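(* Let $X_5\subset\mathbb{P}^3$ be a smooth quintic surface and let $\ell\subset X_5$ be a line. If $\ell$ is met by $28$ other lines on $X_5$, then one of the following holds: $(28_a)$ the line $\ell$ is of ramification type $(3^2)$ and $\mathfrak{b}_1$ vanishes along $\ell$; $(28_b)$ the line $\ell$ is of ramification type $(2^3)$ and $\mathfrak{b}_1$ does not vanish along $\ell$; $(28_c)$ the line $\ell$ is of ramification type $(2,1^4)$.
   Context: The base field $K$ is algebraically closed of characteristic zero. Ramification type: the linear system $|\mathcal{O}_{X_5}(1)-\ell|$ defines a morphism $\pi:X_5\to\mathbb{P}^1$ whose fibers are the plane quartics residual to $\ell$ in the intersections of $X_5$ with planes containing $\ell$. The restriction $\pi|_\ell:\ell\to\mathbb{P}^1$ has degree $4$; its ramification divisor $R_\ell$ has degree $6$. The ramification type lists the multiplicities of the points in $R_\ell$: type $(3^2)$ means $R_\ell=3P_1+3P_2$, type $(2^3)$ means $R_\ell=2(P_1+P_2+P_3)$, and type $(2,1^4)$ means $R_\ell=2P+P_1+P_2+P_3+P_4$, with distinct points in each case. The function $\mathfrak{b}_1$: choose homogeneous coordinates on $\mathbb{P}^3$ with $\ell=V(x_3,x_4)$, let $f$ generate $I(X_5)$, and write $f=\sum_{i,j,k,l}\alpha_{i,j,k,l}\,x_3^i x_4^j x_1^k x_2^l$ (with $\alpha_{i,j,k,l}\in K$, zero unless $i+j+k+l=5$). For $j=1,\dots,4$ put $$\mathfrak{d}_j(f):=\frac{\partial^2 f}{\partial x_j\partial x_3}\cdot\frac{\partial f}{\partial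 x_4}-\frac{\partial^2 f}{\partial x_j\partial x_4}\cdot\frac{\partial f}{\partial x_3}.$$ For a smooth surface containing $\ell$, neither $\partial f/\partial x_4$ nor $\mathfrak{d}_2(f)$ vanishes identically on $\ell$, so one may define the following rational functions on $\ell$: $$A:=-\frac{\mathfrak{d}_1(f)}{\mathfrak{d}_2(f)}\Big|_\ell,\quad B:=\frac{(\partial f/\partial x_3)\,\mathfrak{d}_4(f)-(\partial f/\partial x_4)\,\mathfrak{d}_3(f)}{2\,\mathfrak{d}_2(f)\,(\partial f/\partial x_4)}\Big|_\ell,\quad C:=-\frac{\partial f/\partial x_3}{\partial f/\partial x_4}\Big|_\ell .$$ Then $$\mathfrak{b}_1:=\sum_{\substack{j_1,j_2,j_3\geq 0\\ j_1+j_2\leq 4\\ j_3\leq 1}}\binom{5-(j_1+j_2+j_3)}{4-(j_1+j_2)}\,\alpha_{j_1,j_2,j_3,5-(j_1+j_2+j_3)}\,A^{1-j_3}\,B^{4-(j_1+j_2)}\,C^{j_2}\in K(x_1,x_2).$$ "$\mathfrak{b}_1$ vanishes along $\ell$" means that $\mathfrak{b}_1$ is identically zero as a rational function on $\ell$. *)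

theory Defs
  imports
    "HOL-Analysis.Cartesian_Space"
    "HOL-Library.Poly_Mapping"
    "HOL-Library.Multiset"
    "HOL-Computational_Algebra.Polynomial_Factorial"
begin

section \<open>Polynomials in four variables\<close>

text \<open>
  The variables \<open>x\<^sub>1, \<dots>, x\<^sub>4\<close> are indexed by the four-element type \<open>4\<close>, whose elements are
  \<open>1, 2, 3, 4\<close> (with \<open>4 = 0\<close>); a monomial is its exponent vector.
\<close>

type_synonym 'a mpoly4 = "(4 \<Rightarrow>\<^sub>0 nat) \<Rightarrow>\<^sub>0 'a"

definition insertion :: "('a::zero \<Rightarrow> 'b::comm_semiring_1) \<Rightarrow> (4 \<Rightarrow> 'b) \<Rightarrow> 'a mpoly4 \<Rightarrow> 'b" where
  "insertion h v f =
     (\<Sum>m\<in>Poly_Mapping.keys f.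
        h (Poly_Mapping.lookup f m) * (\<Prod>i\<in>UNIV. v i ^ Poly_Mapping.lookup m i))"

abbreviation eval4 :: "'a::comm_semiring_1 mpoly4 \<Rightarrow> 'a^4 \<Rightarrow> 'a" where
  "eval4 f x \<equiv> insertion (\<lambda>c. c) (\<lambda>i. x $ i) f"

definition partial :: "4 \<Rightarrow> 'a::comm_semiring_1 mpoly4 \<Rightarrow> 'a mpoly4" where
  "partial i f =
     (\<Sum>m\<in>Poly_Mapping.keys f.
        Poly_Mapping.single (m - Poly_Mapping.single i 1)
          (of_nat (Poly_Mapping.lookup m i) * Poly_Mapping.lookup f m))"

definition homogeneous :: "nat \<Rightarrow> 'a::zero mpoly4 \<Rightarrow> bool" where
  "homogeneous d f \<longleftrightarrow>
     (\<forall>m\<in>Poly_Mapping.keys f. (\<Sum>i\<in>UNIV. Poly_Mapping.lookup m i) = d)"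


section \<open>Surfaces and lines in projective three-space\<close>

text \<open>
  A point of projective space is a one-dimensional linear subspace, a line of \<open>\<P>\<^sup>3\<close> a
  two-dimensional linear subspace of \<open>K\<^sup>4\<close>; surfaces are given by their affine cones.
\<close>

definition cone_of :: "'a::comm_semiring_1 mpoly4 \<Rightarrow> ('a^4) set" where
  "cone_of f = {x. eval4 f x = 0}"

text \<open>
  The Jacobian condition forces \<open>f\<close> to be nonzero and squarefree, so that over an algebraically
  closed field \<open>f\<close> generates the homogeneous ideal of its zero set.
\<close>

definition smooth_surface_eq :: "nat \<Rightarrow> 'a::comm_semiring_1 mpoly4 \<Rightarrow> bool" where
  "smooth_surface_eq d f \<longleftrightarrow> homogeneous d f \<and>
     (\<forall>x. x \<noteq> 0 \<and> eval4 f x = 0 \<longrightarrow> (\<exists>i. eval4 (partial i f) x \<noteq> 0))"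

definition proj_line :: "('a::field^4) set \<Rightarrow> bool" where
  "proj_line L \<longleftrightarrow> vec.subspace L \<and> vec.dim L = 2"

definition lines_meeting :: "'a::field mpoly4 \<Rightarrow> ('a^4) set \<Rightarrow> ('a^4) set set" where
  "lines_meeting f L =
     {M. proj_line M \<and> M \<subseteq> cone_of f \<and> M \<noteq> L \<and> M \<inter> L \<noteq> {0}}"


section \<open>Coordinates adapted to a line\<close>

text \<open>A point with new coordinate vector \<open>y\<close> has original coordinate vector \<open>T *v y\<close>.\<close>

definition adapted_coords :: "'a::field^4^4 \<Rightarrow> ('a^4) set \<Rightarrow> bool" where
  "adapted_coords T L \<longleftrightarrow> invertible T \<and> L = (\<lambda>y. T *v y) ` {y. y $ 3 = 0 \<and> y $ 4 = 0}"

definition in_coords :: "'a::comm_semiring_1^4^4 \<Rightarrow> 'a mpoly4 \<Rightarrow> 'a mpoly4" where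
  "in_coords T f =
     insertion (Poly_Mapping.single 0)
       (\<lambda>i. \<Sum>j\<in>UNIV. Poly_Mapping.single (Poly_Mapping.single j 1) (T $ i $ j)) f"


section \<open>Binary forms and restriction to the line \<open>V(x\<^sub>3, x\<^sub>4)\<close>\<close>

text \<open>
  \<open>K[x\<^sub>1, x\<^sub>2]\<close> is \<open>'a poly poly\<close>, with \<open>x\<^sub>2\<close> the outer and \<open>x\<^sub>1\<close> the inner variable, and
  \<open>K(x\<^sub>1, x\<^sub>2)\<close> is its fraction field.
\<close>

abbreviation bconst :: "'a::comm_semiring_1 \<Rightarrow> 'a poly poly" where "bconst c \<equiv> [:[:c:]:]"
abbreviation bX1 :: "'a::comm_semiring_1 poly poly" where "bX1 \<equiv> [:[:0, 1:]:]"
abbreviation bX2 :: "'a::comm_semiring_1 poly poly" where "bX2 \<equiv> [:0, 1:]"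

definition beval :: "'a::comm_semiring_1 poly poly \<Rightarrow> 'a^2 \<Rightarrow> 'a" where
  "beval F p = poly (poly F [:p $ 2:]) (p $ 1)"

definition restrict_line :: "'a::comm_semiring_1 mpoly4 \<Rightarrow> 'a poly poly" where
  "restrict_line f =
     insertion bconst (\<lambda>i. if i = 1 then bX1 else if i = 2 then bX2 else 0) f"

abbreviation rat_on_line :: "'a::field mpoly4 \<Rightarrow> 'a poly poly fract" where
  "rat_on_line f \<equiv> to_fract (restrict_line f)"


section \<open>Ramification type\<close>

text \<open>
  Let \<open>F\<close>, \<open>G\<close> be binary forms of equal degree without common zeros. The fibre of the morphism
  \<open>(F : G) : \<P>\<^sup>1 \<rightarrow> \<P>\<^sup>1\<close> through a point \<open>[p]\<close> is the zero divisor of the form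
  \<open>G(p) F - F(p) G\<close>, and the ramification index at \<open>[p]\<close> is the multiplicity of \<open>[p]\<close> in it.
  (The library constant \<open>multiplicity\<close> would require \<open>K\<close> to carry a chosen gcd structure.) The form
  is nonzero as long as \<open>(F : G)\<close> is not constant.
\<close>

definition ram_index :: "'a::field poly poly \<Rightarrow> 'a poly poly \<Rightarrow> 'a^2 \<Rightarrow> nat" where
  "ram_index F G p =
     Max {n. (bconst (p $ 2) * bX1 - bconst (p $ 1) * bX2) ^ n dvd
             bconst (beval G p) * F - bconst (beval F p) * G}"

definition P1_points :: "('a::field^2) set set" where
  "P1_points = {P. vec.subspace P \<and> vec.dim P = 1}"

text \<open>
  The multiplicity of a point in the ramification divisor. In characteristic zero all ramification
  is tame, so it is the ramification index minus one; the index does not depend on the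
  representative of the point.
\<close>

definition ram_mult :: "'a::field poly poly \<Rightarrow> 'a poly poly \<Rightarrow> ('a^2) set \<Rightarrow> nat" where
  "ram_mult F G P = the_elem (ram_index F G ` (P - {0})) - 1"

text \<open>
  Let \<open>V(f)\<close> be smooth and contain \<open>\<ell> = V(x\<^sub>3, x\<^sub>4)\<close>. The morphism defined by planes through
  \<open>\<ell>\<close> is \<open>(x\<^sub>3 : x\<^sub>4)\<close> away from \<open>\<ell>\<close>. As \<open>f \<equiv> x\<^sub>3 \<partial>f/\<partial>x\<^sub>3 + x\<^sub>4 \<partial>f/\<partial>x\<^sub>4\<close> modulo \<open>(x\<^sub>3, x\<^sub>4)\<^sup>2\<close>
  when the derivatives are restricted to \<open>\<ell>\<close>, it extends to \<open>\<ell>\<close> as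
  \<open>(\<partial>f/\<partial>x\<^sub>4 : -\<partial>f/\<partial>x\<^sub>3)\<close>, which sends a point of \<open>\<ell>\<close> to the plane whose residual curve passes
  through that point.
\<close>

definition line_ram_mult :: "'a::field mpoly4 \<Rightarrow> ('a^2) set \<Rightarrow> nat" where
  "line_ram_mult f =
     ram_mult (restrict_line (partial 4 f)) (- restrict_line (partial 3 f))"

definition ramification_type :: "'a::field mpoly4 \<Rightarrow> nat multiset" where
  "ramification_type f =
     image_mset (line_ram_mult f) (mset_set {P \<in> P1_points. line_ram_mult f P > 0})"


section \<open>The function \<open>\<bb>\<^sub>1\<close>\<close>

definition alpha :: "'a::zero mpoly4 \<Rightarrow> nat \<Rightarrow> nat \<Rightarrow> nat \<Rightarrow> nat \<Rightarrow> 'a" where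
  "alpha f i j k l =
     Poly_Mapping.lookup f
       (Poly_Mapping.single 3 i + Poly_Mapping.single 4 j +
        Poly_Mapping.single 1 k + Poly_Mapping.single 2 l)"

definition dd :: "4 \<Rightarrow> 'a::comm_ring_1 mpoly4 \<Rightarrow> 'a mpoly4" where
  "dd j f = partial j (partial 3 f) * partial 4 f - partial j (partial 4 f) * partial 3 f"

definition ratA :: "'a::field mpoly4 \<Rightarrow> 'a poly poly fract" where
  "ratA f = - (rat_on_line (dd 1 f) / rat_on_line (dd 2 f))"

definition ratB :: "'a::field mpoly4 \<Rightarrow> 'a poly poly fract" where
  "ratB f =
     rat_on_line (partial 3 f * dd 4 f - partial 4 f * dd 3 f) /
     (2 * rat_on_line (dd 2 f) * rat_on_line (partial 4 f))"

definition ratC :: "'a::field mpoly4 \<Rightarrow> 'a poly poly fract" where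
  "ratC f = - (rat_on_line (partial 3 f) / rat_on_line (partial 4 f))"

definition b1 :: "'a::field mpoly4 \<Rightarrow> 'a poly poly fract" where
  "b1 f =
     (\<Sum>(j1, j2, j3) \<in> {(j1, j2, j3). j1 + j2 \<le> 4 \<and> j3 \<le> 1}.
        of_nat ((5 - (j1 + j2 + j3)) choose (4 - (j1 + j2))) *
        to_fract (bconst (alpha f j1 j2 j3 (5 - (j1 + j2 + j3)))) *
        ratA f ^ (1 - j3) * ratB f ^ (4 - (j1 + j2)) * ratC f ^ j2)"

end

(*
  Cut V(f) with the planes through the line. A line of V(f) through a point P of the line lies in
  the tangent plane at P, and if P is not a ramification point it must be the tangent T_P of the
  residual quartic at P. Restrict f to T_P, with a parameter s centred at P: the coefficients of
  s^0, s^1, s^2 vanish, those of s^3, s^4, s^5 are, up to a power of the ramification form J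
  (degree 6), forms in P of degree 26, 35 and 44, and T_P lies on V(f) iff all three vanish at P.
  The form of degree 35 is b_1 up to nonzero factors, provided that the one of degree 26 vanishes
  identically. At a point where J vanishes to order m = 1, 2, 3 a local analysis compares the number
  of lines through P with the order of vanishing of these forms at P. For the form of degree 26 the
  order is at least the number of lines. For the form of degree 35, if the first one is zero, it
  exceeds this number by at least 2, 2, 5 respectively, and for the form of degree 44, if the first
  two are zero, by at least 3, 6, 8.

  So 28 lines force the first form to vanish. With n_m points of multiplicity m we have
  n_1 + 2 n_2 + 3 n_3 = 6. If the second form is nonzero, then 2 n_1 + 2 n_2 + 5 n_3 <= 35 - 28,
  hence n_2 = 3; if it is zero, then 3 n_1 + 6 n_2 + 8 n_3 <= 44 - 28, hence n_3 = 2. In particular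
  the third alternative of the corollary does not occur.
*)

theory Submission
  imports Defs
begin

section \<open>Hasse derivatives and reversed polynomials\<close>

text \<open>With q = \<open>contact_coeff F 2 0\<close>, the coefficient of s^2 in a tangent
  direction (z : w) is w (z J + w q), so T_P has direction (-q : J). Where J has order m > 0 this
  may degenerate, and for the last two forms the local analysis splits according to whether
  \<open>\<pi> ^ m\<close> divides q. If it does, T_P has a limit at the point; the forms,
  homogeneous of degree 3 and 4 in q and J, inherit \<open>\<pi>\<close> to the powers 3 m and 4 m,
  against at most m + 1 lines. If it does not, the vanishing of the first form and a congruence
  between q' and \<open>contact_coeff F 2 1\<close> leave so few lines that a weaker divisibility
  suffices. The degrees 26, 35, 44 are smaller than the summands suggest. They come from the change
  of chart exchanging x_1 and x_2, which also makes the point at infinity an ordinary point. A form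
  transforms properly only when the earlier ones vanish, so the counts must be made in succession.
  The last form cannot vanish too: T_P would lie on the surface for every unramified P, giving
  infinitely many lines.\<close>

definition hasse :: "nat \<Rightarrow> 'a::comm_semiring_1 poly \<Rightarrow> 'a poly" where
  "hasse k p = (\<Sum>l\<le>degree p. monom (of_nat (l choose k) * coeff p l) (l - k))"

lemma coeff_hasse: "coeff (hasse k p) n = of_nat ((n + k) choose k) * coeff p (n + k)"
proof -
  have "coeff (hasse k p) n =
      (\<Sum>l\<le>degree p. if l = n + k then of_nat (l choose k) * coeff p l else 0)"
    unfolding hasse_def coeff_sum
    by (intro sum.cong) (auto simp: coeff_monom binomial_eq_0)
  also have "\<dots> = of_nat ((n + k) choose k) * coeff p (n + k)"
    by (simp add: coeff_eq_0)
  finally show ?thesis .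
qed

lemma hasse_0 [simp]: "hasse 0 p = p"
  by (simp add: poly_eq_iff coeff_hasse)

lemma hasse_1: "hasse (Suc 0) p = pderiv p"
  by (simp add: poly_eq_iff coeff_hasse coeff_pderiv)

lemma pderiv_hasse_1:
  fixes p :: "'a::idom poly"
  shows "pderiv (hasse (Suc 0) p) = 2 * hasse 2 p"
proof -
  have "Suc n * (n + 2) = 2 * ((n + 2) choose 2)" for n
    by (simp add: choose_two)
  then have "of_nat (Suc n) * of_nat (n + 2) = (2 * of_nat ((n + 2) choose 2) :: 'a)" for n
    by (metis of_nat_mult of_nat_numeral)
  then show ?thesis
    by (auto simp add: poly_eq_iff coeff_hasse coeff_pderiv numeral_poly mult.assoc[symmetric])
qed

lemma hasse_add: "hasse k (p + q) = hasse k p + hasse k q"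
  by (simp add: poly_eq_iff coeff_hasse algebra_simps)

lemma hasse_smult: "hasse k (smult c p) = smult c (hasse k p)"
  by (simp add: poly_eq_iff coeff_hasse algebra_simps)

lemma hasse_eq_0: "degree p < k \<Longrightarrow> hasse k p = 0"
  by (simp add: poly_eq_iff coeff_hasse coeff_eq_0)

lemma hasse_pCons: "hasse (Suc k) (pCons a p) = pCons 0 (hasse (Suc k) p) + hasse k p"
  by (rule poly_eqI) (auto simp: coeff_hasse coeff_pCons algebra_simps binomial_eq_0 split: nat.splits)

text \<open>Induction on \<open>p\<close>, with \<open>hasse_pCons\<close> as the Leibniz rule for
  the factor x. The induction hypothesis enters with bound \<open>e\<close> for the factor s and
  with bound \<open>Suc e\<close> for the factor t.\<close>

lemma poly_taylor:
  fixes p :: "'a::comm_ring_1 poly"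
  assumes "degree p \<le> d"
  shows "poly p (t + s) = (\<Sum>k\<le>d. poly (hasse k p) t * s ^ k)"
  using assms
proof (induction p arbitrary: d)
  case 0
  then show ?case by (simp add: hasse_def)
next
  case (pCons a p)
  show ?case
  proof (cases d)
    case 0
    with pCons have "p = 0" by (auto split: if_splits)
    then show ?thesis using 0 by simp
  next
    case (Suc e)
    then have "degree p \<le> e" using pCons.prems by (auto split: if_splits)
    then have IH: "poly p (t + s) = (\<Sum>k\<le>e. poly (hasse k p) t * s ^ k)" 
      and IH': "poly p (t + s) = (\<Sum>k\<le>Suc e. poly (hasse k p) t * s ^ k)"
      using pCons.IH[of e] pCons.IH[of "Suc e"] by auto
    have "(\<Sum>k\<le>Suc e. poly (hasse k (pCons a p)) t * s ^ k) =
        a + t * (poly p t + (\<Sum>k\<le>e. poly (hasse (Suc k) p) t * s ^ Suc k)) +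
        s * (\<Sum>k\<le>e. poly (hasse k p) t * s ^ k)"
      by (simp only: sum.atMost_Suc_shift hasse_pCons sum_distrib_left)
         (simp add: distrib_left distrib_right sum.distrib sum_distrib_left mult_ac add_ac)
    also have "poly p t + (\<Sum>k\<le>e. poly (hasse (Suc k) p) t * s ^ Suc k) = poly p (t + s)"
      by (subst IH', subst sum.atMost_Suc_shift) simp
    also note IH[symmetric]
    finally show ?thesis unfolding Suc by (simp add: algebra_simps)
  qed
qed

text \<open>The form of degree \<open>d\<close> with dehomogenisation \<open>p\<close>, read in the
  other chart. Unlike \<open>reflect_poly\<close> it keeps \<open>d\<close> fixed, so its order at 0
  is the order of the form at infinity.\<close>

definition rev_poly :: "nat \<Rightarrow> 'a::comm_semiring_1 poly \<Rightarrow> 'a poly" where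
  "rev_poly d p = (\<Sum>l\<le>d. monom (coeff p l) (d - l))"

lemma coeff_rev_poly: "coeff (rev_poly d p) n = (if n \<le> d then coeff p (d - n) else 0)"
proof -
  have "coeff (rev_poly d p) n = (\<Sum>l\<le>d. if l = d - n then (if n \<le> d then coeff p l else 0) else 0)"
    unfolding rev_poly_def coeff_sum by (intro sum.cong) (auto simp: coeff_monom)
  then show ?thesis by simp
qed

lemma degree_rev_poly: "degree (rev_poly d p) \<le> d"
  by (rule degree_le) (simp add: coeff_rev_poly)

lemma rev_rev_poly: "degree p \<le> d \<Longrightarrow> rev_poly d (rev_poly d p) = p"
  by (auto simp: poly_eq_iff coeff_rev_poly coeff_eq_0)

lemma rev_poly_0 [simp]: "rev_poly d 0 = 0"
  by (simp add: poly_eq_iff coeff_rev_poly)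

lemma poly_altdef': "degree p \<le> d \<Longrightarrow> poly p (x::'a::comm_semiring_1) = (\<Sum>l\<le>d. coeff p l * x ^ l)"
  unfolding poly_altdef by (rule sum.mono_neutral_left) (auto simp: coeff_eq_0)

lemma poly_rev_poly:
  fixes p :: "'a::field poly"
  assumes "degree p \<le> d" "y \<noteq> 0"
  shows "poly (rev_poly d p) y = y ^ d * poly p (1 / y)"
  unfolding poly_altdef'[OF assms(1)] rev_poly_def poly_sum poly_monom sum_distrib_left
  using assms(2) by (intro sum.cong) (auto simp: field_simps power_diff)

text \<open>Source of the degree bounds for \<open>jac\<close> and the contact polynomials: y^d
  p(1/y) has a pole at 0 if the degree of p exceeds d, and agreement with the polynomial
  \<open>q\<close> rules this out.\<close>

lemma rev_polyI:
  fixes p q :: "'a::field_char_0 poly"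
  assumes "finite B" "\<And>y. y \<notin> B \<Longrightarrow> y \<noteq> 0 \<Longrightarrow> poly q y = y ^ d * poly p (1 / y)"
  shows "degree p \<le> d \<and> q = rev_poly d p"
proof -
  define N where "N = degree p + d"
  \<comment> \<open>Multiplication by y^(N - d), where N - d is the degree of \<open>p\<close>,
    makes both sides polynomials before any bound on that degree is known.\<close>
  have *: "monom 1 (N - d) * q = rev_poly N p"
  proof (rule ccontr)
    assume "monom 1 (N - d) * q \<noteq> rev_poly N p"
    then have "finite {y. poly (monom 1 (N - d) * q - rev_poly N p) y = 0}"
      by (intro poly_roots_finite) simp
    moreover have "- (insert 0 B) \<subseteq> {y. poly (monom 1 (N - d) * q - rev_poly N p) y = 0}"
      using assms(2) by (auto simp: poly_rev_poly N_def poly_monom power_add)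
    ultimately have "finite (- insert 0 B)" by (rule finite_subset[rotated])
    then show False using assms(1) by (simp add: finite_compl infinite_UNIV_char_0)
  qed
  have "coeff (monom 1 (N - d) * q) n = coeff (rev_poly N p) n" for n
    by (simp only: *)
  then have eq: "(if n < N - d then 0 else coeff q (n - (N - d))) = (if n \<le> N then coeff p (N - n) else 0)" for n
    by (simp only: coeff_rev_poly coeff_monom_mult mult_1)
  have "degree p \<le> d"
  proof (rule degree_le, intro allI impI)
    fix i assume "d < i"
    show "coeff p i = 0"
    proof (cases "i \<le> N")
      case True
      then show ?thesis using eq[of "N - i"] \<open>d < i\<close> by (auto split: if_splits)
    next
      case False then show ?thesis by (simp add: N_def coeff_eq_0)
    qed
  qed
  moreover have "coeff q n = coeff (rev_poly d p) n" for n
    using eq[of "n + (N - d)"] by (auto simp: coeff_rev_poly N_def)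
  ultimately show ?thesis by (simp add: poly_eq_iff)
qed

lemma order_rev_poly:
  fixes p :: "'a::field_char_0 poly"
  assumes "p \<noteq> 0" "degree p \<le> d"
  shows "order 0 (rev_poly d p) = d - degree p"
proof -
  have "rev_poly d p = monom 1 (d - degree p) * reflect_poly p"
    by (rule poly_eqI)
      (use assms in \<open>auto simp: coeff_rev_poly coeff_monom_mult coeff_reflect_poly coeff_eq_0\<close>)
  moreover have "order 0 (reflect_poly p) = 0" using assms
    by (simp add: order_0I)
  moreover have "reflect_poly p \<noteq> 0" using assms(1) by auto
  ultimately show ?thesis
    by (subst \<open>rev_poly d p = _\<close>, subst order_mult) auto
qed

section \<open>Contact of lines with the surface\<close>

lemma poly_eqI_cofinite:
  fixes p q :: "'a::field_char_0 poly"
  assumes "finite B" "\<And>x. x \<notin> B \<Longrightarrow> poly p x = poly q x"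
  shows "p = q"
proof (rule ccontr)
  assume "p \<noteq> q"
  then have "finite {x. poly (p - q) x = 0}" by (intro poly_roots_finite) simp
  moreover have "- B \<subseteq> {x. poly (p - q) x = 0}" using assms(2) by auto
  ultimately have "finite (- B)" by (rule finite_subset[rotated])
  then show False using assms(1) by (simp add: finite_compl infinite_UNIV_char_0)
qed

text \<open>
  A family \<open>F\<close> encodes the form \<open>\<Sum> x\<^sub>3^i x\<^sub>4^j F i j\<close>, dehomogenised by \<open>x\<^sub>1 = 1\<close>, \<open>x\<^sub>2\<close> being
  the variable of the polynomials. Put \<open>a = F 1 0\<close> and \<open>b = F 0 1\<close>; the tangent plane at \<open>(1, t, 0, 0)\<close> is
  spanned by the line and \<open>(0, 0, b t, - a t)\<close>. Along \<open>s \<mapsto> (1, t + s z, s w b t, - s w a t)\<close> the form is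
  \<open>line_fun F t z w s\<close>, and \<open>contact F t m z w\<close> is its coefficient of \<open>s^m\<close>.
\<close>

definition contact_coeff :: "(nat \<Rightarrow> nat \<Rightarrow> 'a::comm_ring_1 poly) \<Rightarrow> nat \<Rightarrow> nat \<Rightarrow> 'a poly" where
  "contact_coeff F n k = (\<Sum>i\<le>n. hasse k (F i (n - i)) * F 0 1 ^ i * (- F 1 0) ^ (n - i))"

definition contact :: "(nat \<Rightarrow> nat \<Rightarrow> 'a::comm_ring_1 poly) \<Rightarrow> 'a \<Rightarrow> nat \<Rightarrow> 'a \<Rightarrow> 'a \<Rightarrow> 'a" where
  "contact F t m z w = (\<Sum>n=1..m. w ^ n * z ^ (m - n) * poly (contact_coeff F n (m - n)) t)"

definition line_fun :: "(nat \<Rightarrow> nat \<Rightarrow> 'a::comm_ring_1 poly) \<Rightarrow> 'a \<Rightarrow> 'a \<Rightarrow> 'a \<Rightarrow> 'a \<Rightarrow> 'a" where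
  "line_fun F t z w s = (\<Sum>n=1..5. (s * w) ^ n *
     (\<Sum>i\<le>n. poly (F 0 1) t ^ i * (- poly (F 1 0) t) ^ (n - i) * poly (F i (n - i)) (t + s * z)))"

text \<open>With a = \<open>F 1 0\<close> and b = \<open>F 0 1\<close> this is the Wronskian a' b -
  b' a of the map (b : -a) from the line to the pencil of planes, that is, the ramification form
  J.\<close>

definition jac :: "(nat \<Rightarrow> nat \<Rightarrow> 'a::comm_ring_1 poly) \<Rightarrow> 'a poly" where
  "jac F = contact_coeff F 1 1"

text \<open>
  The contact coefficients in the tangent direction \<open>z = - contact_coeff F 2 0\<close>, \<open>w = jac F\<close>, divided by
  \<open>jac F\<close>; see \<open>contact_canonical\<close>.
\<close>

definition contact3_poly :: "(nat \<Rightarrow> nat \<Rightarrow> 'a::comm_ring_1 poly) \<Rightarrow> 'a poly" where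
  "contact3_poly F = contact_coeff F 1 2 * contact_coeff F 2 0 ^ 2 - jac F * contact_coeff F 2 0 * contact_coeff F 2 1 + jac F ^ 2 * contact_coeff F 3 0"

definition contact4_poly :: "(nat \<Rightarrow> nat \<Rightarrow> 'a::comm_ring_1 poly) \<Rightarrow> 'a poly" where
  "contact4_poly F = - (contact_coeff F 1 3 * contact_coeff F 2 0 ^ 3) + jac F * contact_coeff F 2 2 * contact_coeff F 2 0 ^ 2
     - jac F ^ 2 * contact_coeff F 3 1 * contact_coeff F 2 0 + jac F ^ 3 * contact_coeff F 4 0"

definition contact5_poly :: "(nat \<Rightarrow> nat \<Rightarrow> 'a::comm_ring_1 poly) \<Rightarrow> 'a poly" where
  "contact5_poly F = contact_coeff F 1 4 * contact_coeff F 2 0 ^ 4 - jac F * contact_coeff F 2 3 * contact_coeff F 2 0 ^ 3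
     + jac F ^ 2 * contact_coeff F 3 2 * contact_coeff F 2 0 ^ 2 - jac F ^ 3 * contact_coeff F 4 1 * contact_coeff F 2 0 + jac F ^ 4 * contact_coeff F 5 0"

text \<open>The family of the chart \<open>x\<^sub>2 = 1\<close>, in which the point at infinity is \<open>0\<close>.\<close>

definition flip :: "(nat \<Rightarrow> nat \<Rightarrow> 'a::comm_ring_1 poly) \<Rightarrow> nat \<Rightarrow> nat \<Rightarrow> 'a poly" where
  "flip F i j = rev_poly (5 - i - j) (F i j)"

lemma contact_coeff_1_0: "contact_coeff F 1 0 = 0" "contact_coeff F (Suc 0) 0 = 0"
  by (simp_all add: contact_coeff_def)

lemma contact_2: "contact F t 2 z w = w * z * poly (jac F) t + w ^ 2 * poly (contact_coeff F 2 0) t"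
  by (simp add: contact_def jac_def numeral_eq_Suc)

lemma contact_3: "contact F t 3 z w =
    w * z ^ 2 * poly (contact_coeff F 1 2) t + w ^ 2 * z * poly (contact_coeff F 2 1) t + w ^ 3 * poly (contact_coeff F 3 0) t"
  by (simp add: contact_def numeral_eq_Suc)

lemma contact_4: "contact F t 4 z w =
    w * z ^ 3 * poly (contact_coeff F 1 3) t + w ^ 2 * z ^ 2 * poly (contact_coeff F 2 2) t +
    w ^ 3 * z * poly (contact_coeff F 3 1) t + w ^ 4 * poly (contact_coeff F 4 0) t"
  by (simp add: contact_def numeral_eq_Suc)

lemma contact_5: "contact F t 5 z w =
    w * z ^ 4 * poly (contact_coeff F 1 4) t + w ^ 2 * z ^ 3 * poly (contact_coeff F 2 3) t +
    w ^ 3 * z ^ 2 * poly (contact_coeff F 3 2) t + w ^ 4 * z * poly (contact_coeff F 4 1) t + w ^ 5 * poly (contact_coeff F 5 0) t"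
  by (simp add: contact_def numeral_eq_Suc)

lemma contact_scale: "contact F t m (c * z) (c * w) = c ^ m * contact F t m z w"
  unfolding contact_def sum_distrib_left
proof (intro sum.cong refl)
  fix n assume "n \<in> {1..m}"
  then have "c ^ m = c ^ n * c ^ (m - n)" by (simp flip: power_add)
  then show "(c * w) ^ n * (c * z) ^ (m - n) * poly (contact_coeff F n (m - n)) t =
      c ^ m * (w ^ n * z ^ (m - n) * poly (contact_coeff F n (m - n)) t)"
    by (simp add: power_mult_distrib mult_ac)
qed

text \<open>Every term of \<open>contact\<close> has a factor w, here J. Splitting it off once
  leaves the contact polynomials, homogeneous of degree m - 1 in \<open>contact_coeff F 2 0\<close>
  and J.\<close>

lemma contact_canonical:
  defines "Z F t \<equiv> - poly (contact_coeff F 2 0) t" and "W F t \<equiv> poly (jac F) t"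
  shows "contact F t 2 (Z F t) (W F t) = 0"
    "contact F t 3 (Z F t) (W F t) = poly (jac F) t * poly (contact3_poly F) t"
    "contact F t 4 (Z F t) (W F t) = poly (jac F) t * poly (contact4_poly F) t"
    "contact F t 5 (Z F t) (W F t) = poly (jac F) t * poly (contact5_poly F) t"
  unfolding contact_2 contact_3 contact_4 contact_5 Z_def W_def contact3_poly_def contact4_poly_def contact5_poly_def
  by (simp_all add: algebra_simps power2_eq_square power3_eq_cube numeral_eq_Suc)

locale quintic_family =
  fixes F :: "nat \<Rightarrow> nat \<Rightarrow> 'a::field_char_0 poly"
  assumes degree_F: "degree (F i j) \<le> 5 - i - j"
    and F_0_0: "F 0 0 = 0"
begin

text \<open>The expansion starts at s^2: the only candidate for s^1 is
  \<open>contact_coeff F 1 0\<close> = a b - b a = 0, which expresses that the direction lies in the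
  tangent plane.\<close>

lemma line_fun_expand:
  "line_fun F t z w s = (\<Sum>m=2..5. contact F t m z w * s ^ m)"
proof -
  have "line_fun F t z w s = (\<Sum>n=1..5. (s * w) ^ n * (\<Sum>k\<le>5-n. (s * z) ^ k * poly (contact_coeff F n k) t))"
    unfolding line_fun_def
  proof (rule sum.cong[OF refl])
    fix n :: nat
    have "(\<Sum>i\<le>n. poly (F 0 1) t ^ i * (- poly (F 1 0) t) ^ (n - i) * poly (F i (n - i)) (t + s * z)) =
      (\<Sum>i\<le>n. \<Sum>k\<le>5-n. (s * z) ^ k * poly (hasse k (F i (n - i)) * F 0 1 ^ i * (- F 1 0) ^ (n - i)) t)"
    proof (intro sum.cong refl)
      fix i assume "i \<in> {..n}"
      then have "degree (F i (n - i)) \<le> 5 - n" using degree_F[of i "n - i"] by simp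
      then show "poly (F 0 1) t ^ i * (- poly (F 1 0) t) ^ (n - i) * poly (F i (n - i)) (t + s * z) =
        (\<Sum>k\<le>5-n. (s * z) ^ k * poly (hasse k (F i (n - i)) * F 0 1 ^ i * (- F 1 0) ^ (n - i)) t)"
        by (simp add: poly_taylor sum_distrib_left mult_ac)
    qed
    also have "\<dots> = (\<Sum>k\<le>5-n. (s * z) ^ k * poly (contact_coeff F n k) t)"
      by (subst sum.swap) (simp add: contact_coeff_def poly_sum sum_distrib_left mult_ac)
    finally show "(s * w) ^ n * (\<Sum>i\<le>n. poly (F 0 1) t ^ i * (- poly (F 1 0) t) ^ (n - i) *
        poly (F i (n - i)) (t + s * z)) =
      (s * w) ^ n * (\<Sum>k\<le>5-n. (s * z) ^ k * poly (contact_coeff F n k) t)" by (simp only:)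
  qed
  also have "\<dots> = (\<Sum>m=2..5. contact F t m z w * s ^ m)"
    by (simp add: contact_def numeral_eq_Suc contact_coeff_1_0 algebra_simps)
  finally show ?thesis .
qed

text \<open>
  A line in one chart is a line in the other one, with its parameter changed by a homography; comparing
  coefficients shows how the contact polynomials transform and bounds their degrees.
\<close>

lemma line_fun_flip:
  assumes "y \<noteq> 0" "y + s * z \<noteq> 0"
  shows "line_fun (flip F) y z w s =
    (y + s * z) ^ 5 * line_fun F (1 / y) (- (z / y)) (w * y ^ 4) (s / (y + s * z))"
  unfolding line_fun_def sum_distrib_left
proof (intro sum.cong refl)
  fix n i :: nat
  define Y where "Y = y + s * z"
  assume n: "n \<in> {1..5}" and i: "i \<in> {..n}"
  have Y: "Y \<noteq> 0" using assms Y_def by simp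
  \<comment> \<open>Division of the coordinates by \<open>Y\<close> moves the point Y of the chart
    x_2 = 1 to 1/Y, reached from 1/y with parameter s/Y and slope -z/y.\<close>
  have arg: "1 / y + s / Y * - (z / y) = 1 / Y"
  proof -
    have "1 / y + s / Y * - (z / y) = (Y - s * z) / (y * Y)"
      using assms(1) Y by (simp add: field_simps)
    also have "Y - s * z = y" by (simp add: Y_def)
    finally show ?thesis using assms(1) by simp
  qed
  have dF: "degree (F i (n - i)) \<le> 5 - n" using degree_F[of i "n - i"] i by simp
  have 1: "poly (flip F i (n - i)) Y = Y ^ (5 - n) * poly (F i (n - i)) (1 / Y)"
    using dF Y i by (simp add: flip_def poly_rev_poly)
  have 2: "poly (flip F 0 1) y = y ^ 4 * poly (F 0 1) (1 / y)"
    "poly (flip F 1 0) y = y ^ 4 * poly (F 1 0) (1 / y)"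
    using degree_F[of 0 1] degree_F[of 1 0] assms(1) by (simp_all add: flip_def poly_rev_poly)
  have 3: "(y ^ 4) ^ n = (y ^ 4) ^ i * (y ^ 4) ^ (n - i)" using i by (simp flip: power_add)
  have 4: "Y ^ 5 / Y ^ n = Y ^ (5 - n)" using n Y by (simp add: power_diff)
  have "(y + s * z) ^ 5 * ((s / (y + s * z) * (w * y ^ 4)) ^ n *
      (poly (F 0 1) (1 / y) ^ i * (- poly (F 1 0) (1 / y)) ^ (n - i) *
       poly (F i (n - i)) (1 / y + s / (y + s * z) * - (z / y)))) =
    (s * w) ^ n * (y ^ 4) ^ n * (Y ^ 5 / Y ^ n) * (poly (F 0 1) (1 / y) ^ i *
      (- poly (F 1 0) (1 / y)) ^ (n - i) * poly (F i (n - i)) (1 / Y))"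
    unfolding Y_def[symmetric] arg by (simp add: power_mult_distrib power_divide)
  also have "\<dots> = (s * w) ^ n * (poly (flip F 0 1) y ^ i * (- poly (flip F 1 0) y) ^ (n - i) *
      poly (flip F i (n - i)) Y)"
    unfolding 1 2 3 4 mult_minus_right[symmetric] power_mult_distrib by (simp only: mult_ac)
  finally show "(s * w) ^ n * (poly (flip F 0 1) y ^ i * (- poly (flip F 1 0) y) ^ (n - i) *
      poly (flip F i (n - i)) (y + s * z)) =
    (y + s * z) ^ 5 * ((s / (y + s * z) * (w * y ^ 4)) ^ n *
      (poly (F 0 1) (1 / y) ^ i * (- poly (F 1 0) (1 / y)) ^ (n - i) *
       poly (F i (n - i)) (1 / y + s / (y + s * z) * - (z / y))))"
    by (simp add: Y_def)
qed

end

lemma (in quintic_family) quintic_family_flip: "quintic_family (flip F)"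
  by unfold_locales (simp_all add: flip_def degree_rev_poly F_0_0)

section \<open>The contact polynomials under the change of chart\<close>

context quintic_family begin

text \<open>The binomial factors come from expanding the sum of \<open>X k\<close> s^k (y + s z)^(5
  - k). The system is triangular: \<open>X 2\<close> and \<open>X 3\<close> leak into the later
  contacts, which therefore transform like forms only once the earlier ones vanish.\<close>

lemma contact_flip:
  fixes y z w :: 'a
  assumes "y \<noteq> 0"
  defines "X m \<equiv> contact F (1 / y) m (- (z / y)) (w * y ^ 4)"
  shows "contact (flip F) y 2 z w = y ^ 3 * X 2"
    "contact (flip F) y 3 z w = y ^ 2 * X 3 + 3 * y ^ 2 * z * X 2"
    "contact (flip F) y 4 z w = y * X 4 + 2 * y * z * X 3 + 3 * y * z ^ 2 * X 2"
    "contact (flip F) y 5 z w = X 5 + z * X 4 + z ^ 2 * X 3 + z ^ 3 * X 2"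
proof -
  interpret flip: quintic_family "flip F" by (rule quintic_family_flip)
  define X' where "X' m = contact (flip F) y m z w" for m
  define B where "B = {s. y + s * z = 0}"
  have "B = {s. poly [:y, z:] s = 0}" by (simp add: B_def)
  then have "finite B" using poly_roots_finite[of "[:y, z:]"] assms(1) by simp
  moreover have "poly [:0, 0, X' 2, X' 3, X' 4, X' 5:] s =
      poly [:0, 0, y ^ 3 * X 2, y ^ 2 * X 3 + 3 * y ^ 2 * z * X 2,
        y * X 4 + 2 * y * z * X 3 + 3 * y * z ^ 2 * X 2, X 5 + z * X 4 + z ^ 2 * X 3 + z ^ 3 * X 2:] s"
    if "s \<notin> B" for s
  proof -
    define Y where "Y = y + s * z"
    have Y: "Y \<noteq> 0" using that by (simp add: B_def Y_def)
    have "(\<Sum>m=2..5. X' m * s ^ m) = Y ^ 5 * (\<Sum>m=2..5. X m * (s / Y) ^ m)"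
      using line_fun_flip[OF assms(1), of s z w] Y
      by (simp add: flip.line_fun_expand line_fun_expand X'_def X_def Y_def)
    also have "\<dots> = (\<Sum>m=2..5. X m * s ^ m * Y ^ (5 - m))"
      unfolding sum_distrib_left using Y
      by (intro sum.cong) (auto simp: power_diff power_divide)
    finally show ?thesis
      by (simp add: numeral_eq_Suc Y_def algebra_simps)
  qed
  ultimately have "[:0, 0, X' 2, X' 3, X' 4, X' 5:] =
      [:0, 0, y ^ 3 * X 2, y ^ 2 * X 3 + 3 * y ^ 2 * z * X 2,
        y * X 4 + 2 * y * z * X 3 + 3 * y * z ^ 2 * X 2, X 5 + z * X 4 + z ^ 2 * X 3 + z ^ 3 * X 2:]"
    by (rule poly_eqI_cofinite)
  then show "contact (flip F) y 2 z w = y ^ 3 * X 2"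
    "contact (flip F) y 3 z w = y ^ 2 * X 3 + 3 * y ^ 2 * z * X 2"
    "contact (flip F) y 4 z w = y * X 4 + 2 * y * z * X 3 + 3 * y * z ^ 2 * X 2"
    "contact (flip F) y 5 z w = X 5 + z * X 4 + z ^ 2 * X 3 + z ^ 3 * X 2"
    by (auto simp: X'_def)
qed

lemma poly_jac_flip: "y \<noteq> 0 \<Longrightarrow> poly (jac (flip F)) y = - (y ^ 6) * poly (jac F) (1 / y)"
  and poly_contact_coeff_2_0_flip: "y \<noteq> 0 \<Longrightarrow> poly (contact_coeff (flip F) 2 0) y = y ^ 11 * poly (contact_coeff F 2 0) (1 / y)"
proof -
  assume y: "y \<noteq> 0"
  have 0: "poly (contact_coeff (flip F) 2 0) y = y ^ 11 * poly (contact_coeff F 2 0) (1 / y)"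
  proof -
    have "poly (contact_coeff (flip F) 2 0) y = y ^ 3 * ((y ^ 4)\<^sup>2 * poly (contact_coeff F 2 0) (1 / y))"
      using contact_flip(1)[OF y, of 0 1] by (simp add: contact_2)
    then show ?thesis by algebra
  qed
  then show "poly (contact_coeff (flip F) 2 0) y = y ^ 11 * poly (contact_coeff F 2 0) (1 / y)" .
  have "poly (jac (flip F)) y + poly (contact_coeff (flip F) 2 0) y =
      y ^ 3 * (- (y ^ 4 * poly (jac F) (1 / y) / y) + (y ^ 4) ^ 2 * poly (contact_coeff F 2 0) (1 / y))"
    using contact_flip(1)[OF y, of 1 1] by (simp add: contact_2)
  also have "\<dots> = - (y ^ 6) * poly (jac F) (1 / y) + y ^ 11 * poly (contact_coeff F 2 0) (1 / y)"
  proof -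
    have "y * (y ^ 4 * poly (jac F) (1 / y) / y) = y ^ 4 * poly (jac F) (1 / y)" using y by simp
    then show ?thesis by algebra
  qed
  finally show "poly (jac (flip F)) y = - (y ^ 6) * poly (jac F) (1 / y)"
    using 0 by simp
qed

text \<open>The canonical direction of \<open>flip F\<close> is -(y^10) times that of
  \<open>F\<close>, so the contact of index m gains y^(10 m) and a sign (-1)^m;
  \<open>contact_flip\<close> adds y^(5 - m), and cancelling w = -(y^6) J removes y^6. Hence the
  exponents 9 m - 1 = 26, 35, 44 and the minus sign for m = 4.\<close>

lemma poly_contact_poly_flip:
  assumes "y \<noteq> 0" "poly (jac F) (1 / y) \<noteq> 0"
  shows "poly (contact3_poly (flip F)) y = y ^ 26 * poly (contact3_poly F) (1 / y)"
    and "contact3_poly F = 0 \<Longrightarrow> poly (contact4_poly (flip F)) y = - (y ^ 35) * poly (contact4_poly F) (1 / y)"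
    and "contact3_poly F = 0 \<Longrightarrow> contact4_poly F = 0 \<Longrightarrow> poly (contact5_poly (flip F)) y = y ^ 44 * poly (contact5_poly F) (1 / y)"
proof -
  define z w where "z = - poly (contact_coeff (flip F) 2 0) y" and "w = poly (jac (flip F)) y"
  define J where "J = poly (jac F) (1 / y)"
  have J: "J \<noteq> 0" using assms by (simp add: J_def)
  have zw: "- (z / y) = - (y ^ 10) * - poly (contact_coeff F 2 0) (1 / y)" "w * y ^ 4 = - (y ^ 10) * J"
  proof -
    have "y ^ 11 = y ^ 10 * y" by algebra
    then have "z = (y ^ 10 * - poly (contact_coeff F 2 0) (1 / y)) * y"
      using assms(1) by (simp add: z_def poly_contact_coeff_2_0_flip)
    then show "- (z / y) = - (y ^ 10) * - poly (contact_coeff F 2 0) (1 / y)"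
      using assms(1) by simp
    show "w * y ^ 4 = - (y ^ 10) * J"
      using assms(1) by (simp add: w_def poly_jac_flip J_def)
  qed
  have w: "w = - (y ^ 6) * J" by (simp add: w_def J_def poly_jac_flip assms)
  have w0: "w \<noteq> 0" using J assms(1) by (simp add: w)
  define X where "X m = contact F (1 / y) m (- (z / y)) (w * y ^ 4)" for m
  have X: "X m = (- (y ^ 10)) ^ m * contact F (1 / y) m (- poly (contact_coeff F 2 0) (1 / y)) J" for m
    unfolding X_def zw contact_scale ..
  note can = contact_canonical[of F "1 / y", folded J_def]
  note can' = contact_canonical[of "flip F" y, folded z_def w_def]
  note cf = contact_flip[OF assms(1), of z w, folded X_def]
  have X2: "X 2 = 0" by (simp add: X can)
  have X3: "X 3 = - (y ^ 30) * J * poly (contact3_poly F) (1 / y)"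
    by (simp add: X can power_minus_odd flip: power_mult)
  have X4: "X 4 = y ^ 40 * J * poly (contact4_poly F) (1 / y)"
    by (simp add: X can flip: power_mult)
  have X5: "X 5 = - (y ^ 50) * J * poly (contact5_poly F) (1 / y)"
    by (simp add: X can power_minus_odd flip: power_mult)
  have "w * poly (contact3_poly (flip F)) y = y ^ 2 * (- (y ^ 30) * J * poly (contact3_poly F) (1 / y))"
    using cf(2) can'(2) X2 X3 by simp
  also have "\<dots> = w * (y ^ 26 * poly (contact3_poly F) (1 / y))"
    unfolding w by algebra
  finally show "poly (contact3_poly (flip F)) y = y ^ 26 * poly (contact3_poly F) (1 / y)"
    using w0 by (rule mult_left_cancel[THEN iffD1, rotated])
  assume contact3_poly: "contact3_poly F = 0"
  then have X3': "X 3 = 0" by (simp add: X3)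
  have "w * poly (contact4_poly (flip F)) y = y * (y ^ 40 * J * poly (contact4_poly F) (1 / y))"
    using cf(3) can'(3) X2 X3' X4 by simp
  also have "\<dots> = w * (- (y ^ 35) * poly (contact4_poly F) (1 / y))"
    unfolding w by algebra
  finally show "poly (contact4_poly (flip F)) y = - (y ^ 35) * poly (contact4_poly F) (1 / y)"
    using w0 by (rule mult_left_cancel[THEN iffD1, rotated])
  assume contact4_poly: "contact4_poly F = 0"
  then have X4': "X 4 = 0" by (simp add: X4)
  have "w * poly (contact5_poly (flip F)) y = - (y ^ 50) * J * poly (contact5_poly F) (1 / y)"
    using cf(4) can'(4) X2 X3' X4' X5 by simp
  also have "\<dots> = w * (y ^ 44 * poly (contact5_poly F) (1 / y))"
    unfolding w by algebra
  finally show "poly (contact5_poly (flip F)) y = y ^ 44 * poly (contact5_poly F) (1 / y)"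
    using w0 by (rule mult_left_cancel[THEN iffD1, rotated])
qed

lemma jac_flip: "degree (jac F) \<le> 6 \<and> jac (flip F) = - rev_poly 6 (jac F)"
proof -
  have "degree (jac F) \<le> 6 \<and> - jac (flip F) = rev_poly 6 (jac F)"
    by (rule rev_polyI[where B = "{}"]) (auto simp: poly_jac_flip)
  then show ?thesis by (metis minus_minus)
qed

lemma contact_poly_flip:
  assumes "jac F \<noteq> 0"
  shows "degree (contact3_poly F) \<le> 26 \<and> contact3_poly (flip F) = rev_poly 26 (contact3_poly F)"
    and "contact3_poly F = 0 \<Longrightarrow> degree (contact4_poly F) \<le> 35 \<and> contact4_poly (flip F) = - rev_poly 35 (contact4_poly F)"
    and "contact3_poly F = 0 \<Longrightarrow> contact4_poly F = 0 \<Longrightarrow> degree (contact5_poly F) \<le> 44 \<and> contact5_poly (flip F) = rev_poly 44 (contact5_poly F)"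
proof -
  define B where "B = (\<lambda>x. 1 / x) ` {x. poly (jac F) x = 0}"
  have fin: "finite B" unfolding B_def using assms by (intro finite_imageI poly_roots_finite)
  have nz: "poly (jac F) (1 / y) \<noteq> 0" if "y \<notin> B" "y \<noteq> 0" for y
    using that unfolding B_def by (metis (mono_tags) image_eqI mem_Collect_eq div_by_1 divide_divide_eq_right mult_1)
  show "degree (contact3_poly F) \<le> 26 \<and> contact3_poly (flip F) = rev_poly 26 (contact3_poly F)"
    by (rule rev_polyI[OF fin]) (simp add: poly_contact_poly_flip nz)
  assume contact3_poly: "contact3_poly F = 0"
  have "degree (contact4_poly F) \<le> 35 \<and> - contact4_poly (flip F) = rev_poly 35 (contact4_poly F)"
    by (rule rev_polyI[OF fin]) (simp add: poly_contact_poly_flip(2) contact3_poly nz)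
  then show "degree (contact4_poly F) \<le> 35 \<and> contact4_poly (flip F) = - rev_poly 35 (contact4_poly F)"
    by (metis minus_minus)
  assume contact4_poly: "contact4_poly F = 0"
  show "degree (contact5_poly F) \<le> 44 \<and> contact5_poly (flip F) = rev_poly 44 (contact5_poly F)"
    by (rule rev_polyI[OF fin]) (simp add: poly_contact_poly_flip(3) contact3_poly contact4_poly nz)
qed

end

section \<open>Local analysis at a point of the line\<close>

text \<open>\<open>T p\<close> is the shifted polynomial p(t + s). It is multiplicative in p and
  sends \<open>[:- t, 1:] ^ e\<close> to s^e, which shifts the Taylor coefficients by e.\<close>

lemma hasse_linear_power:
  fixes g :: "'a::field_char_0 poly"
  shows "poly (hasse k ([:- t, 1:] ^ e * g)) t = (if k < e then 0 else poly (hasse (k - e) g) t)"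
proof -
  define T where "T p = (\<Sum>k\<le>degree p. monom (poly (hasse k p) t) k)" for p :: "'a poly"
  have coeff_T: "coeff (T p) k = poly (hasse k p) t" for p k
    by (simp add: T_def coeff_sum coeff_monom hasse_eq_0)
  have poly_T: "poly (T p) s = poly p (t + s)" for p s
    by (simp add: T_def poly_sum poly_monom poly_taylor[OF order_refl])
  have "T ([:- t, 1:] ^ e * g) = monom 1 e * T g"
    by (rule poly_eqI_cofinite[of "{}"]) (simp_all add: poly_T poly_monom)
  then have "coeff (T ([:- t, 1:] ^ e * g)) k = coeff (monom 1 e * T g) k" by simp
  then show ?thesis by (simp only: coeff_T coeff_monom_mult) auto
qed

lemma hasse_order:
  fixes p :: "'a::field_char_0 poly"
  assumes "p \<noteq> 0"
  shows "k < order t p \<Longrightarrow> poly (hasse k p) t = 0"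
    and "poly (hasse (order t p) p) t \<noteq> 0"
proof -
  obtain g where g: "p = [:- t, 1:] ^ order t p * g" "\<not> [:- t, 1:] dvd g"
    using order_decomp[OF assms] by blast
  show "k < order t p \<Longrightarrow> poly (hasse k p) t = 0"
    using hasse_linear_power[of k t "order t p" g] g(1) by simp
  show "poly (hasse (order t p) p) t \<noteq> 0"
    using hasse_linear_power[of "order t p" t "order t p" g] g by (simp add: poly_eq_0_iff_dvd)
qed

text \<open>Slopes of the lines on the surface in the tangent plane, other than the given line: that
  one has w = 0, and any other direction scales to w = 1. The indices 2 to 5 are those of
  \<open>line_fun_expand\<close>.\<close>

definition lines_at :: "(nat \<Rightarrow> nat \<Rightarrow> 'a::comm_ring_1 poly) \<Rightarrow> 'a \<Rightarrow> 'a set" where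
  "lines_at F t = {z. \<forall>m\<in>{2..5}. contact F t m z 1 = 0}"

lemma lines_at_iff: "z \<in> lines_at F t \<longleftrightarrow>
    contact F t 2 z 1 = 0 \<and> contact F t 3 z 1 = 0 \<and> contact F t 4 z 1 = 0 \<and> contact F t 5 z 1 = 0"
proof -
  have "{2..5::nat} = {2, 3, 4, 5}" by auto
  then show ?thesis by (simp add: lines_at_def)
qed

text \<open>As a polynomial in z, this contact has degree at most m + 1, and its coefficient of z^(m
  + 1) comes from the term n = 1 alone.\<close>

lemma contact_roots:
  fixes F :: "nat \<Rightarrow> nat \<Rightarrow> 'a::field_char_0 poly"
  assumes "poly (contact_coeff F 1 (Suc m)) t \<noteq> 0"
  shows "finite {z. contact F t (m + 2) z 1 = 0}" "card {z. contact F t (m + 2) z 1 = 0} \<le> Suc m"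
proof -
  define R where "R = (\<Sum>n=1..m+2. monom (poly (contact_coeff F n (m + 2 - n)) t) (m + 2 - n))"
  have R: "poly R z = contact F t (m + 2) z 1" for z
    by (simp add: R_def contact_def poly_sum poly_monom mult_ac del: sum.cl_ivl_Suc)
  have "coeff R (Suc m) = (\<Sum>n=1..m+2. if n = 1 then poly (contact_coeff F n (m + 2 - n)) t else 0)"
    unfolding R_def coeff_sum by (intro sum.cong) (auto simp: coeff_monom)
  then have "coeff R (Suc m) = poly (contact_coeff F 1 (Suc m)) t" by (simp del: sum.cl_ivl_Suc)
  then have "coeff R (Suc m) \<noteq> 0" using assms by simp
  then have "R \<noteq> 0" by auto
  moreover have "degree R \<le> Suc m"
    unfolding R_def by (intro degree_sum_le) (auto intro: order_trans[OF degree_monom_le])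
  ultimately show "finite {z. contact F t (m + 2) z 1 = 0}"
    "card {z. contact F t (m + 2) z 1 = 0} \<le> Suc m"
    using card_poly_roots_bound[of R] poly_roots_finite[of R] by (simp_all add: R)
qed

text \<open>Gap between order of vanishing and number of lines. If the tangent direction has a
  limit, the orders 3 m, and 4 m for \<open>contact5_loss\<close>, face at most m + 1 lines: gaps 1,
  3, 5 and 2, 5, 8. With m + 1 lines an additional zero raises the 1 to 2, the 2 to 3 and the second
  5 to 6; m = 2 without a limit lowers the 3 to 2.\<close>

definition contact4_loss :: "nat \<Rightarrow> nat" where
  "contact4_loss m = (if m = 0 then 0 else if m < 3 then 2 else 5)"

definition contact5_loss :: "nat \<Rightarrow> nat" where
  "contact5_loss m = (if m = 0 then 0 else if m = 1 then 3 else if m = 2 then 6 else 8)"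

locale smooth_at = quintic_family F for F :: "nat \<Rightarrow> nat \<Rightarrow> 'a::field_char_0 poly" +
  fixes t :: 'a
  assumes base: "poly (F 0 1) t \<noteq> 0 \<or> poly (F 1 0) t \<noteq> 0"
    and jac: "jac F \<noteq> 0"
begin

definition m where "m = order t (jac F)"
definition \<pi> where "\<pi> = [:- t, 1:]"
text \<open>The restriction to the line of the residual quartic through the point \<open>t\<close>.\<close>

definition fibre where
  "fibre = smult (poly (F 0 1) t) (F 1 0) - smult (poly (F 1 0) t) (F 0 1)"

abbreviation a where "a \<equiv> F 1 0"
abbreviation b where "b \<equiv> F 0 1"

lemma contact_coeff_1: "contact_coeff F 1 k = hasse k a * b - hasse k b * a"
  by (simp add: contact_coeff_def)

text \<open>At the point itself, the terms of \<open>contact\<close> linear in w thus carry the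
  Taylor coefficients of \<open>fibre\<close>; its order at t, which turns out to be m + 1, decides
  which of them vanish.\<close>

lemma poly_contact_coeff_1: "poly (contact_coeff F 1 k) t = poly (hasse k fibre) t"
  unfolding contact_coeff_1 fibre_def diff_conv_add_uminus smult_minus_left[symmetric] hasse_add hasse_smult
  by simp

lemma jac_eq: "jac F = pderiv a * b - pderiv b * a"
  unfolding jac_def contact_coeff_1 by (simp add: hasse_1)

text \<open>The product a' b' cancels in the derivative of the Wronskian. This determines the order
  m - 1 of \<open>contact_coeff F 1 2\<close> at a ramified point, and its leading
  coefficient.\<close>

lemma pderiv_jac: "pderiv (jac F) = 2 * contact_coeff F 1 2"
  unfolding jac_eq contact_coeff_1
  by (simp add: pderiv_diff pderiv_mult pderiv_hasse_1[unfolded hasse_1] algebra_simps)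

lemma poly_fibre: "poly fibre t = 0"
  by (simp add: fibre_def)

lemma jac_fibre:
  "smult (poly b t) (jac F) = pderiv fibre * b - fibre * pderiv b"
  "smult (poly a t) (jac F) = pderiv fibre * a - fibre * pderiv a"
  by (simp_all add: jac_eq fibre_def pderiv_diff pderiv_smult algebra_simps smult_diff_right)

lemma fibre_nonzero: "fibre \<noteq> 0"
  using jac_fibre base jac by auto

text \<open>By \<open>jac_fibre\<close>, J is up to a constant the Wronskian of \<open>fibre\<close>
  and of a or b, whichever is nonzero at t. The Wronskian of \<open>\<pi> ^ Suc e * g\<close> with a
  polynomial nonzero at t has order exactly e, since e + 1 is invertible in characteristic
  0.\<close>

lemma order_fibre: "order t fibre = Suc m"
proof -
  have pos: "order t fibre \<noteq> 0" using fibre_nonzero poly_fibre order_root by blast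
  then obtain e where e: "order t fibre = Suc e" by (cases "order t fibre") auto
  obtain g where g: "fibre = \<pi> ^ Suc e * g" "\<not> \<pi> dvd g"
    using order_decomp[OF fibre_nonzero] e \<pi>_def by metis
  have "order t (jac F) = e" if c: "c = poly h t" "c \<noteq> 0"
    "smult c (jac F) = pderiv fibre * h - fibre * pderiv h" for c h
  proof -
    define r where "r = smult (of_nat (Suc e)) (g * h) + \<pi> * (pderiv g * h - g * pderiv h)"
    have "pderiv fibre = \<pi> ^ Suc e * pderiv g + smult (of_nat (Suc e)) (g * \<pi> ^ e)"
      unfolding g(1) \<pi>_def by (rule lemma_order_pderiv1)
    then have eq: "smult c (jac F) = \<pi> ^ e * r"
      unfolding c(3) r_def g(1) by (simp add: algebra_simps del: of_nat_Suc)
    have "poly r t = of_nat (Suc e) * (poly g t * c)"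
      by (simp add: r_def c \<pi>_def del: of_nat_Suc)
    moreover have "poly g t \<noteq> 0" using g(2) by (simp add: \<pi>_def poly_eq_0_iff_dvd)
    ultimately have r: "poly r t \<noteq> 0" using c(2) by (simp del: of_nat_Suc)
    then have "r \<noteq> 0" by auto
    have "order t (\<pi> ^ e) = e" unfolding \<pi>_def by (rule order_power_n_n)
    then have "order t (\<pi> ^ e * r) = e" using \<open>r \<noteq> 0\<close> r
      by (subst order_mult) (auto simp: \<pi>_def order_0I)
    then show ?thesis using order_smult[OF c(2), of t "jac F"] by (simp add: eq)
  qed
  from this[of "poly b t" b] this[of "poly a t" a] base jac_fibre have "m = e"
    unfolding m_def by blast
  then show ?thesis using e by simp
qed

lemma m_le: "m \<le> 3"
proof -
  have "degree fibre \<le> 4" unfolding fibre_def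
    using degree_F[of 0 1] degree_F[of 1 0]
    by (intro degree_diff_le) (auto intro: order_trans[OF degree_smult_le])
  then show ?thesis
    using order_degree[OF fibre_nonzero, of t] order_fibre by linarith
qed

lemma contact_coeff_1_low: "k \<le> m \<Longrightarrow> poly (contact_coeff F 1 k) t = 0"
  and contact_coeff_1_top: "poly (contact_coeff F 1 (Suc m)) t \<noteq> 0"
  unfolding poly_contact_coeff_1
  using hasse_order(1)[OF fibre_nonzero, of k t] hasse_order(2)[OF fibre_nonzero, of t]
  by (auto simp: order_fibre)

text \<open>The contact of index m + 2, at most 5 by \<open>m_le\<close>, is one of the defining
  conditions and has at most m + 1 roots. If there are m + 1 lines, they exhaust these roots; this
  is what \<open>lines_full\<close> exploits.\<close>

lemma finite_lines: "finite (lines_at F t)"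
  and card_lines: "card (lines_at F t) \<le> Suc m"
  and lines_full: "card (lines_at F t) = Suc m \<Longrightarrow> contact F t (m + 2) z 1 = 0 \<Longrightarrow> z \<in> lines_at F t"
proof -
  have sub: "lines_at F t \<subseteq> {z. contact F t (m + 2) z 1 = 0}"
    using m_le by (auto simp: lines_at_def)
  note R = contact_roots[of F m t, OF contact_coeff_1_top]
  show "finite (lines_at F t)" using sub R(1) by (rule finite_subset)
  show "card (lines_at F t) \<le> Suc m" using card_mono[OF R(1) sub] R(2) by simp
  show "z \<in> lines_at F t" if "card (lines_at F t) = Suc m" "contact F t (m + 2) z 1 = 0"
    using card_subset_eq[OF R(1) sub] that R(2) card_mono[OF R(1) sub] by auto
qed

lemma pi_dvd_iff: "\<pi> dvd p \<longleftrightarrow> poly p t = 0"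
  by (simp add: \<pi>_def poly_eq_0_iff_dvd)

lemma pi_nonzero: "\<pi> \<noteq> 0"
  by (simp add: \<pi>_def)

definition jt where "jt = (SOME j. jac F = \<pi> ^ m * j)"

lemma jac_pi: "jac F = \<pi> ^ m * jt"
proof -
  have "\<pi> ^ m dvd jac F" unfolding \<pi>_def m_def by (rule order_1)
  then show ?thesis unfolding jt_def dvd_def by (rule someI_ex)
qed

lemma poly_jt: "poly jt t \<noteq> 0"
proof
  assume "poly jt t = 0"
  then have "\<pi> dvd jt" by (simp add: pi_dvd_iff)
  then have "\<pi> ^ Suc m dvd jac F" unfolding jac_pi by (subst power_Suc2) (rule mult_dvd_mono, auto)
  then show False using order_2[OF jac, of t] by (simp add: \<pi>_def m_def)
qed

lemma contact_coeff_1_2_pi: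
  assumes "m = Suc k"
  shows "2 * contact_coeff F 1 2 = \<pi> ^ k * (smult (of_nat m) jt + \<pi> * pderiv jt)"
  unfolding pderiv_jac[symmetric] jac_pi assms \<pi>_def lemma_order_pderiv1
  by (simp add: algebra_simps del: of_nat_Suc)

text \<open>\<open>contact_coeff F 2 0\<close> is a quadratic form in (b, -a), and
  \<open>contact_coeff F 2 1\<close> differentiates its coefficients only. The rest differentiates b
  and a; after multiplication by b or a it becomes a multiple of the form itself modulo J, because
  a' b - b' a = J.\<close>

lemma pderiv_contact_coeff_2_0:
  "b * (pderiv (contact_coeff F 2 0) - contact_coeff F 2 1) = 2 * pderiv b * contact_coeff F 2 0 + jac F * (2 * F 0 2 * a - F 1 1 * b)"
  "a * (pderiv (contact_coeff F 2 0) - contact_coeff F 2 1) = 2 * pderiv a * contact_coeff F 2 0 + jac F * (F 1 1 * a - 2 * F 2 0 * b)"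
proof -
  have q0: "contact_coeff F 2 0 = F 2 0 * b * b - F 1 1 * b * a + F 0 2 * a * a"
    by (simp add: contact_coeff_def numeral_eq_Suc algebra_simps)
  have q1: "contact_coeff F 2 1 = pderiv (F 2 0) * b * b - pderiv (F 1 1) * b * a + pderiv (F 0 2) * a * a"
    by (simp add: contact_coeff_def numeral_eq_Suc algebra_simps hasse_1)
  show "b * (pderiv (contact_coeff F 2 0) - contact_coeff F 2 1) = 2 * pderiv b * contact_coeff F 2 0 + jac F * (2 * F 0 2 * a - F 1 1 * b)"
    "a * (pderiv (contact_coeff F 2 0) - contact_coeff F 2 1) = 2 * pderiv a * contact_coeff F 2 0 + jac F * (F 1 1 * a - 2 * F 2 0 * b)"
    unfolding q0 q1 jac_eq
    by (simp_all add: pderiv_add pderiv_diff pderiv_mult) algebra+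
qed

text \<open>In \<open>pderiv_contact_coeff_2_0\<close> the factor b or a, whichever is nonzero at t,
  can be cancelled modulo powers of \<open>\<pi>\<close>; k \<le> m makes the term with J
  disappear.\<close>

lemma q1_congruence:
  assumes "\<pi> ^ k dvd contact_coeff F 2 0" "k \<le> m"
  shows "\<pi> ^ k dvd pderiv (contact_coeff F 2 0) - contact_coeff F 2 1"
proof -
  have "\<pi> ^ k dvd jac F" using assms(2) by (simp add: jac_pi le_imp_power_dvd)
  then have *: "\<pi> ^ k dvd b * (pderiv (contact_coeff F 2 0) - contact_coeff F 2 1)"
    "\<pi> ^ k dvd a * (pderiv (contact_coeff F 2 0) - contact_coeff F 2 1)"
    unfolding pderiv_contact_coeff_2_0 using assms(1) by (auto intro!: dvd_add)
  have "\<pi> ^ k dvd r" if "poly c t \<noteq> 0" "\<pi> ^ k dvd c * r" for c r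
  proof (cases "r = 0")
    case False
    then have "c * r \<noteq> 0" using that(1) by auto
    then have "k \<le> order t c + order t r"
      using that(2) order_divides[of t k "c * r"] by (simp add: order_mult \<pi>_def)
    moreover have "order t c = 0" using that(1) by (rule order_0I)
    ultimately show ?thesis unfolding \<pi>_def order_divides by simp
  qed simp
  from this[of b] this[of a] * base show ?thesis by blast
qed

end

section \<open>Lines through a point against the order of the contact polynomials\<close>

context smooth_at begin

lemma poly_pi: "poly \<pi> t = 0"
  by (simp add: \<pi>_def)

lemma pderiv_pi: "pderiv \<pi> = 1"
  by (simp add: \<pi>_def pderiv_pCons)

lemma jac_0_iff: "poly (jac F) t = 0 \<longleftrightarrow> m \<noteq> 0"
  using jac order_root[of "jac F" t] by (simp add: m_def)

text \<open>Where J is nonzero, the contact of index 2 has a single root z, so a line can only have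
  the canonical direction.\<close>

lemma unramified_line:
  assumes "z \<in> lines_at F t" "m = 0"
  shows "poly (contact3_poly F) t = 0" "poly (contact4_poly F) t = 0" "poly (contact5_poly F) t = 0"
proof -
  let ?J = "poly (jac F) t"
  have J: "?J \<noteq> 0" using assms(2) jac_0_iff by simp
  have z: "- poly (contact_coeff F 2 0) t = ?J * z"
    using assms(1) by (auto simp: lines_at_iff contact_2 algebra_simps add_eq_0_iff)
  have "contact F t k (- poly (contact_coeff F 2 0) t) ?J = 0" if "k \<in> {2..5}" for k
    unfolding z using contact_scale[of F t k ?J z 1] assms(1) that by (auto simp: lines_at_def)
  then show "poly (contact3_poly F) t = 0" "poly (contact4_poly F) t = 0" "poly (contact5_poly F) t = 0"
    using contact_canonical[of F t] J by force+
qed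

lemma unramified:
  assumes "m = 0"
  shows "\<pi> ^ card (lines_at F t) dvd contact3_poly F" "\<pi> ^ card (lines_at F t) dvd contact4_poly F"
    "\<pi> ^ card (lines_at F t) dvd contact5_poly F"
proof -
  have "card (lines_at F t) = 0 \<or> card (lines_at F t) = 1"
    using card_lines assms by auto
  moreover have "\<exists>z. z \<in> lines_at F t" if "card (lines_at F t) = 1"
    using that by (auto simp: card_1_singleton_iff)
  ultimately show "\<pi> ^ card (lines_at F t) dvd contact3_poly F" "\<pi> ^ card (lines_at F t) dvd contact4_poly F"
    "\<pi> ^ card (lines_at F t) dvd contact5_poly F"
    using unramified_line assms by (auto simp: pi_dvd_iff)
qed

lemma contact_coeff_1_2_factor:
  assumes "m = Suc k"
  obtains d where "contact_coeff F 1 2 = \<pi> ^ k * d" "2 * poly d t = of_nat m * poly jt t"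
proof
  let ?e = "smult (of_nat m) jt + \<pi> * pderiv jt"
  have "contact_coeff F 1 2 = smult (1 / 2) (2 * contact_coeff F 1 2)" by (simp add: numeral_poly)
  then show "contact_coeff F 1 2 = \<pi> ^ k * smult (1 / 2) ?e" using contact_coeff_1_2_pi[OF assms] by simp
  show "2 * poly (smult (1 / 2) ?e) t = of_nat m * poly jt t" by (simp add: \<pi>_def)
qed

text \<open>At a ramified point J vanishes, so a single line already forces
  \<open>contact_coeff F 2 0\<close> to vanish. As \<open>\<pi> ^ (m - 1)\<close> divides
  \<open>contact_coeff F 1 2\<close>, each summand then has order at least m + 1, the maximal number
  of lines.\<close>

theorem card_lines_contact3: "\<pi> ^ card (lines_at F t) dvd contact3_poly F"
proof (cases "m = 0 \<or> card (lines_at F t) = 0")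
  case True
  then show ?thesis using unramified by auto
next
  case False
  then obtain k where k: "m = Suc k" by (cases m) auto
  obtain d where d: "contact_coeff F 1 2 = \<pi> ^ k * d" using contact_coeff_1_2_factor[OF k] by metis
  obtain z where "z \<in> lines_at F t" using False by (metis card.empty ex_in_conv)
  then have "poly (contact_coeff F 2 0) t = 0"
    using False jac_0_iff by (simp add: lines_at_iff contact_2)
  then obtain q where q: "contact_coeff F 2 0 = \<pi> * q" by (auto simp: dvd_def simp flip: pi_dvd_iff)
  have "contact3_poly F = \<pi> ^ Suc m * (d * q\<^sup>2 - jt * q * contact_coeff F 2 1 + \<pi> ^ k * jt\<^sup>2 * contact_coeff F 3 0)"
    unfolding contact3_poly_def d q jac_pi k by (simp add: algebra_simps power2_eq_square)
  then have "\<pi> ^ Suc m dvd contact3_poly F" by simp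
  then show ?thesis using card_lines power_le_dvd by blast
qed

lemma contact_normalise:
  "contact F t n (- poly q t) (poly jt t) = 0 \<longleftrightarrow> contact F t n (- poly q t / poly jt t) 1 = 0"
  using contact_scale[of F t n "poly jt t" "- poly q t / poly jt t" 1] poly_jt by simp

text \<open>By homogeneity in \<open>contact_coeff F 2 0\<close> and J the common factor
  \<open>\<pi> ^ m\<close> comes out to the power 2, 3 or 4. The value of the cofactor at t is the
  contact in the limit direction \<open>z\<close>, up to a power of \<open>jt\<close>.\<close>

lemma contact_poly_factor:
  assumes q: "contact_coeff F 2 0 = \<pi> ^ m * q"
  defines "z \<equiv> - poly q t / poly jt t"
  shows "\<exists>c. contact3_poly F = \<pi> ^ (2 * m) * c \<and> (contact F t 3 z 1 = 0 \<longleftrightarrow> poly c t = 0)"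
    "\<exists>c. contact4_poly F = \<pi> ^ (3 * m) * c \<and> (contact F t 4 z 1 = 0 \<longleftrightarrow> poly c t = 0)"
    "\<exists>c. contact5_poly F = \<pi> ^ (4 * m) * c \<and> (contact F t 5 z 1 = 0 \<longleftrightarrow> poly c t = 0)"
proof -
  define p where "p = \<pi> ^ m"
  have p: "\<pi> ^ (2 * m) = p ^ 2" "\<pi> ^ (3 * m) = p ^ 3" "\<pi> ^ (4 * m) = p ^ 4"
    "contact_coeff F 2 0 = p * q" "jac F = p * jt"
    by (simp_all add: p_def q jac_pi power_mult[symmetric] mult.commute)
  define cc where "cc = contact_coeff F 1 2 * q ^ 2 - jt * q * contact_coeff F 2 1 + jt ^ 2 * contact_coeff F 3 0"
  have "contact3_poly F = \<pi> ^ (2 * m) * cc" unfolding contact3_poly_def p cc_def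
    by (simp add: algebra_simps power_mult_distrib numeral_eq_Suc)
  moreover have "contact F t 3 (- poly q t) (poly jt t) = poly jt t * poly cc t"
    unfolding contact_3 cc_def by (simp add: algebra_simps numeral_eq_Suc)
  ultimately show "\<exists>c. contact3_poly F = \<pi> ^ (2 * m) * c \<and> (contact F t 3 z 1 = 0 \<longleftrightarrow> poly c t = 0)"
    unfolding z_def contact_normalise[symmetric] using poly_jt by auto
  define cb where "cb = - (contact_coeff F 1 3 * q ^ 3) + jt * contact_coeff F 2 2 * q ^ 2
    - jt ^ 2 * contact_coeff F 3 1 * q + jt ^ 3 * contact_coeff F 4 0"
  have "contact4_poly F = \<pi> ^ (3 * m) * cb" unfolding contact4_poly_def p cb_def
    by (simp add: algebra_simps power_mult_distrib numeral_eq_Suc)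
  moreover have "contact F t 4 (- poly q t) (poly jt t) = poly jt t * poly cb t"
    unfolding contact_4 cb_def by (simp add: algebra_simps numeral_eq_Suc)
  ultimately show "\<exists>c. contact4_poly F = \<pi> ^ (3 * m) * c \<and> (contact F t 4 z 1 = 0 \<longleftrightarrow> poly c t = 0)"
    unfolding z_def contact_normalise[symmetric] using poly_jt by auto
  define cg where "cg = contact_coeff F 1 4 * q ^ 4 - jt * contact_coeff F 2 3 * q ^ 3
    + jt ^ 2 * contact_coeff F 3 2 * q ^ 2 - jt ^ 3 * contact_coeff F 4 1 * q + jt ^ 4 * contact_coeff F 5 0"
  have "contact5_poly F = \<pi> ^ (4 * m) * cg" unfolding contact5_poly_def p cg_def
    by (simp add: algebra_simps power_mult_distrib numeral_eq_Suc)
  moreover have "contact F t 5 (- poly q t) (poly jt t) = poly jt t * poly cg t"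
    unfolding contact_5 cg_def by (simp add: algebra_simps numeral_eq_Suc)
  ultimately show "\<exists>c. contact5_poly F = \<pi> ^ (4 * m) * c \<and> (contact F t 5 z 1 = 0 \<longleftrightarrow> poly c t = 0)"
    unfolding z_def contact_normalise[symmetric] using poly_jt by auto
qed

text \<open>
  If \<open>\<pi> ^ m\<close> divides \<open>contact_coeff F 2 0\<close>, the tangent direction has a limit at \<open>t\<close>. When there are as
  many lines as possible, this limit is one of them, which gives an additional zero.
\<close>

lemma regular_case:
  assumes "\<pi> ^ m dvd contact_coeff F 2 0" "m > 0" "contact3_poly F = 0"
  shows "\<pi> ^ (card (lines_at F t) + contact4_loss m) dvd contact4_poly F"
    and "contact4_poly F = 0 \<Longrightarrow> \<pi> ^ (card (lines_at F t) + contact5_loss m) dvd contact5_poly F"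
proof -
  obtain q where q: "contact_coeff F 2 0 = \<pi> ^ m * q" using assms(1) by (auto simp: dvd_def)
  define z where "z = - poly q t / poly jt t"
  obtain cc where cc: "contact3_poly F = \<pi> ^ (2 * m) * cc" "contact F t 3 z 1 = 0 \<longleftrightarrow> poly cc t = 0"
    using contact_poly_factor(1)[OF q] unfolding z_def by blast
  obtain cb where cb: "contact4_poly F = \<pi> ^ (3 * m) * cb" "contact F t 4 z 1 = 0 \<longleftrightarrow> poly cb t = 0"
    using contact_poly_factor(2)[OF q] unfolding z_def by blast
  obtain cg where cg: "contact5_poly F = \<pi> ^ (4 * m) * cg" "contact F t 5 z 1 = 0 \<longleftrightarrow> poly cg t = 0"
    using contact_poly_factor(3)[OF q] unfolding z_def by blast
  have contact3_poly: "contact F t 3 z 1 = 0" using cc assms(3) pi_nonzero by auto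
  have b: "\<pi> ^ (3 * m) dvd contact4_poly F" using cb by simp
  have g: "\<pi> ^ (4 * m) dvd contact5_poly F" using cg by simp
  have b': "\<pi> ^ Suc (3 * m) dvd contact4_poly F" if "z \<in> lines_at F t"
    using that cb by (auto simp: lines_at_iff power_Suc2 simp flip: pi_dvd_iff simp del: power_Suc)
  have g': "\<pi> ^ Suc (4 * m) dvd contact5_poly F" if "z \<in> lines_at F t"
    using that cg by (auto simp: lines_at_iff power_Suc2 simp flip: pi_dvd_iff simp del: power_Suc)
  \<comment> \<open>\<open>lines_full\<close> asks for the contact of index m + 2 at the limit:
    index 3 for m = 1, known from \<open>contact3_poly F = 0\<close>, and index 4 for m = 2, for
    which \<open>contact4_poly F = 0\<close> is needed.\<close>
  have full: "z \<in> lines_at F t" if "card (lines_at F t) = Suc m" "m = 1 \<or> m = 2 \<and> contact4_poly F = 0"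
    using that lines_full[of z] contact3_poly cb pi_nonzero by (auto simp: numeral_eq_Suc)
  have m: "m = 1 \<or> m = 2 \<or> m = 3" using assms(2) m_le by auto
  show "\<pi> ^ (card (lines_at F t) + contact4_loss m) dvd contact4_poly F"
  proof (cases "card (lines_at F t) = Suc m \<and> m = 1")
    case True
    then show ?thesis using b' full by (simp add: contact4_loss_def numeral_eq_Suc)
  next
    case False
    then have "card (lines_at F t) + contact4_loss m \<le> 3 * m"
      using m card_lines by (auto simp: contact4_loss_def)
    then show ?thesis using b power_le_dvd by blast
  qed
  show "\<pi> ^ (card (lines_at F t) + contact5_loss m) dvd contact5_poly F" if "contact4_poly F = 0"
  proof (cases "card (lines_at F t) = Suc m \<and> m < 3")
    case True
    then have "\<pi> ^ Suc (4 * m) dvd contact5_poly F" using g' full m that by auto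
    moreover have "card (lines_at F t) + contact5_loss m \<le> Suc (4 * m)"
      using m True by (auto simp: contact5_loss_def)
    ultimately show ?thesis using power_le_dvd by blast
  next
    case False
    then have "card (lines_at F t) + contact5_loss m \<le> 4 * m"
      using m card_lines by (auto simp: contact5_loss_def)
    then show ?thesis using g power_le_dvd by blast
  qed
qed

text \<open>The summand with \<open>contact_coeff F 1 2\<close> has a factor
  \<open>\<pi> ^ (m - 1)\<close> with cofactor d nonzero at t; all others have order at least m. So
  the square next to d must vanish at t.\<close>

lemma q0_vanishes:
  assumes "m > 0" "contact3_poly F = 0"
  shows "\<pi> dvd contact_coeff F 2 0"
proof -
  obtain k where k: "m = Suc k" using assms(1) by (cases m) auto
  obtain d where d: "contact_coeff F 1 2 = \<pi> ^ k * d" "2 * poly d t = of_nat m * poly jt t"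
    using contact_coeff_1_2_factor[OF k] by metis
  have "poly d t \<noteq> 0" using d(2) poly_jt k by (auto simp del: of_nat_Suc)
  have "\<pi> ^ k * (d * contact_coeff F 2 0 ^ 2 + \<pi> * (- jt * contact_coeff F 2 0 * contact_coeff F 2 1 + \<pi> ^ m * jt ^ 2 * contact_coeff F 3 0)) = contact3_poly F"
    unfolding contact3_poly_def d jac_pi k by (simp add: algebra_simps power2_eq_square)
  then have "d * contact_coeff F 2 0 ^ 2 + \<pi> * (- jt * contact_coeff F 2 0 * contact_coeff F 2 1 + \<pi> ^ m * jt ^ 2 * contact_coeff F 3 0) = 0"
    using assms(2) pi_nonzero by simp
  then have "poly (d * contact_coeff F 2 0 ^ 2 + \<pi> * (- jt * contact_coeff F 2 0 * contact_coeff F 2 1 + \<pi> ^ m * jt ^ 2 * contact_coeff F 3 0)) t = 0"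
    by (simp only: poly_0)
  then have "poly d t * poly (contact_coeff F 2 0) t ^ 2 = 0" by (simp add: poly_pi)
  then show ?thesis using \<open>poly d t \<noteq> 0\<close> by (simp add: pi_dvd_iff)
qed

text \<open>Here \<open>contact_coeff F 2 0\<close> has order 1, so by the congruence
  \<open>contact_coeff F 2 1\<close> is nonzero at t, and the contact of index 3 is linear in z
  since \<open>contact_coeff F 1 2\<close> vanishes for m = 2. In \<open>contact4_poly\<close> the
  first summand has order exactly 3, the others more.\<close>

lemma ramified_2:
  assumes "m = 2" "contact3_poly F = 0" "\<not> \<pi> ^ 2 dvd contact_coeff F 2 0"
  shows "card (lines_at F t) \<le> 1" "\<pi> ^ 3 dvd contact4_poly F" "contact4_poly F \<noteq> 0"
proof -
  obtain q where q: "contact_coeff F 2 0 = \<pi> * q" using q0_vanishes assms by (auto simp: dvd_def)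
  have qt: "poly q t \<noteq> 0"
    using assms(3) by (auto simp: q power2_eq_square pi_nonzero simp flip: pi_dvd_iff)
  have "poly (pderiv (contact_coeff F 2 0)) t = poly q t"
    by (simp add: q pderiv_mult pderiv_pi poly_pi)
  moreover have "\<pi> ^ 1 dvd pderiv (contact_coeff F 2 0) - contact_coeff F 2 1"
    by (rule q1_congruence) (simp_all add: q assms(1))
  ultimately have q1: "poly (contact_coeff F 2 1) t \<noteq> 0" using qt by (simp add: pi_dvd_iff)
  have D2: "poly (contact_coeff F 1 2) t = 0" using contact_coeff_1_low[of 2] assms(1) by simp
  have "z = - poly (contact_coeff F 3 0) t / poly (contact_coeff F 2 1) t" if "z \<in> lines_at F t" for z
  proof -
    have "z ^ 2 * poly (contact_coeff F 1 2) t + z * poly (contact_coeff F 2 1) t + poly (contact_coeff F 3 0) t = 0"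
      using that by (simp add: lines_at_iff contact_3)
    then have "z * poly (contact_coeff F 2 1) t = - poly (contact_coeff F 3 0) t"
      unfolding D2 by (simp add: eq_neg_iff_add_eq_0)
    then show ?thesis by (rule nonzero_eq_divide_eq[OF q1, THEN iffD2])
  qed
  then have "lines_at F t \<subseteq> {- poly (contact_coeff F 3 0) t / poly (contact_coeff F 2 1) t}" by auto
  then show "card (lines_at F t) \<le> 1" using card_mono[of "{- poly (contact_coeff F 3 0) t / poly (contact_coeff F 2 1) t}"] by simp
  define r where "r = - (contact_coeff F 1 3 * q ^ 3) + \<pi> * (jt * contact_coeff F 2 2 * q ^ 2
     - \<pi> * jt ^ 2 * contact_coeff F 3 1 * q + \<pi> ^ 2 * jt ^ 3 * contact_coeff F 4 0)"
  have b: "contact4_poly F = \<pi> ^ 3 * r"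
    unfolding contact4_poly_def q jac_pi assms(1) r_def by (simp add: algebra_simps numeral_eq_Suc)
  then show "\<pi> ^ 3 dvd contact4_poly F" by simp
  have "poly (contact_coeff F 1 3) t \<noteq> 0" using contact_coeff_1_top assms(1) by (simp add: numeral_eq_Suc)
  then have "poly r t \<noteq> 0" using qt by (simp add: r_def poly_pi)
  then have "r \<noteq> 0" by auto
  then show "contact4_poly F \<noteq> 0" by (simp add: b pi_nonzero)
qed

lemma monomial_dvd:
  assumes "\<pi> ^ k dvd contact_coeff F 2 0" "n \<le> m * i + k * j"
  shows "\<pi> ^ n dvd c * (jac F ^ i * contact_coeff F 2 0 ^ j)"
proof -
  have "(\<pi> ^ m) ^ i * (\<pi> ^ k) ^ j dvd jac F ^ i * contact_coeff F 2 0 ^ j"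
    by (intro mult_dvd_mono dvd_power_same assms(1)) (simp add: jac_pi)
  then have "\<pi> ^ (m * i + k * j) dvd jac F ^ i * contact_coeff F 2 0 ^ j"
    by (simp only: power_add power_mult)
  then have "\<pi> ^ n dvd jac F ^ i * contact_coeff F 2 0 ^ j" using assms(2) by (rule power_le_dvd)
  then show ?thesis by (rule dvd_mult)
qed

text \<open>Lowest terms of \<open>contact3_poly F = 0\<close> are compared twice: first
  \<open>contact_coeff F 2 0\<close> is seen to have order exactly 2, then
  \<open>contact_coeff F 3 0\<close> to be nonzero at t. The other two coefficients of the contact
  of index 3 vanish there, so it has no root z.\<close>

lemma ramified_3:
  assumes "m = 3" "contact3_poly F = 0" "\<not> \<pi> ^ 3 dvd contact_coeff F 2 0"
  shows "lines_at F t = {}" "\<pi> ^ 7 dvd contact4_poly F" "\<pi> ^ 8 dvd contact5_poly F"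
proof -
  obtain d where d: "contact_coeff F 1 2 = \<pi> ^ 2 * d" "2 * poly d t = 3 * poly jt t"
    using contact_coeff_1_2_factor[of 2] assms(1) by auto
  obtain q where q: "contact_coeff F 2 0 = \<pi> * q" using q0_vanishes assms by (auto simp: dvd_def)
  have "\<pi> ^ 4 * (d * q ^ 2 - jt * q * contact_coeff F 2 1 + \<pi> ^ 2 * jt ^ 2 * contact_coeff F 3 0) = contact3_poly F"
    unfolding contact3_poly_def d q jac_pi assms(1) by (simp add: algebra_simps numeral_eq_Suc)
  then have S: "d * q ^ 2 - jt * q * contact_coeff F 2 1 + \<pi> ^ 2 * jt ^ 2 * contact_coeff F 3 0 = 0"
    using assms(2) pi_nonzero by simp
  have "\<pi> ^ 1 dvd pderiv (contact_coeff F 2 0) - contact_coeff F 2 1"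
    by (rule q1_congruence) (simp_all add: q assms(1))
  then have q1: "poly (contact_coeff F 2 1) t = poly q t"
    by (simp add: q pderiv_mult pderiv_pi pi_dvd_iff poly_pi)
  have "0 = poly (d * q ^ 2 - jt * q * contact_coeff F 2 1 + \<pi> ^ 2 * jt ^ 2 * contact_coeff F 3 0) t"
    unfolding S by simp
  also have "\<dots> = poly d t * poly q t ^ 2 - poly jt t * poly q t * poly q t"
    by (simp add: poly_pi q1[unfolded One_nat_def])
  finally have S0: "0 = poly d t * poly q t ^ 2 - poly jt t * poly q t * poly q t" .
  \<comment> \<open>With x = 3/2 j the coefficient of j y^2 is 3/2 - 1, which is nonzero; the 3 is
    m, from the derivative of J.\<close>
  have "0 = x * y ^ 2 - j * y * y \<Longrightarrow> 2 * x = 3 * j \<Longrightarrow> j * y ^ 2 = 0" for x y j :: 'a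
    by algebra
  from this[OF S0 d(2)] have q0: "poly q t = 0" using poly_jt by simp
  then obtain p where p: "q = \<pi> * p" by (auto simp: dvd_def simp flip: pi_dvd_iff)
  have "\<pi> dvd contact_coeff F 2 1" unfolding pi_dvd_iff q1 by (rule q0)
  then obtain p1 where p1: "contact_coeff F 2 1 = \<pi> * p1" by (elim dvdE)
  have "\<pi> ^ 2 dvd pderiv (contact_coeff F 2 0) - contact_coeff F 2 1"
    by (rule q1_congruence) (simp_all add: q p power2_eq_square assms(1))
  also have "pderiv (contact_coeff F 2 0) - contact_coeff F 2 1 = \<pi> * (2 * p + \<pi> * pderiv p - p1)"
    by (simp add: q p p1[unfolded One_nat_def] pderiv_mult pderiv_pi algebra_simps)
  finally have "\<pi> dvd 2 * p + \<pi> * pderiv p - p1"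
    using pi_nonzero by (simp add: power2_eq_square)
  then have p1t: "poly p1 t = 2 * poly p t" by (simp add: pi_dvd_iff poly_pi)
  have "\<pi> ^ 2 * (d * p ^ 2 - jt * p * p1 + jt ^ 2 * contact_coeff F 3 0) =
      d * q ^ 2 - jt * q * contact_coeff F 2 1 + \<pi> ^ 2 * jt ^ 2 * contact_coeff F 3 0"
    unfolding p p1 by (simp add: algebra_simps numeral_eq_Suc)
  also note S
  finally have "d * p ^ 2 - jt * p * p1 + jt ^ 2 * contact_coeff F 3 0 = 0" using pi_nonzero by simp
  then have "0 = poly (d * p ^ 2 - jt * p * p1 + jt ^ 2 * contact_coeff F 3 0) t" by (simp only: poly_0)
  also have "\<dots> = poly d t * poly p t ^ 2 -
      poly jt t * poly p t * (2 * poly p t) + poly jt t ^ 2 * poly (contact_coeff F 3 0) t"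
    by (simp add: p1t)
  finally have S0: "0 = poly d t * poly p t ^ 2 -
      poly jt t * poly p t * (2 * poly p t) + poly jt t ^ 2 * poly (contact_coeff F 3 0) t" .
  \<comment> \<open>Now the derivative of \<open>\<pi> ^ 2 * p\<close> contributes 2 p, and the
    coefficient of j y^2 becomes 3/2 - 2, again nonzero.\<close>
  have "0 = x * y ^ 2 - j * y * (2 * y) + j ^ 2 * w \<Longrightarrow> 2 * x = 3 * j \<Longrightarrow>
      j * (2 * j * w) = j * y ^ 2" for x y j w :: 'a
    by algebra
  from this[OF S0 d(2)]
  have "poly jt t * (2 * poly jt t * poly (contact_coeff F 3 0) t) = poly jt t * poly p t ^ 2" .
  then have r0: "2 * poly jt t * poly (contact_coeff F 3 0) t = poly p t ^ 2"
    by (rule mult_left_cancel[OF poly_jt, THEN iffD1])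
  have pt: "poly p t \<noteq> 0"
  proof
    assume "poly p t = 0"
    then obtain r where "p = \<pi> * r" unfolding pi_dvd_iff[symmetric] by (elim dvdE)
    then have "contact_coeff F 2 0 = \<pi> ^ 3 * r" by (simp add: q p power3_eq_cube mult.assoc)
    then show False using assms(3) by simp
  qed
  have D2: "poly (contact_coeff F 1 2) t = 0" unfolding d by (simp add: poly_pi)
  have "z \<notin> lines_at F t" for z
  proof
    assume "z \<in> lines_at F t"
    then have "z ^ 2 * poly (contact_coeff F 1 2) t + z * poly (contact_coeff F 2 1) t + poly (contact_coeff F 3 0) t = 0"
      by (simp add: lines_at_iff contact_3)
    moreover have "poly (contact_coeff F 2 1) t = 0" by (simp only: q1 q0)
    ultimately have "poly (contact_coeff F 3 0) t = 0" using D2 by (simp only: mult_zero_right add_0)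
    then show False using r0 pt by simp
  qed
  then show "lines_at F t = {}" by auto
  have "\<pi> dvd contact_coeff F 1 3" unfolding pi_dvd_iff using contact_coeff_1_low[of 3] assms(1) by simp
  then obtain e where e: "contact_coeff F 1 3 = \<pi> * e" by (elim dvdE)
  have q2: "\<pi> ^ 2 dvd contact_coeff F 2 0" by (simp add: q p power2_eq_square)
  note monomial = monomial_dvd[OF q2, unfolded assms(1)]
  have "\<pi> ^ 6 dvd e * (jac F ^ 0 * contact_coeff F 2 0 ^ 3)" by (rule monomial) simp
  then have "\<pi> ^ Suc 6 dvd \<pi> * (e * contact_coeff F 2 0 ^ 3)" unfolding power_Suc by (intro mult_dvd_mono) auto
  then have B: "\<pi> ^ 7 dvd contact_coeff F 1 3 * contact_coeff F 2 0 ^ 3" unfolding e by (simp add: mult.assoc)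
  have B': "\<pi> ^ 7 dvd contact_coeff F 2 2 * (jac F ^ 1 * contact_coeff F 2 0 ^ 2)"
    "\<pi> ^ 7 dvd contact_coeff F 3 1 * (jac F ^ 2 * contact_coeff F 2 0 ^ 1)"
    "\<pi> ^ 7 dvd contact_coeff F 4 0 * (jac F ^ 3 * contact_coeff F 2 0 ^ 0)"
    by (rule monomial; simp)+
  have bF: "contact4_poly F = - (contact_coeff F 1 3 * contact_coeff F 2 0 ^ 3) + contact_coeff F 2 2 * (jac F ^ 1 * contact_coeff F 2 0 ^ 2)
      - contact_coeff F 3 1 * (jac F ^ 2 * contact_coeff F 2 0 ^ 1) + contact_coeff F 4 0 * (jac F ^ 3 * contact_coeff F 2 0 ^ 0)"
    unfolding contact4_poly_def by (simp only: mult_ac power_one_right power_0 mult_1_left mult_1_right)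
  show "\<pi> ^ 7 dvd contact4_poly F"
    unfolding bF dvd_minus_iff by (intro dvd_add dvd_diff B' dvd_minus_iff[THEN iffD2, OF B])
  have G: "\<pi> ^ 8 dvd contact_coeff F 1 4 * (jac F ^ 0 * contact_coeff F 2 0 ^ 4)"
    "\<pi> ^ 8 dvd contact_coeff F 2 3 * (jac F ^ 1 * contact_coeff F 2 0 ^ 3)"
    "\<pi> ^ 8 dvd contact_coeff F 3 2 * (jac F ^ 2 * contact_coeff F 2 0 ^ 2)"
    "\<pi> ^ 8 dvd contact_coeff F 4 1 * (jac F ^ 3 * contact_coeff F 2 0 ^ 1)"
    "\<pi> ^ 8 dvd contact_coeff F 5 0 * (jac F ^ 4 * contact_coeff F 2 0 ^ 0)"
    by (rule monomial; simp)+
  have gF: "contact5_poly F = contact_coeff F 1 4 * (jac F ^ 0 * contact_coeff F 2 0 ^ 4) - contact_coeff F 2 3 * (jac F ^ 1 * contact_coeff F 2 0 ^ 3)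
      + contact_coeff F 3 2 * (jac F ^ 2 * contact_coeff F 2 0 ^ 2) - contact_coeff F 4 1 * (jac F ^ 3 * contact_coeff F 2 0 ^ 1)
      + contact_coeff F 5 0 * (jac F ^ 4 * contact_coeff F 2 0 ^ 0)"
    unfolding contact5_poly_def by (simp only: mult_ac power_one_right power_0 mult_1_left mult_1_right)
  show "\<pi> ^ 8 dvd contact5_poly F"
    unfolding gF by (intro dvd_add dvd_diff G)
qed

theorem card_lines_contact4:
  assumes "contact3_poly F = 0"
  shows "\<pi> ^ (card (lines_at F t) + contact4_loss m) dvd contact4_poly F"
proof -
  consider "m = 0" | "m > 0" "\<pi> ^ m dvd contact_coeff F 2 0" | "m = 1" "\<not> \<pi> ^ m dvd contact_coeff F 2 0"
    | "m = 2" "\<not> \<pi> ^ m dvd contact_coeff F 2 0" | "m = 3" "\<not> \<pi> ^ m dvd contact_coeff F 2 0"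
    using m_le by linarith
  then show ?thesis
  proof cases
    case 1
    then show ?thesis using unramified by (simp add: contact4_loss_def)
  next
    case 2
    then show ?thesis using regular_case assms by simp
  next
    case 3
    then show ?thesis using q0_vanishes assms by simp
  next
    case 4
    then have nd: "\<not> \<pi> ^ 2 dvd contact_coeff F 2 0" by simp
    then have "card (lines_at F t) + contact4_loss m \<le> 3"
      using ramified_2(1)[OF 4(1) assms] 4(1) by (simp add: contact4_loss_def)
    then show ?thesis by (rule power_le_dvd[OF ramified_2(2)[OF 4(1) assms nd]])
  next
    case 5
    then have nd: "\<not> \<pi> ^ 3 dvd contact_coeff F 2 0" by simp
    then have "card (lines_at F t) + contact4_loss m \<le> 7"
      using ramified_3(1)[OF 5(1) assms] 5(1) by (simp add: contact4_loss_def)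
    then show ?thesis by (rule power_le_dvd[OF ramified_3(2)[OF 5(1) assms nd]])
  qed
qed

text \<open>Without a limit direction, m = 1 is impossible by \<open>q0_vanishes\<close>, m = 2
  because \<open>ramified_2\<close> makes \<open>contact4_poly\<close> nonzero, and for m = 3 there
  are no lines, so that order 8 is enough.\<close>

theorem card_lines_contact5:
  assumes "contact3_poly F = 0" "contact4_poly F = 0"
  shows "\<pi> ^ (card (lines_at F t) + contact5_loss m) dvd contact5_poly F"
proof -
  consider "m = 0" | "m > 0" "\<pi> ^ m dvd contact_coeff F 2 0" | "m = 1" "\<not> \<pi> ^ m dvd contact_coeff F 2 0"
    | "m = 2" "\<not> \<pi> ^ m dvd contact_coeff F 2 0" | "m = 3" "\<not> \<pi> ^ m dvd contact_coeff F 2 0"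
    using m_le by linarith
  then show ?thesis
  proof cases
    case 1
    then show ?thesis using unramified by (simp add: contact5_loss_def)
  next
    case 2
    then show ?thesis using regular_case assms by simp
  next
    case 3
    then show ?thesis using q0_vanishes assms by simp
  next
    case 4
    then show ?thesis using ramified_2[OF _ assms(1)] assms(2) by auto
  next
    case 5
    then show ?thesis using ramified_3[OF _ assms(1)] by (auto simp: contact5_loss_def)
  qed
qed

end

section \<open>Counting over the projective line\<close>

text \<open>Orders at t: p' q has order one less than p, while p q' vanishes or has at least the
  order of p.\<close>

lemma wronskian_nonzero:
  fixes p q :: "'a::field_char_0 poly"
  assumes "p \<noteq> 0" "poly p t = 0" "poly q t \<noteq> 0"
  shows "pderiv p * q - p * pderiv q \<noteq> 0"
proof
  assume "pderiv p * q - p * pderiv q = 0"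
  then have eq: "pderiv p * q = p * pderiv q" by simp
  have pos: "order t p \<noteq> 0" using assms order_root by blast
  have d: "pderiv p \<noteq> 0"
  proof
    assume "pderiv p = 0"
    then obtain h where "p = [:h:]" using pderiv_iszero by blast
    then show False using assms by simp
  qed
  have ord: "order t p = Suc (order t (pderiv p))"
    using order_pderiv2[OF d pos] by blast
  have "q \<noteq> 0" using assms(3) by auto
  with d have nz: "pderiv p * q \<noteq> 0" by simp
  have "order t (pderiv p) = order t (p * pderiv q)"
    using order_mult[OF nz, of t] order_0I[OF assms(3)] eq by simp
  moreover have "order t p \<le> order t (p * pderiv q)"
    using nz eq dvd_imp_order_le[of "p * pderiv q" p t] by simp
  ultimately show False using ord by simp
qed

text \<open>\<open>None\<close> stands for the point at infinity.\<close>

definition order_at :: "nat \<Rightarrow> 'a::idom poly \<Rightarrow> 'a option \<Rightarrow> nat" where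
  "order_at d p x = (case x of Some t \<Rightarrow> order t p | None \<Rightarrow> d - degree p)"

lemma order_at_simps [simp]:
  "order_at d p (Some t) = order t p" "order_at d p None = d - degree p"
  by (simp_all add: order_at_def)

lemma order_at_eq_0:
  "p \<noteq> 0 \<Longrightarrow> x \<notin> insert None (Some ` {t. poly p t = 0}) \<Longrightarrow> order_at d p x = 0"
  by (cases x) (auto simp: order_root)

lemma finite_order_at: "p \<noteq> 0 \<Longrightarrow> finite {x. order_at d p x > 0}"
proof -
  assume p: "p \<noteq> 0"
  have "{x. order_at d p x > 0} \<subseteq> insert None (Some ` {t. poly p t = 0})"
    using order_at_eq_0[OF p] by fastforce
  then show ?thesis using poly_roots_finite[OF p] by (auto intro: finite_subset)
qed

lemma sum_order_at:
  assumes "p \<noteq> 0" "degree p \<le> d" "finite S"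
  shows "(\<Sum>x\<in>S. order_at d p x) \<le> d"
proof -
  define Z where "Z = {t. poly p t = 0}"
  have fin: "finite Z" unfolding Z_def by (rule poly_roots_finite[OF assms(1)])
  have "(\<Sum>x\<in>S. order_at d p x) \<le> (\<Sum>x\<in>S \<union> insert None (Some ` Z). order_at d p x)"
    using fin assms(3) by (intro sum_mono2) auto
  also have "\<dots> = (\<Sum>x\<in>insert None (Some ` Z). order_at d p x)"
    using fin assms order_at_eq_0[OF assms(1)] unfolding Z_def
    by (intro sum.mono_neutral_right) blast+
  also have "\<dots> = d - degree p + (\<Sum>t\<in>Z. order t p)"
    using fin by (subst sum.insert) (auto simp: sum.reindex)
  also have "\<dots> \<le> d" using sum_order_le_degree[OF assms(1)] assms(2) by (simp add: Z_def)
  finally show ?thesis .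
qed

lemma sum_order_alg_closed:
  fixes p :: "'a::alg_closed_field poly"
  assumes "p \<noteq> 0"
  shows "(\<Sum>t | poly p t = 0. order t p) = degree p"
proof -
  obtain A where A: "size A = degree p" "p = smult (lead_coeff p) (\<Prod>x\<in>#A. [:- x, 1:])"
    using alg_closed_imp_factorization[OF assms] by blast
  have "proots (\<Prod>x\<in>#A. [:- x, 1:]) = A"
  proof (induction A)
    case (add x A)
    have "(\<Prod>x\<in>#A. [:- x, 1:]) \<noteq> 0" by (auto simp: prod_mset_zero_iff)
    then show ?case using add by (simp add: proots_mult del: mult_pCons_left)
  qed simp
  then have "proots p = A" using A(2) assms by (metis proots_smult leading_coeff_0_iff)
  then have "size (proots p) = degree p" using A(1) by simp
  then show ?thesis using assms
    by (simp add: size_multiset_overloaded_eq)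
qed

lemma sum_order_at_alg_closed:
  fixes p :: "'a::alg_closed_field poly"
  assumes "p \<noteq> 0" "degree p \<le> d"
  shows "(\<Sum>x | order_at d p x > 0. order_at d p x) = d"
proof -
  define Z where "Z = {t. poly p t = 0}"
  have fin: "finite Z" unfolding Z_def by (rule poly_roots_finite[OF assms(1)])
  have "(\<Sum>x | order_at d p x > 0. order_at d p x) = (\<Sum>x\<in>insert None (Some ` Z). order_at d p x)"
    using fin order_at_eq_0[OF assms(1)] unfolding Z_def
    by (intro sum.mono_neutral_left) fastforce+
  also have "\<dots> = d - degree p + (\<Sum>t\<in>Z. order t p)"
    using fin by (subst sum.insert) (auto simp: sum.reindex)
  also have "\<dots> = d" using sum_order_alg_closed[OF assms(1)] assms(2) by (simp add: Z_def)
  finally show ?thesis .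
qed

section \<open>Ramification and lines over all points of the projective line\<close>

definition ram :: "(nat \<Rightarrow> nat \<Rightarrow> 'a::field_char_0 poly) \<Rightarrow> 'a option \<Rightarrow> nat" where
  "ram F x = (case x of Some t \<Rightarrow> order t (jac F) | None \<Rightarrow> order 0 (jac (flip F)))"

definition lines_through :: "(nat \<Rightarrow> nat \<Rightarrow> 'a::field_char_0 poly) \<Rightarrow> 'a option \<Rightarrow> 'a set" where
  "lines_through F x = (case x of Some t \<Rightarrow> lines_at F t | None \<Rightarrow> lines_at (flip F) 0)"

text \<open>The base conditions say that a and b, as binary quartics, have no common zero; the
  coefficient of degree 4 is the value at infinity.\<close>

locale smooth_quintic = quintic_family F
  for F :: "nat \<Rightarrow> nat \<Rightarrow> 'a::{alg_closed_field, field_char_0} poly" +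
  assumes base_finite: "poly (F 0 1) t \<noteq> 0 \<or> poly (F 1 0) t \<noteq> 0"
    and base_infinite: "coeff (F 0 1) 4 \<noteq> 0 \<or> coeff (F 1 0) 4 \<noteq> 0"
begin

text \<open>A vanishing Wronskian makes one of a and b a multiple of the other; without common zeros
  over an algebraically closed field both are then constant polynomials, so both vanish at
  infinity.\<close>

lemma jac_nonzero: "jac F \<noteq> 0"
proof
  assume J: "jac F = 0"
  define a b where "a = F 1 0" and "b = F 0 1"
  note ab = a_def[symmetric] b_def[symmetric]
  have jac_eq: "jac F = pderiv a * b - pderiv b * a"
    by (simp add: jac_def contact_coeff_def hasse_1 a_def b_def)
  define d where "d = smult (poly b 0) a - smult (poly a 0) b"
  have "pderiv d * b - d * pderiv b = smult (poly b 0) (jac F)"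
    "pderiv d * a - d * pderiv a = smult (poly a 0) (jac F)"
    unfolding jac_eq d_def by (simp_all add: pderiv_diff pderiv_smult algebra_simps smult_diff_right)
  moreover have "poly d 0 = 0" by (simp add: d_def)
  ultimately have "d = 0"
    using wronskian_nonzero[of d 0 b] wronskian_nonzero[of d 0 a] base_finite[of 0] J
    unfolding ab by auto
  then have eq: "smult (poly b 0) a = smult (poly a 0) b" by (simp add: d_def)
  have False if "c \<noteq> 0" "smult c q = smult e p" "\<And>t. poly p t \<noteq> 0 \<or> poly q t \<noteq> 0"
    "coeff p 4 \<noteq> 0 \<or> coeff q 4 \<noteq> 0" for c e and p q :: "'a poly"
  proof -
    have q: "q = smult (e / c) p"
      using arg_cong[OF that(2), of "smult (1 / c)"] that(1) by simp
    have "poly p t \<noteq> 0" for t using that(3)[of t] by (auto simp: q)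
    then have "degree p = 0" using alg_closed_imp_poly_has_root[of p] by auto
    then have "coeff p 4 = 0" by (simp add: coeff_eq_0)
    then show False using that(4) by (simp add: q)
  qed
  from this[of "poly b 0" a "poly a 0" b] this[of "poly a 0" b "poly b 0" a] eq
  show False using base_finite base_infinite unfolding ab by metis
qed

lemma smooth_at: "smooth_at F t"
  by unfold_locales (rule base_finite jac_nonzero)+

lemma jac_flip_nonzero: "jac (flip F) \<noteq> 0"
  and ram_infinite: "ram F None = 6 - degree (jac F)"
proof -
  have "order 0 (jac (flip F)) = 6 - degree (jac F)"
    using jac_flip order_rev_poly[OF jac_nonzero, of 6] by simp
  then show "ram F None = 6 - degree (jac F)" by (simp add: ram_def)
  have "rev_poly 6 (jac F) \<noteq> 0"
    using jac_flip jac_nonzero rev_rev_poly by (metis rev_poly_0)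
  then show "jac (flip F) \<noteq> 0" using jac_flip by simp
qed

lemma ram_order_at: "ram F x = order_at 6 (jac F) x"
  by (cases x) (simp_all add: ram_infinite, simp add: ram_def)

lemma smooth_at_flip: "smooth_at (flip F) 0"
proof -
  interpret flip: quintic_family "flip F" by (rule quintic_family_flip)
  show ?thesis
    by unfold_locales
      (use base_infinite jac_flip_nonzero in \<open>simp_all add: poly_0_coeff_0 flip_def coeff_rev_poly\<close>)
qed

lemma ram_le: "ram F x \<le> 3"
  using smooth_at.m_le[OF smooth_at] smooth_at.m_le[OF smooth_at_flip]
  by (cases x) (simp_all add: ram_def smooth_at.m_def[OF smooth_at] smooth_at.m_def[OF smooth_at_flip])

lemma lines_finite: "finite (lines_through F x)"
  using smooth_at.finite_lines[OF smooth_at] smooth_at.finite_lines[OF smooth_at_flip]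
  by (cases x) (simp_all add: lines_through_def)

lemma order_at_dvd:
  assumes "p \<noteq> 0" "degree p \<le> d" "p' = rev_poly d p \<or> p' = - rev_poly d p"
    and "\<And>t. [:- t, 1:] ^ (card (lines_at F t) + g (order t (jac F))) dvd p"
    and "[:- 0, 1:] ^ (card (lines_at (flip F) 0) + g (order 0 (jac (flip F)))) dvd p'"
  shows "card (lines_through F x) + g (ram F x) \<le> order_at d p x"
proof (cases x)
  case None
  have "rev_poly d p \<noteq> 0" using assms(1,2) rev_rev_poly by (metis rev_poly_0)
  then have "p' \<noteq> 0" using assms(3) by auto
  moreover have "order 0 p' = d - degree p" using assms(3) order_rev_poly[OF assms(1,2)] by auto
  ultimately show ?thesis
    using assms(5)[unfolded order_divides] by (simp add: None lines_through_def ram_def)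
next
  case (Some t)
  then show ?thesis using assms(1) assms(4)[of t, unfolded order_divides]
    by (simp add: lines_through_def ram_def)
qed

text \<open>\<open>g\<close> is the loss at ramified points. The local estimates are added over the
  points that carry a line or ramification; the two signs allowed for \<open>p'\<close> are those of
  \<open>contact_poly_flip\<close>.\<close>

lemma count_bound:
  assumes "p \<noteq> 0" "degree p \<le> d" "p' = rev_poly d p \<or> p' = - rev_poly d p" "g 0 = 0"
    and "\<And>t. [:- t, 1:] ^ (card (lines_at F t) + g (order t (jac F))) dvd p"
    and "[:- 0, 1:] ^ (card (lines_at (flip F) 0) + g (order 0 (jac (flip F)))) dvd p'"
    and fin: "finite (Sigma UNIV (lines_through F))"
  shows "card (Sigma UNIV (lines_through F)) + (\<Sum>x | ram F x > 0. g (ram F x)) \<le> d"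
proof -
  define R where "R = {x. ram F x > 0}"
  have finR: "finite R"
    unfolding R_def ram_order_at by (rule finite_order_at[OF jac_nonzero])
  define S where "S = fst ` Sigma UNIV (lines_through F) \<union> R"
  have finS: "finite S" unfolding S_def using fin finR by simp
  have "Sigma UNIV (lines_through F) = Sigma S (lines_through F)"
    by (force simp: S_def)
  then have "card (Sigma UNIV (lines_through F)) = (\<Sum>x\<in>S. card (lines_through F x))"
    using finS lines_finite by (simp add: card_SigmaI)
  moreover have "(\<Sum>x\<in>R. g (ram F x)) = (\<Sum>x\<in>S. g (ram F x))"
    using finS assms(4) by (intro sum.mono_neutral_left) (auto simp: S_def R_def)
  ultimately have "card (Sigma UNIV (lines_through F)) + (\<Sum>x\<in>R. g (ram F x)) =
      (\<Sum>x\<in>S. card (lines_through F x) + g (ram F x))"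
    by (simp add: sum.distrib)
  also have "\<dots> \<le> (\<Sum>x\<in>S. order_at d p x)"
    by (intro sum_mono order_at_dvd[OF assms(1,2,3,5,6)])
  also have "\<dots> \<le> d" by (rule sum_order_at[OF assms(1,2) finS])
  finally show ?thesis by (simp add: R_def)
qed

lemma infinite_lines:
  assumes "contact3_poly F = 0" "contact4_poly F = 0" "contact5_poly F = 0"
  shows "infinite (Sigma UNIV (lines_through F))"
proof
  assume fin: "finite (Sigma UNIV (lines_through F))"
  have "Some ` (- {t. poly (jac F) t = 0}) \<subseteq> fst ` Sigma UNIV (lines_through F)"
  proof
    fix x assume "x \<in> Some ` (- {t. poly (jac F) t = 0})"
    then obtain t where t: "x = Some t" "poly (jac F) t \<noteq> 0" by auto
    define z where "z = - poly (contact_coeff F 2 0) t / poly (jac F) t"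
    have iff: "contact F t m z 1 = 0 \<longleftrightarrow> contact F t m (- poly (contact_coeff F 2 0) t) (poly (jac F) t) = 0" for m
      using contact_scale[of F t m "poly (jac F) t" z 1] t(2) by (simp add: z_def)
    then have "z \<in> lines_at F t"
      unfolding lines_at_iff iff contact_canonical assms by simp
    then show "x \<in> fst ` Sigma UNIV (lines_through F)"
      by (force simp: t lines_through_def)
  qed
  then have "finite (Some ` (- {t. poly (jac F) t = 0}))"
    using fin by (meson finite_imageI finite_subset)
  then have "finite (- {t. poly (jac F) t = 0})"
    by (rule finite_imageD) simp
  then show False using poly_roots_finite[OF jac_nonzero]
    by (simp add: finite_compl infinite_UNIV_char_0)
qed

end

lemma multiset_1_2_3:
  fixes M :: "nat multiset"
  assumes "\<And>x. x \<in># M \<Longrightarrow> 0 < x \<and> x \<le> 3"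
  shows "M = replicate_mset (count M 1) 1 + replicate_mset (count M 2) 2 + replicate_mset (count M 3) 3"
proof (rule multiset_eqI)
  fix x :: nat
  consider "x = 1" | "x = 2" | "x = 3" | "x = 0 \<or> x > 3" by linarith
  then show "count M x = count (replicate_mset (count M 1) 1 + replicate_mset (count M 2) 2 +
      replicate_mset (count M 3) 3) x"
  proof cases
    case 4
    then have "x \<notin># M" using assms by force
    then show ?thesis using 4 by (auto simp: count_eq_zero_iff)
  qed auto
qed

context smooth_quintic begin

theorem ramification_of_28_lines:
  assumes fin: "finite (Sigma UNIV (lines_through F))"
    and card: "card (Sigma UNIV (lines_through F)) = 28"
  shows "image_mset (ram F) (mset_set {x. ram F x > 0}) = {#3, 3#} \<and> contact4_poly F = 0 \<or>
    image_mset (ram F) (mset_set {x. ram F x > 0}) = {#2, 2, 2#} \<and> contact4_poly F \<noteq> 0"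
proof -
  define R where "R = {x. ram F x > 0}"
  define M where "M = image_mset (ram F) (mset_set R)"
  have finR: "finite R"
    unfolding R_def ram_order_at by (rule finite_order_at[OF jac_nonzero])
  have sum_M: "(\<Sum>x\<in>R. g (ram F x)) = sum_mset (image_mset g M)" for g :: "nat \<Rightarrow> nat"
    by (simp add: M_def image_mset.compositionality o_def sum_unfold_sum_mset)
  have M: "M = replicate_mset (count M 1) 1 + replicate_mset (count M 2) 2 + replicate_mset (count M 3) 3"
    using finR by (intro multiset_1_2_3) (auto simp: M_def R_def ram_le)
  define n1 n2 n3 where "n1 = count M 1" and "n2 = count M 2" and "n3 = count M 3"
  have M': "M = replicate_mset n1 1 + replicate_mset n2 2 + replicate_mset n3 3"
    using M by (simp add: n1_def n2_def n3_def)
  have sums: "(\<Sum>x\<in>R. g (ram F x)) = n1 * g 1 + n2 * g 2 + n3 * g 3" for g :: "nat \<Rightarrow> nat"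
    unfolding sum_M M' by simp
  \<comment> \<open>Algebraic closedness makes this an equality instead of a bound: all zeros of J
    lie in the field.\<close>
  have "(\<Sum>x\<in>R. ram F x) = 6"
    unfolding R_def ram_order_at using jac_flip by (intro sum_order_at_alg_closed[OF jac_nonzero]) simp
  then have total: "n1 + 2 * n2 + 3 * n3 = 6"
    using sums[of "\<lambda>x. x"] by simp
  have contact3_poly: "contact3_poly F = 0"
  proof (rule ccontr)
    assume "contact3_poly F \<noteq> 0"
    from count_bound[OF this, of 26 "contact3_poly (flip F)" "\<lambda>_. 0"] contact_poly_flip(1)[OF jac_nonzero]
    show False using fin card
        smooth_at.card_lines_contact3[OF smooth_at] smooth_at.card_lines_contact3[OF smooth_at_flip]
      by (simp add: smooth_at.\<pi>_def[OF smooth_at] smooth_at.\<pi>_def[OF smooth_at_flip])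
  qed
  have contact3_poly': "contact3_poly (flip F) = 0" using contact_poly_flip(1)[OF jac_nonzero] contact3_poly by simp
  show ?thesis
  proof (cases "contact4_poly F = 0")
    case False
    have "28 + (\<Sum>x\<in>R. contact4_loss (ram F x)) \<le> 35"
      using count_bound[OF False, of 35 "contact4_poly (flip F)" contact4_loss] contact_poly_flip(2)[OF jac_nonzero contact3_poly]
        smooth_at.card_lines_contact4[OF smooth_at contact3_poly] smooth_at.card_lines_contact4[OF smooth_at_flip contact3_poly'] fin card
      by (simp add: smooth_at.\<pi>_def[OF smooth_at] smooth_at.\<pi>_def[OF smooth_at_flip]
          smooth_at.m_def[OF smooth_at] smooth_at.m_def[OF smooth_at_flip] contact4_loss_def R_def)
    then have "2 * n1 + 2 * n2 + 5 * n3 \<le> 7" unfolding sums by (simp add: contact4_loss_def)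
    \<comment> \<open>The total 6 is subtracted; then n3 = 0, and n1 = 0 by parity, since n1 + 3 n3
      = 6 - 2 n2.\<close>
    with total have "n1 + 2 * n3 \<le> 1" by linarith
    moreover from this have "n3 = 0" by linarith
    moreover have "even n1 \<or> odd n3" using total by presburger
    ultimately have "n1 = 0" "n2 = 3" "n3 = 0" using total by auto
    then have "M = {#2, 2, 2#}" unfolding M' by (simp add: numeral_eq_Suc)
    then show ?thesis using False by (simp add: M_def R_def)
  next
    case True
    have contact4_poly': "contact4_poly (flip F) = 0" using contact_poly_flip(2)[OF jac_nonzero contact3_poly] True by simp
    have "contact5_poly F \<noteq> 0" using infinite_lines contact3_poly True fin by blast
    then have "28 + (\<Sum>x\<in>R. contact5_loss (ram F x)) \<le> 44"
      using count_bound[of "contact5_poly F" 44 "contact5_poly (flip F)" contact5_loss] contact_poly_flip(3)[OF jac_nonzero contact3_poly True]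
        smooth_at.card_lines_contact5[OF smooth_at contact3_poly True]
        smooth_at.card_lines_contact5[OF smooth_at_flip contact3_poly' contact4_poly'] fin card
      by (simp add: smooth_at.\<pi>_def[OF smooth_at] smooth_at.\<pi>_def[OF smooth_at_flip]
          smooth_at.m_def[OF smooth_at] smooth_at.m_def[OF smooth_at_flip] contact5_loss_def R_def)
    then have "3 * n1 + 6 * n2 + 8 * n3 \<le> 16" unfolding sums by (simp add: contact5_loss_def)
    \<comment> \<open>Three times the total is 3 n1 + 6 n2 + 9 n3 = 18, two more than the bound
      allows for 8 n3 in place of 9 n3.\<close>
    with total have "n3 \<ge> 2" by linarith
    with total have "n1 = 0" "n2 = 0" "n3 = 2" by linarith+
    then have "M = {#3, 3#}" unfolding M' by (simp add: numeral_eq_Suc)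
    then show ?thesis using True by (simp add: M_def R_def)
  qed
qed

end

section \<open>Quaternary forms\<close>

lemma poly_mapping_sum_single:
  "f = (\<Sum>m\<in>Poly_Mapping.keys f. Poly_Mapping.single m (Poly_Mapping.lookup f m))"
  by (rule poly_mapping_eqI)
    (simp add: lookup_sum lookup_single when_def in_keys_iff)

locale coeff_hom =
  fixes h :: "'a::comm_ring_1 \<Rightarrow> 'b::comm_ring_1"
  assumes h_0: "h 0 = 0" and h_1: "h 1 = 1"
    and h_add: "h (x + y) = h x + h y" and h_mult: "h (x * y) = h x * h y"
begin

lemma insertion_superset:
  assumes "finite A" "Poly_Mapping.keys f \<subseteq> A"
  shows "insertion h v f =
    (\<Sum>m\<in>A. h (Poly_Mapping.lookup f m) * (\<Prod>i\<in>UNIV. v i ^ Poly_Mapping.lookup m i))"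
  unfolding insertion_def using assms
  by (intro sum.mono_neutral_left) (auto simp: in_keys_iff h_0)

lemma insertion_zero: "insertion h v 0 = 0"
  by (simp add: insertion_def)

lemma insertion_single:
  "insertion h v (Poly_Mapping.single m c) = h c * (\<Prod>i\<in>UNIV. v i ^ Poly_Mapping.lookup m i)"
  by (subst insertion_superset[of "{m}"]) (auto split: if_splits)

lemma insertion_add: "insertion h v (f + g) = insertion h v f + insertion h v g"
proof -
  let ?A = "Poly_Mapping.keys f \<union> Poly_Mapping.keys g"
  have "Poly_Mapping.keys (f + g) \<subseteq> ?A" by (rule keys_add)
  then show ?thesis
    by (simp add: insertion_superset[of ?A] lookup_add h_add distrib_right sum.distrib)
qed

lemma insertion_sum: "insertion h v (\<Sum>x\<in>A. f x) = (\<Sum>x\<in>A. insertion h v (f x))"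
  by (induction A rule: infinite_finite_induct) (simp_all add: insertion_zero insertion_add)

lemma insertion_mult: "insertion h v (f * g) = insertion h v f * insertion h v g"
proof -
  have "f * g = (\<Sum>m\<in>Poly_Mapping.keys f. \<Sum>n\<in>Poly_Mapping.keys g.
      Poly_Mapping.single (m + n) (Poly_Mapping.lookup f m * Poly_Mapping.lookup g n))"
    by (subst poly_mapping_sum_single[of f], subst poly_mapping_sum_single[of g])
      (simp only: sum_product mult_single)
  then have "insertion h v (f * g) = (\<Sum>m\<in>Poly_Mapping.keys f. \<Sum>n\<in>Poly_Mapping.keys g.
      (h (Poly_Mapping.lookup f m) * (\<Prod>i\<in>UNIV. v i ^ Poly_Mapping.lookup m i)) *
      (h (Poly_Mapping.lookup g n) * (\<Prod>i\<in>UNIV. v i ^ Poly_Mapping.lookup n i)))"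
    by (simp add: insertion_sum insertion_single lookup_add h_mult power_add prod.distrib mult_ac)
  then show ?thesis by (simp add: insertion_def sum_product)
qed

lemma insertion_uminus: "insertion h v (- f) = - insertion h v f"
  using insertion_add[of v f "- f"]
  by (simp add: insertion_zero eq_neg_iff_add_eq_0 add.commute)

lemma insertion_diff: "insertion h v (f - g) = insertion h v f - insertion h v g"
  using insertion_add[of v f "- g"] by (simp add: insertion_uminus)

lemma insertion_one: "insertion h v 1 = 1"
  using insertion_single[of v 0 1] by (simp add: h_1)

lemma insertion_power: "insertion h v (f ^ n) = insertion h v f ^ n"
  by (induction n) (simp_all add: insertion_one insertion_mult)

lemma insertion_prod: "insertion h v (\<Prod>x\<in>A. f x) = (\<Prod>x\<in>A. insertion h v (f x))"
  by (induction A rule: infinite_finite_induct) (simp_all add: insertion_one insertion_mult)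

lemma insertion_var:
  "insertion h v (Poly_Mapping.single (Poly_Mapping.single j 1) c) = h c * v j"
proof -
  have "(\<Prod>i\<in>UNIV. v i ^ Poly_Mapping.lookup (Poly_Mapping.single j (1::nat)) i) =
      (\<Prod>i\<in>UNIV. if i = j then v i else 1)"
    by (intro prod.cong) (auto simp: lookup_single when_def)
  then show ?thesis by (simp add: insertion_single)
qed

lemma insertion_const: "insertion h v (Poly_Mapping.single 0 c) = h c"
  by (simp add: insertion_single)

lemma insertion_in_coords:
  "insertion h v (in_coords T f) = insertion h (\<lambda>i. \<Sum>j\<in>UNIV. h (T $ i $ j) * v j) f"
  unfolding in_coords_def insertion_def[of "Poly_Mapping.single 0"]
  by (simp del: One_nat_def add: insertion_sum insertion_mult insertion_prod insertion_power
      insertion_var insertion_const insertion_def[of h _ f])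

end

lemma coeff_hom_id: "coeff_hom (\<lambda>c. c)"
  by unfold_locales simp_all

lemma coeff_hom_bconst: "coeff_hom (\<lambda>c. [:[:c:]:])"
  by unfold_locales (simp_all add: one_pCons)

lemma lookup_partial:
  "Poly_Mapping.lookup (partial i f) m =
    of_nat (Suc (Poly_Mapping.lookup m i)) * Poly_Mapping.lookup f (m + Poly_Mapping.single i 1)"
proof -
  let ?e = "Poly_Mapping.single i (1::nat)"
  have "Poly_Mapping.lookup (partial i f) m = (\<Sum>m'\<in>Poly_Mapping.keys f.
      if m' = m + ?e then of_nat (Poly_Mapping.lookup m' i) * Poly_Mapping.lookup f m' else 0)"
    unfolding partial_def lookup_sum
  proof (intro sum.cong refl)
    fix m'
    \<comment> \<open>Subtraction of exponents is truncated: a monomial free of the variable i is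
      left in place by it, but then the factor \<open>of_nat 0\<close> kills the term.\<close>
    have "m' = m + ?e" if "m' - ?e = m" "Poly_Mapping.lookup m' i \<noteq> 0"
    proof (rule poly_mapping_eqI)
      fix k
      show "Poly_Mapping.lookup m' k = Poly_Mapping.lookup (m + ?e) k"
        unfolding that(1)[symmetric] lookup_add lookup_minus lookup_single
        using that(2) by (auto simp: when_def)
    qed
    then have ne: "of_nat (Poly_Mapping.lookup m' i) * Poly_Mapping.lookup f m' = 0 \<or> m' - ?e \<noteq> m"
      if "m' \<noteq> m + ?e"
      using that by (metis mult_zero_left of_nat_0)
    show "Poly_Mapping.lookup (Poly_Mapping.single (m' - ?e)
        (of_nat (Poly_Mapping.lookup m' i) * Poly_Mapping.lookup f m')) m =
      (if m' = m + ?e then of_nat (Poly_Mapping.lookup m' i) * Poly_Mapping.lookup f m' else 0)"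
    proof (cases "m' = m + ?e")
      case True
      then show ?thesis by (simp add: lookup_single)
    next
      case False
      then show ?thesis using ne by (auto simp only: lookup_single when_def if_False if_True refl split: if_splits)
    qed
  qed
  also have "\<dots> = of_nat (Suc (Poly_Mapping.lookup m i)) * Poly_Mapping.lookup f (m + ?e)"
    by (auto simp: in_keys_iff lookup_add)
  finally show ?thesis .
qed

lemma four_distinct [simp]:
  "(1::4) \<noteq> 2" "(1::4) \<noteq> 3" "(1::4) \<noteq> 4" "(2::4) \<noteq> 1" "(2::4) \<noteq> 3" "(2::4) \<noteq> 4"
  "(3::4) \<noteq> 1" "(3::4) \<noteq> 2" "(3::4) \<noteq> 4" "(4::4) \<noteq> 1" "(4::4) \<noteq> 2" "(4::4) \<noteq> 3"
  by simp_all

definition mono4 :: "nat \<Rightarrow> nat \<Rightarrow> nat \<Rightarrow> nat \<Rightarrow> 4 \<Rightarrow>\<^sub>0 nat" where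
  "mono4 i j k l = Poly_Mapping.single 3 i + Poly_Mapping.single 4 j +
     Poly_Mapping.single 1 k + Poly_Mapping.single 2 l"

lemma lookup_mono4:
  "Poly_Mapping.lookup (mono4 i j k l) 1 = k" "Poly_Mapping.lookup (mono4 i j k l) 2 = l"
  "Poly_Mapping.lookup (mono4 i j k l) 3 = i" "Poly_Mapping.lookup (mono4 i j k l) 4 = j"
  unfolding mono4_def lookup_add lookup_single when_def by simp_all

lemma mono4_lookup:
  "mono4 (Poly_Mapping.lookup m 3) (Poly_Mapping.lookup m 4) (Poly_Mapping.lookup m 1)
     (Poly_Mapping.lookup m 2) = m"
proof (rule poly_mapping_eqI)
  fix i :: 4
  show "Poly_Mapping.lookup (mono4 (Poly_Mapping.lookup m 3) (Poly_Mapping.lookup m 4)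
      (Poly_Mapping.lookup m 1) (Poly_Mapping.lookup m 2)) i = Poly_Mapping.lookup m i"
    using exhaust_4[of i] by (elim disjE) (simp_all only: lookup_mono4)
qed

lemma alpha_mono4: "alpha f i j k l = Poly_Mapping.lookup f (mono4 i j k l)"
  by (simp add: alpha_def mono4_def)

lemma mono4_Suc:
  "mono4 i j k l + Poly_Mapping.single 1 1 = mono4 i j (Suc k) l"
  "mono4 i j k l + Poly_Mapping.single 2 1 = mono4 i j k (Suc l)"
  "mono4 i j k l + Poly_Mapping.single 3 1 = mono4 (Suc i) j k l"
  "mono4 i j k l + Poly_Mapping.single 4 1 = mono4 i (Suc j) k l"
proof -
  have "Poly_Mapping.single x (Suc n) = Poly_Mapping.single x n + Poly_Mapping.single x 1" for x :: 4 and n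
    by (simp flip: single_add)
  then show "mono4 i j k l + Poly_Mapping.single 1 1 = mono4 i j (Suc k) l"
    "mono4 i j k l + Poly_Mapping.single 2 1 = mono4 i j k (Suc l)"
    "mono4 i j k l + Poly_Mapping.single 3 1 = mono4 (Suc i) j k l"
    "mono4 i j k l + Poly_Mapping.single 4 1 = mono4 i (Suc j) k l"
    unfolding mono4_def by (simp_all only: add_ac)
qed

lemma alpha_partial:
  "alpha (partial 1 f) i j k l = of_nat (Suc k) * alpha f i j (Suc k) l"
  "alpha (partial 2 f) i j k l = of_nat (Suc l) * alpha f i j k (Suc l)"
  "alpha (partial 3 f) i j k l = of_nat (Suc i) * alpha f (Suc i) j k l"
  "alpha (partial 4 f) i j k l = of_nat (Suc j) * alpha f i (Suc j) k l"
  by (simp_all only: alpha_mono4 lookup_partial lookup_mono4 mono4_Suc)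

lemma homogeneous_partial: "homogeneous (Suc d) f \<Longrightarrow> homogeneous d (partial i f)"
  unfolding homogeneous_def
proof
  fix m assume f: "\<forall>m\<in>Poly_Mapping.keys f. (\<Sum>i\<in>UNIV. Poly_Mapping.lookup m i) = Suc d"
    and m: "m \<in> Poly_Mapping.keys (partial i f)"
  then have "Poly_Mapping.lookup f (m + Poly_Mapping.single i 1) \<noteq> 0"
    unfolding in_keys_iff lookup_partial by (auto simp del: of_nat_Suc)
  then have "(\<Sum>k\<in>UNIV. Poly_Mapping.lookup (m + Poly_Mapping.single i 1) k) = Suc d"
    using f by (simp add: in_keys_iff)
  moreover have "(\<Sum>k\<in>UNIV. Poly_Mapping.lookup (Poly_Mapping.single i (1::nat)) k) = 1"
    by (simp add: lookup_single when_def)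
  ultimately show "(\<Sum>k\<in>UNIV. Poly_Mapping.lookup m k) = d"
    by (simp add: lookup_add sum.distrib)
qed

lemma homogeneous_add: "homogeneous d f \<Longrightarrow> homogeneous d g \<Longrightarrow> homogeneous d (f + g)"
  unfolding homogeneous_def using keys_add[of f g] by blast

lemma homogeneous_sum: "(\<And>x. x \<in> A \<Longrightarrow> homogeneous d (f x)) \<Longrightarrow> homogeneous d (\<Sum>x\<in>A. f x)"
proof (induction A rule: infinite_finite_induct)
  case (insert x F)
  then show ?case by (simp add: homogeneous_add)
qed (simp_all add: homogeneous_def)

lemma homogeneous_mult:
  "homogeneous d f \<Longrightarrow> homogeneous e g \<Longrightarrow> homogeneous (d + e) (f * g :: 'a::comm_ring_1 mpoly4)"
  unfolding homogeneous_def using keys_mult[of f g] by (force simp: lookup_add sum.distrib)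

lemma homogeneous_single_0: "homogeneous 0 (Poly_Mapping.single 0 c)"
  by (simp add: homogeneous_def)

lemma homogeneous_power:
  "homogeneous d f \<Longrightarrow> homogeneous (n * d) (f ^ n :: 'a::comm_ring_1 mpoly4)"
  using homogeneous_single_0[of "1::'a"] by (induction n) (auto intro: homogeneous_mult)

lemma homogeneous_prod:
  assumes "\<And>x. x \<in> A \<Longrightarrow> homogeneous (d x) (f x :: 'a::comm_ring_1 mpoly4)" "finite A"
  shows "homogeneous (\<Sum>x\<in>A. d x) (\<Prod>x\<in>A. f x)"
  using assms(2,1)
proof (induction rule: finite_induct)
  case empty
  then show ?case using homogeneous_single_0[of "1::'a"] by simp
qed (simp add: homogeneous_mult)

lemma homogeneous_in_coords:
  fixes T :: "'a::comm_ring_1^4^4"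
  assumes "homogeneous d f"
  shows "homogeneous d (in_coords T f)"
  unfolding in_coords_def insertion_def
proof (rule homogeneous_sum)
  fix m assume "m \<in> Poly_Mapping.keys f"
  then have d: "d = 0 + (\<Sum>i\<in>UNIV. Poly_Mapping.lookup m i * 1)"
    using assms by (simp add: homogeneous_def)
  have "homogeneous 1 (\<Sum>j\<in>UNIV. Poly_Mapping.single (Poly_Mapping.single j 1) (T $ i $ j))" for i
    by (rule homogeneous_sum) (simp add: homogeneous_def lookup_single when_def)
  then show "homogeneous d (Poly_Mapping.single 0 (Poly_Mapping.lookup f m) *
      (\<Prod>i\<in>UNIV. (\<Sum>j\<in>UNIV. Poly_Mapping.single (Poly_Mapping.single j 1) (T $ i $ j)) ^
        Poly_Mapping.lookup m i))"
    by (subst d) (intro homogeneous_mult homogeneous_single_0 homogeneous_prod homogeneous_power; simp)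
qed

lemma (in coeff_hom) insertion_alpha:
  assumes "homogeneous d f"
  shows "insertion h v f = (\<Sum>i\<le>d. \<Sum>j\<le>d-i. \<Sum>l\<le>d-i-j.
    h (alpha f i j (d-i-j-l) l) * (v 3 ^ i * v 4 ^ j * v 1 ^ (d-i-j-l) * v 2 ^ l))"
proof -
  define S where "S = (SIGMA i:{..d}. SIGMA j:{..d-i}. {..d-i-j})"
  define \<phi> where "\<phi> = (\<lambda>(i, j, l). mono4 i j (d-i-j-l) l)"
  have fin: "finite S" by (simp add: S_def)
  have inj: "inj_on \<phi> S"
  proof (rule inj_onI)
    fix x y assume *: "\<phi> x = \<phi> y"
    obtain i j l i' j' l' where xy: "x = (i, j, l)" "y = (i', j', l')" by (metis prod_cases3)
    show "x = y"
      using *[unfolded xy \<phi>_def prod.case] unfolding xy by (metis lookup_mono4(2-4))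
  qed
  have sub: "Poly_Mapping.keys f \<subseteq> \<phi> ` S"
  proof
    fix m assume "m \<in> Poly_Mapping.keys f"
    then have deg: "Poly_Mapping.lookup m 1 + Poly_Mapping.lookup m 2 + Poly_Mapping.lookup m 3 +
        Poly_Mapping.lookup m 4 = d"
      using assms by (simp add: homogeneous_def sum_4)
    let ?x = "(Poly_Mapping.lookup m 3, Poly_Mapping.lookup m 4, Poly_Mapping.lookup m 2)"
    have "d - Poly_Mapping.lookup m 3 - Poly_Mapping.lookup m 4 - Poly_Mapping.lookup m 2 =
        Poly_Mapping.lookup m 1" using deg by simp
    then have "\<phi> ?x = m" by (simp only: \<phi>_def prod.case mono4_lookup)
    moreover have "?x \<in> S" unfolding S_def using deg by auto
    ultimately show "m \<in> \<phi> ` S" by (metis image_eqI)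
  qed
  have prod_4: "(\<Prod>i\<in>UNIV. g i) = g 1 * g 2 * g 3 * g 4" for g :: "4 \<Rightarrow> 'b"
    unfolding UNIV_4 by (simp add: mult_ac)
  have "insertion h v f = (\<Sum>m\<in>\<phi> ` S. h (Poly_Mapping.lookup f m) *
      (\<Prod>i\<in>UNIV. v i ^ Poly_Mapping.lookup m i))"
    using fin sub by (intro insertion_superset) simp_all
  also have "\<dots> = (\<Sum>(i, j, l)\<in>S. h (alpha f i j (d-i-j-l) l) *
      (v 3 ^ i * v 4 ^ j * v 1 ^ (d-i-j-l) * v 2 ^ l))"
    unfolding sum.reindex[OF inj] o_def
    by (intro sum.cong refl) (auto simp only: \<phi>_def prod.case prod_4 lookup_mono4 alpha_mono4 mult_ac)
  also have "\<dots> = (\<Sum>i\<le>d. \<Sum>j\<le>d-i. \<Sum>l\<le>d-i-j.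
      h (alpha f i j (d-i-j-l) l) * (v 3 ^ i * v 4 ^ j * v 1 ^ (d-i-j-l) * v 2 ^ l))"
    unfolding S_def by (subst sum.Sigma[symmetric] | simp add: split_def)+
  finally show ?thesis .
qed

section \<open>Restriction to the line and the family of a quintic form\<close>

definition dehom :: "nat \<Rightarrow> 'a::comm_ring_1 mpoly4 \<Rightarrow> 'a poly" where
  "dehom d f = (\<Sum>l\<le>d. monom (alpha f 0 0 (d - l) l) l)"

definition fam :: "'a::comm_ring_1 mpoly4 \<Rightarrow> nat \<Rightarrow> nat \<Rightarrow> 'a poly" where
  "fam f i j = (\<Sum>l\<le>5-i-j. monom (alpha f i j (5-i-j-l) l) l)"

lemma coeff_dehom: "coeff (dehom d f) l = (if l \<le> d then alpha f 0 0 (d - l) l else 0)"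
  by (simp add: dehom_def coeff_sum coeff_monom)

lemma coeff_fam: "coeff (fam f i j) l = (if l \<le> 5-i-j then alpha f i j (5-i-j-l) l else 0)"
  by (simp add: fam_def coeff_sum coeff_monom)

lemma degree_fam: "degree (fam f i j) \<le> 5 - i - j"
  by (rule degree_le) (simp add: coeff_fam)

lemma dehom_first:
  "dehom 4 (partial 3 f) = fam f 1 0" "dehom 4 (partial 4 f) = fam f 0 1"
  by (rule poly_eqI, simp add: coeff_dehom coeff_fam alpha_partial)+

lemma dehom_second:
  "dehom 3 (partial 2 (partial 3 f)) = pderiv (fam f 1 0)"
  "dehom 3 (partial 2 (partial 4 f)) = pderiv (fam f 0 1)"
  "dehom 3 (partial 3 (partial 3 f)) = 2 * fam f 2 0"
  "dehom 3 (partial 3 (partial 4 f)) = fam f 1 1"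
  "dehom 3 (partial 4 (partial 3 f)) = fam f 1 1"
  "dehom 3 (partial 4 (partial 4 f)) = 2 * fam f 0 2"
  by (rule poly_eqI, simp add: coeff_dehom coeff_fam coeff_pderiv alpha_partial numeral_poly,
      simp add: numeral_eq_Suc)+

text \<open>Euler's relation x_1 g_1 + x_2 g_2 = 4 g for the restrictions g of the partials by x_3
  and x_4, at x_1 = 1.\<close>

lemma dehom_euler:
  "dehom 3 (partial 1 (partial 3 f)) = 4 * fam f 1 0 - [:0, 1:] * pderiv (fam f 1 0)"
  "dehom 3 (partial 1 (partial 4 f)) = 4 * fam f 0 1 - [:0, 1:] * pderiv (fam f 0 1)"
proof -
  have shift: "coeff ([:0, 1:] * pderiv p) n = of_nat n * coeff p n" for p :: "'a poly" and n
    by (cases n) (simp_all add: coeff_pderiv)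
  have *: "of_nat (4 - n) = (4 - of_nat n :: 'a)" "Suc (3 - n) = 4 - n" if "n \<le> 3" for n
    using that by (simp_all add: of_nat_diff)
  have n4: "n \<le> 3 \<or> n = 4 \<or> n > 4" for n :: nat by linarith
  have "coeff (dehom 3 (partial 1 (partial 3 f))) n = coeff (4 * fam f 1 0 - [:0, 1:] * pderiv (fam f 1 0)) n"
    "coeff (dehom 3 (partial 1 (partial 4 f))) n = coeff (4 * fam f 0 1 - [:0, 1:] * pderiv (fam f 0 1)) n" for n
    using n4[of n] unfolding coeff_diff shift
    by (auto simp: coeff_dehom coeff_fam alpha_partial numeral_poly * algebra_simps of_nat_1[unfolded One_nat_def]
        simp del: of_nat_Suc)
  then show "dehom 3 (partial 1 (partial 3 f)) = 4 * fam f 1 0 - [:0, 1:] * pderiv (fam f 1 0)"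
    "dehom 3 (partial 1 (partial 4 f)) = 4 * fam f 0 1 - [:0, 1:] * pderiv (fam f 0 1)"
    by (auto intro: poly_eqI)
qed

definition bform :: "nat \<Rightarrow> 'a::comm_ring_1 poly \<Rightarrow> 'a poly poly" where
  "bform d p = (\<Sum>l\<le>d. bconst (coeff p l) * bX1 ^ (d - l) * bX2 ^ l)"

lemma restrict_line_hom:
  fixes f g :: "'a::comm_ring_1 mpoly4"
  shows "restrict_line (f + g) = restrict_line f + restrict_line g"
  "restrict_line (f - g) = restrict_line f - restrict_line g"
  "restrict_line (f * g) = restrict_line f * restrict_line g"
  unfolding restrict_line_def
  by (simp_all only: coeff_hom.insertion_add[OF coeff_hom_bconst]
      coeff_hom.insertion_diff[OF coeff_hom_bconst] coeff_hom.insertion_mult[OF coeff_hom_bconst])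

lemma sum_on_line:
  fixes c :: "nat \<Rightarrow> nat \<Rightarrow> nat \<Rightarrow> 'b::comm_ring_1"
  shows "(\<Sum>i\<le>d. \<Sum>j\<le>d-i. \<Sum>l\<le>d-i-j. c i j l * (0 ^ i * 0 ^ j * X ^ (d-i-j-l) * Y ^ l)) =
    (\<Sum>l\<le>d. c 0 0 l * X ^ (d-l) * Y ^ l)"
proof -
  define S where "S i j = (\<Sum>l\<le>d-i-j. c i j l * (0 ^ i * 0 ^ j * X ^ (d-i-j-l) * Y ^ l))" for i j
  have S0: "S i j = 0" if "i \<noteq> 0 \<or> j \<noteq> 0" for i j
    using that by (auto simp: S_def power_0_left)
  have "(\<Sum>i\<le>d. \<Sum>j\<le>d-i. S i j) = (\<Sum>i\<in>{0}. \<Sum>j\<le>d-i. S i j)"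
    by (rule sum.mono_neutral_right) (auto simp: S0)
  also have "\<dots> = (\<Sum>j\<le>d. S 0 j)" by simp
  also have "\<dots> = (\<Sum>j\<in>{0}. S 0 j)"
    by (rule sum.mono_neutral_right) (auto simp: S0)
  finally show ?thesis by (simp add: S_def mult.assoc)
qed

lemma restrict_line_bform:
  assumes "homogeneous d f"
  shows "restrict_line f = bform d (dehom d f)"
proof -
  have "restrict_line f = (\<Sum>i\<le>d. \<Sum>j\<le>d-i. \<Sum>l\<le>d-i-j.
    bconst (alpha f i j (d-i-j-l) l) * (0 ^ i * 0 ^ j * bX1 ^ (d-i-j-l) * bX2 ^ l))"
    unfolding restrict_line_def coeff_hom.insertion_alpha[OF coeff_hom_bconst assms] by simp
  then show ?thesis
    unfolding sum_on_line bform_def coeff_dehom by simp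
qed

definition hform :: "nat \<Rightarrow> 'a::comm_ring_1 poly \<Rightarrow> 'a \<Rightarrow> 'a \<Rightarrow> 'a" where
  "hform d p x y = (\<Sum>l\<le>d. coeff p l * x ^ (d - l) * y ^ l)"

lemma hform_scale: "hform d p (c * x) (c * y) = c ^ d * hform d p x y"
  unfolding hform_def sum_distrib_left
proof (intro sum.cong refl)
  fix l assume "l \<in> {..d}"
  then have "c ^ d = c ^ (d - l) * c ^ l" by (simp flip: power_add)
  then show "coeff p l * (c * x) ^ (d - l) * (c * y) ^ l = c ^ d * (coeff p l * x ^ (d - l) * y ^ l)"
    by (simp add: power_mult_distrib mult_ac)
qed

lemma hform_1: "degree p \<le> d \<Longrightarrow> hform d p 1 y = poly p y"
  by (simp add: hform_def poly_altdef')

lemma hform_rev: "hform d (rev_poly d p) y x = hform d p x y"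
  unfolding hform_def
  by (subst sum.atLeastAtMost_rev[of _ 0 d, simplified atLeast0AtMost], intro sum.cong)
    (auto simp: coeff_rev_poly mult_ac)

lemma hform_0_1: "hform d p 0 1 = coeff p d"
proof -
  have "hform d p 0 1 = (\<Sum>l\<le>d. if l = d then coeff p l else 0)"
    unfolding hform_def by (intro sum.cong) (auto simp: power_0_left)
  then show ?thesis by simp
qed

lemma beval_bform: "beval (bform d p) x = hform d p (x $ 1) (x $ 2)"
  by (simp add: beval_def bform_def hform_def poly_sum mult.assoc)

lemma eval4_fam:
  assumes "homogeneous 5 f"
  shows "eval4 f x = (\<Sum>i\<le>5. \<Sum>j\<le>5-i.
    x $ 3 ^ i * x $ 4 ^ j * hform (5-i-j) (fam f i j) (x $ 1) (x $ 2))"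
  unfolding coeff_hom.insertion_alpha[OF coeff_hom_id assms] hform_def sum_distrib_left
  by (intro sum.cong refl) (simp add: coeff_fam mult_ac)

lemma eval4_partial_line:
  assumes "homogeneous 5 f" "x $ 3 = 0" "x $ 4 = 0"
  shows "eval4 (partial 3 f) x = hform 4 (fam f 1 0) (x $ 1) (x $ 2)"
    "eval4 (partial 4 f) x = hform 4 (fam f 0 1) (x $ 1) (x $ 2)"
proof -
  have "eval4 g x = hform 4 (dehom 4 g) (x $ 1) (x $ 2)" if g: "homogeneous 4 g" for g
  proof -
    have "eval4 g x = (\<Sum>l\<le>4. alpha g 0 0 (4-l) l * (x $ 1) ^ (4-l) * (x $ 2) ^ l)"
      unfolding coeff_hom.insertion_alpha[OF coeff_hom_id g] assms(2,3)
      using sum_on_line[where c = "\<lambda>i j l. alpha g i j (4-i-j-l) l"] by simp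
    then show ?thesis by (simp add: hform_def coeff_dehom mult.assoc)
  qed
  moreover have "homogeneous 4 (partial i f)" for i
    using assms(1) by (intro homogeneous_partial) (simp add: numeral_eq_Suc)
  ultimately show "eval4 (partial 3 f) x = hform 4 (fam f 1 0) (x $ 1) (x $ 2)"
    "eval4 (partial 4 f) x = hform 4 (fam f 0 1) (x $ 1) (x $ 2)"
    by (simp_all add: dehom_first)
qed

definition line_poly :: "'a::comm_ring_1 mpoly4 \<Rightarrow> 'a^4 \<Rightarrow> 'a^4 \<Rightarrow> 'a poly" where
  "line_poly f x w = insertion (\<lambda>c. [:c:]) (\<lambda>i. [:x $ i, w $ i:]) f"

lemma poly_line_poly: "poly (line_poly f x w) s = eval4 f (x + s *s w)"
  by (simp add: line_poly_def insertion_def poly_sum poly_prod)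

text \<open>Chain rule along a line, monomial by monomial. It turns tangency into a coefficient of
  \<open>line_poly\<close>, which passes directly through linear coordinate changes.\<close>

lemma coeff_line_poly:
  fixes f :: "'a::idom mpoly4"
  shows "coeff (line_poly f x w) 1 = (\<Sum>i\<in>UNIV. w $ i * eval4 (partial i f) x)"
proof -
  define P where "P m = (\<Prod>k\<in>UNIV. [:x $ k, w $ k:] ^ Poly_Mapping.lookup m k)" for m :: "4 \<Rightarrow>\<^sub>0 nat"
  have P: "coeff (P m) 1 = (\<Sum>i\<in>UNIV. w $ i * (of_nat (Poly_Mapping.lookup m i) *
      (\<Prod>k\<in>UNIV. x $ k ^ Poly_Mapping.lookup (m - Poly_Mapping.single i 1) k)))" for m
  proof -
    have "coeff (P m) 1 = poly (pderiv (P m)) 0" by (simp add: poly_0_coeff_0 coeff_pderiv)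
    also have "\<dots> = (\<Sum>i\<in>UNIV. (\<Prod>k\<in>UNIV - {i}. x $ k ^ Poly_Mapping.lookup m k) *
        (of_nat (Poly_Mapping.lookup m i) * x $ i ^ (Poly_Mapping.lookup m i - 1) * w $ i))"
      unfolding P_def pderiv_prod
      by (simp add: poly_sum poly_prod pderiv_power pderiv_pCons) (simp only: mult_ac)
    also have "\<dots> = (\<Sum>i\<in>UNIV. w $ i * (of_nat (Poly_Mapping.lookup m i) *
      (\<Prod>k\<in>UNIV. x $ k ^ Poly_Mapping.lookup (m - Poly_Mapping.single i 1) k)))"
    proof (intro sum.cong refl)
      fix i :: 4
      have "(\<Prod>k\<in>UNIV. x $ k ^ Poly_Mapping.lookup (m - Poly_Mapping.single i 1) k) =
        x $ i ^ (Poly_Mapping.lookup m i - 1) * (\<Prod>k\<in>UNIV - {i}. x $ k ^ Poly_Mapping.lookup m k)"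
        by (subst prod.remove[of _ i]) (auto simp: lookup_minus lookup_single when_def intro!: prod.cong)
      then show "(\<Prod>k\<in>UNIV - {i}. x $ k ^ Poly_Mapping.lookup m k) *
        (of_nat (Poly_Mapping.lookup m i) * x $ i ^ (Poly_Mapping.lookup m i - 1) * w $ i) =
        w $ i * (of_nat (Poly_Mapping.lookup m i) *
        (\<Prod>k\<in>UNIV. x $ k ^ Poly_Mapping.lookup (m - Poly_Mapping.single i 1) k))"
        by (simp add: mult_ac)
    qed
    finally show ?thesis .
  qed
  have E: "eval4 (partial i f) x = (\<Sum>m\<in>Poly_Mapping.keys f. of_nat (Poly_Mapping.lookup m i) *
      Poly_Mapping.lookup f m *
      (\<Prod>k\<in>UNIV. x $ k ^ Poly_Mapping.lookup (m - Poly_Mapping.single i 1) k))" for i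
    unfolding partial_def coeff_hom.insertion_sum[OF coeff_hom_id]
      coeff_hom.insertion_single[OF coeff_hom_id] ..
  have "coeff (line_poly f x w) 1 =
      (\<Sum>m\<in>Poly_Mapping.keys f. Poly_Mapping.lookup f m * coeff (P m) 1)"
    unfolding line_poly_def insertion_def coeff_sum P_def by simp
  also have "\<dots> = (\<Sum>i\<in>UNIV. w $ i * eval4 (partial i f) x)"
    unfolding P E sum_distrib_left by (subst sum.swap) (simp only: mult_ac)
  finally show ?thesis .
qed

lemma matrix_vector_line: "T *v (x + s *s w) = T *v x + s *s (T *v (w::'a::field^4))"
  by (simp add: matrix_vector_right_distrib vector_scalar_commute)

lemma eval4_in_coords:
  fixes T :: "'a::comm_ring_1^4^4"
  shows "eval4 (in_coords T f) y = eval4 f (T *v y)"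
  unfolding coeff_hom.insertion_in_coords[OF coeff_hom_id]
  by (simp add: matrix_vector_mult_def)

section \<open>The ramification type\<close>

text \<open>
  Evaluation at \<open>x\<^sub>2 / x\<^sub>1\<close> embeds \<open>K[t]\<close> into \<open>K(x\<^sub>1, x\<^sub>2)\<close>; a form of degree \<open>d\<close> is \<open>x\<^sub>1 ^ d\<close> times the
  image of its dehomogenisation.
\<close>

definition at_ratio :: "'a::field poly \<Rightarrow> 'a poly poly fract" where
  "at_ratio p = poly (map_poly (\<lambda>c. to_fract (bconst c)) p) (to_fract bX2 / to_fract bX1)"

lemma to_fract_bconst:
  "to_fract (bconst (c + d)) = to_fract (bconst c) + to_fract (bconst (d::'a::field))"
  "to_fract (bconst (c * d)) = to_fract (bconst c) * to_fract (bconst d)"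
  by (simp_all flip: to_fract_add to_fract_mult)

lemma at_ratio_0 [simp]: "at_ratio 0 = 0"
  by (simp add: at_ratio_def)

lemma at_ratio_pCons:
  "at_ratio (pCons c p) = to_fract (bconst c) + to_fract bX2 / to_fract bX1 * at_ratio p"
  by (simp add: at_ratio_def map_poly_pCons)

lemma at_ratio_const: "at_ratio [:c:] = to_fract (bconst c)"
  by (simp add: at_ratio_pCons)

lemma at_ratio_1 [simp]: "at_ratio (1 :: 'a::field poly) = 1"
  using at_ratio_const[of "1::'a"] by (simp only: pCons_one to_fract_1)

lemma at_ratio_add: "at_ratio (p + q) = at_ratio p + at_ratio q"
  by (induction p q rule: poly_induct2) (simp_all add: at_ratio_pCons to_fract_bconst algebra_simps add_divide_distrib)

lemma at_ratio_smult: "at_ratio (smult c p) = to_fract (bconst c) * at_ratio p"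
  by (induction p) (simp_all add: at_ratio_pCons to_fract_bconst algebra_simps del: to_fract_mult)

lemma at_ratio_mult: "at_ratio (p * q) = at_ratio p * at_ratio q"
  by (induction p) (simp_all add: at_ratio_pCons at_ratio_add at_ratio_smult algebra_simps)

lemma at_ratio_uminus: "at_ratio (- p) = - at_ratio p"
  using at_ratio_add[of p "- p"] by (simp add: eq_neg_iff_add_eq_0 add.commute)

lemma at_ratio_diff: "at_ratio (p - q) = at_ratio p - at_ratio q"
  using at_ratio_add[of p "- q"] by (simp add: at_ratio_uminus)

lemma at_ratio_power: "at_ratio (p ^ n) = at_ratio p ^ n"
  by (induction n) (simp_all add: at_ratio_mult)

lemma at_ratio_sum: "at_ratio (\<Sum>x\<in>A. p x) = (\<Sum>x\<in>A. at_ratio (p x))"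
  by (induction A rule: infinite_finite_induct) (simp_all add: at_ratio_add)

lemma at_ratio_of_nat: "at_ratio (of_nat n) = of_nat n"
  by (induction n) (simp_all add: at_ratio_add)

lemma at_ratio_monom:
  "at_ratio (monom c n) = to_fract (bconst c) * (to_fract bX2 / to_fract bX1) ^ n"
  by (induction n) (simp_all add: at_ratio_pCons monom_0 monom_Suc)

lemma bX1_nonzero: "to_fract (bX1 :: 'a::field poly poly) \<noteq> 0"
  by simp

lemma poly_as_sum_of_monoms_le: "degree p \<le> d \<Longrightarrow> (\<Sum>l\<le>d. monom (coeff p l) l) = p"
  by (rule poly_as_sum_of_monoms')

lemma to_fract_power: "to_fract (x ^ n) = to_fract x ^ n"
  by (induction n) simp_all

lemma to_fract_bform:
  assumes "degree p \<le> d"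
  shows "to_fract (bform d p) = to_fract bX1 ^ d * at_ratio p"
proof -
  let ?x = "to_fract (bX1 :: 'a poly poly)" and ?y = "to_fract (bX2 :: 'a poly poly)"
  have "at_ratio p = (\<Sum>l\<le>d. to_fract (bconst (coeff p l)) * (?y / ?x) ^ l)"
    unfolding at_ratio_monom[symmetric] at_ratio_sum[symmetric] poly_as_sum_of_monoms_le[OF assms] ..
  then have "?x ^ d * at_ratio p = (\<Sum>l\<le>d. to_fract (bconst (coeff p l)) * (?x ^ d * (?y / ?x) ^ l))"
    by (simp only: sum_distrib_left mult_ac)
  also have "\<dots> = (\<Sum>l\<le>d. to_fract (bconst (coeff p l) * bX1 ^ (d - l) * bX2 ^ l))"
  proof (intro sum.cong refl)
    fix l assume "l \<in> {..d}"
    then have "?x ^ d * (?y / ?x) ^ l = ?x ^ (d - l) * ?y ^ l"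
      using bX1_nonzero by (simp add: power_divide power_diff)
    then show "to_fract (bconst (coeff p l)) * (?x ^ d * (?y / ?x) ^ l) =
        to_fract (bconst (coeff p l) * bX1 ^ (d - l) * bX2 ^ l)"
      by (simp only: to_fract_mult to_fract_power mult.assoc)
  qed
  finally show ?thesis by (simp only: bform_def to_fract_sum)
qed

lemma at_ratio_eq_0:
  fixes p :: "'a::field_char_0 poly"
  assumes "at_ratio p = 0"
  shows "p = 0"
proof -
  have "to_fract (bform (degree p) p) = 0" using assms to_fract_bform[OF order_refl, of p] by simp
  then have "bform (degree p) p = 0" by simp
  have "poly p y = 0" for y
  proof -
    have "beval (bform (degree p) p) (vector [1, y]) = poly p y"
      unfolding beval_bform by (simp add: hform_1)
    then show ?thesis unfolding \<open>bform (degree p) p = 0\<close> by (simp add: beval_def)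
  qed
  then show ?thesis using poly_all_0_iff_0 by auto
qed

lemma bform_add: "bform d (p + q) = bform d p + bform d q"
proof -
  have "bform d (p + q) =
      (\<Sum>l\<le>d. (bconst (coeff p l) + bconst (coeff q l)) * bX1 ^ (d - l) * bX2 ^ l)"
    by (simp add: bform_def)
  then show ?thesis by (simp only: bform_def distrib_right sum.distrib)
qed

lemma bform_smult: "bform d (smult c p) = bconst c * bform d p"
proof -
  have "bform d (smult c p) = (\<Sum>l\<le>d. bconst c * (bconst (coeff p l) * bX1 ^ (d - l) * bX2 ^ l))"
    by (simp add: bform_def mult.assoc)
  then show ?thesis by (simp only: bform_def sum_distrib_left)
qed

lemma bform_uminus: "bform d (- p) = - bform d p"
proof -
  have "bform d p + bform d (- p) = 0" unfolding bform_add[symmetric] by (simp add: bform_def)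
  then show ?thesis by (simp add: eq_neg_iff_add_eq_0 add.commute)
qed

lemma bform_eq_mult:
  fixes p q r :: "'a::field poly"
  assumes "degree p \<le> d" "degree q \<le> e" "degree r \<le> k" "r = p * q" "k = d + e"
  shows "bform k r = bform d p * bform e q"
proof -
  have "to_fract (bform k r) = to_fract (bform d p * bform e q)"
    unfolding to_fract_mult to_fract_bform[OF assms(1)] to_fract_bform[OF assms(2)]
      to_fract_bform[OF assms(3)]
    unfolding assms(4,5) at_ratio_mult power_add by (simp only: mult_ac)
  then show ?thesis by (simp only: to_fract_eq_iff)
qed

lemma bform_X1_power:
  fixes p :: "'a::field poly"
  assumes "degree p \<le> k"
  shows "bform (n + k) p = bX1 ^ n * bform k p"
proof -
  have "to_fract (bform (n + k) p) = to_fract (bX1 ^ n * bform k p)"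
    unfolding to_fract_mult to_fract_bform[OF assms] to_fract_bform[OF trans_le_add2[OF assms]]
      to_fract_power power_add
    by (simp only: mult_ac)
  then show ?thesis by (simp only: to_fract_eq_iff)
qed

lemma bform_linear: "bform 1 [:c, d:] = bconst c * bX1 + bconst d * bX2"
  by (simp add: bform_def)

lemma bform_power:
  fixes p :: "'a::field poly"
  assumes "degree p \<le> 1"
  shows "bform n (p ^ n) = bform 1 p ^ n"
proof (induction n)
  case 0
  then show ?case by (simp add: bform_def one_pCons)
next
  case (Suc n)
  have "degree (p ^ n) \<le> 1 * n" for n
    using degree_power_le mult_le_mono1[OF assms] by (rule order_trans)
  from this[of n] this[of "Suc n"]
  have "bform (Suc n) (p ^ Suc n) = bform 1 p * bform n (p ^ n)"
    using assms by (intro bform_eq_mult) simp_all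
  then show ?case by (simp only: Suc power_Suc)
qed

section \<open>Points of the projective line and the linear forms vanishing at them\<close>

definition pt :: "'a::field option \<Rightarrow> 'a^2" where
  "pt x = (case x of Some t \<Rightarrow> vector [1, t] | None \<Rightarrow> vector [0, 1])"

lemma pt_simps [simp]: "pt (Some t) $ 1 = 1" "pt (Some t) $ 2 = t" "pt None $ 1 = 0" "pt None $ 2 = 1"
  by (simp_all add: pt_def)

lemma pt_nonzero: "pt x \<noteq> 0"
proof
  assume "pt x = 0"
  then have "pt x $ 1 = 0" "pt x $ 2 = 0" by simp_all
  then show False by (cases x) simp_all
qed

lemma span_pt: "vec.span {pt x} = range (\<lambda>c. c *s pt x)"
  by (rule vec.span_singleton)

lemma inj_span_pt: "inj (\<lambda>x. vec.span {pt x})"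
proof (rule injI)
  fix x y :: "'a option"
  assume "vec.span {pt x} = vec.span {pt y}"
  then have "pt x \<in> vec.span {pt y}" using vec.span_base[of "pt x" "{pt x}"] by simp
  then obtain c where c: "pt x = c *s pt y" by (auto simp: span_pt)
  then have "pt x $ 1 = c * pt y $ 1" "pt x $ 2 = c * pt y $ 2" by simp_all
  then show "x = y" by (cases x; cases y) auto
qed

lemma exists_pt:
  fixes p :: "'a::field^2"
  assumes "p \<noteq> 0"
  shows "\<exists>x c. c \<noteq> 0 \<and> p = c *s pt x"
proof (cases "p $ 1 = 0")
  case True
  then have "p $ 2 \<noteq> 0" using assms by (auto simp: vec_eq_iff forall_2)
  then show ?thesis using True
    by (intro exI[of _ None] exI[of _ "p $ 2"]) (simp add: vec_eq_iff forall_2)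
next
  case False
  then show ?thesis
    by (intro exI[of _ "Some (p $ 2 / p $ 1)"] exI[of _ "p $ 1"]) (simp add: vec_eq_iff forall_2)
qed

lemma P1_points_eq: "P1_points = range (\<lambda>x. vec.span {pt x})"
proof (intro equalityI subsetI)
  fix P :: "('a^2) set" assume "P \<in> P1_points"
  then have P: "vec.subspace P" "vec.dim P = 1" by (simp_all add: P1_points_def)
  then have "\<not> P \<subseteq> {0}" using vec.dim_eq_0[of P] by auto
  then obtain p where p: "p \<in> P" "p \<noteq> 0" by auto
  then obtain x c where x: "c \<noteq> 0" "p = c *s pt x" using exists_pt by blast
  have "pt x = (1 / c) *s p" using x by simp
  then have "pt x \<in> P" using P(1) p(1) vec.subspace_scale by metis
  then have "vec.span {pt x} \<subseteq> P" using P(1) by (intro vec.span_minimal) auto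
  then have "vec.span {pt x} = P"
    using P pt_nonzero[of x] by (intro vec.subspace_dim_equal) simp_all
  then show "P \<in> range (\<lambda>x. vec.span {pt x})" by blast
next
  fix P :: "('a^2) set" assume "P \<in> range (\<lambda>x. vec.span {pt x})"
  then show "P \<in> P1_points" by (auto simp: P1_points_def pt_nonzero)
qed

text \<open>Forward, x_1 = 1 turns the linear form into a multiple of x_2 - t; backward, the
  cofactor of g is homogenised in degree d - n.\<close>

lemma dvd_bform_finite:
  fixes g :: "'a::field_char_0 poly"
  assumes "\<kappa> \<noteq> 0" "g \<noteq> 0" "degree g \<le> d"
  shows "(bconst (\<kappa> * t) * bX1 - bconst \<kappa> * bX2) ^ n dvd bform d g \<longleftrightarrow> n \<le> order t g"
proof
  assume "(bconst (\<kappa> * t) * bX1 - bconst \<kappa> * bX2) ^ n dvd bform d g"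
  then obtain H where H: "bform d g = (bconst (\<kappa> * t) * bX1 - bconst \<kappa> * bX2) ^ n * H"
    by (elim dvdE)
  define G where "G = (\<Sum>k\<le>degree H. monom (poly (coeff H k) 1) k)"
  have G: "poly G y = poly (poly H [:y:]) 1" for y
    unfolding G_def by (simp add: poly_sum poly_monom poly_altdef[of H])
  have "g = smult ((- \<kappa>) ^ n) ([:- t, 1:] ^ n * G)"
  proof (rule poly_eqI_cofinite[of "{}"])
    fix y
    have "poly g y = beval (bform d g) (vector [1, y])"
      unfolding beval_bform using assms(3) by (simp add: hform_1)
    also have "\<dots> = (\<kappa> * t - \<kappa> * y) ^ n * poly G y"
      unfolding H by (simp add: beval_def G)
    also have "\<kappa> * t - \<kappa> * y = - \<kappa> * (y - t)" by (simp add: algebra_simps)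
    also have "(- \<kappa> * (y - t)) ^ n * poly G y = (- \<kappa>) ^ n * ((y - t) ^ n * poly G y)"
      by (simp only: power_mult_distrib mult.assoc)
    finally show "poly g y = poly (smult ((- \<kappa>) ^ n) ([:- t, 1:] ^ n * G)) y"
      by simp
  qed simp
  then have "[:- t, 1:] ^ n dvd g" using assms(1) by (simp add: dvd_smult)
  then show "n \<le> order t g" using assms(2) by (simp add: order_divides)
next
  assume "n \<le> order t g"
  then have "[:- t, 1:] ^ n dvd g" by (simp add: order_divides)
  then obtain q where q: "g = [:- t, 1:] ^ n * q" by (elim dvdE)
  then have "q \<noteq> 0" using assms(2) by auto
  then have deg: "degree g = n + degree q"
    unfolding q by (subst degree_mult_eq) (simp_all add: degree_linear_power)
  define l where "l = [:\<kappa> * t, - \<kappa>:]"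
  have l: "l = smult (- \<kappa>) [:- t, 1:]" by (simp add: l_def)
  have ln: "l ^ n = smult ((- \<kappa>) ^ n) ([:- t, 1:] ^ n)"
    unfolding l by (rule smult_power)
  have "g = l ^ n * smult (1 / (- \<kappa>) ^ n) q"
    unfolding ln q using assms(1) by (simp only: mult_smult_left mult_smult_right smult_smult) simp
  then have "bform d g = bform n (l ^ n) * bform (d - n) (smult (1 / (- \<kappa>) ^ n) q)"
    using assms(1,3) deg degree_power_le[of l n]
    by (intro bform_eq_mult) (auto simp: l_def)
  also have "bform n (l ^ n) = bform 1 l ^ n" by (rule bform_power) (simp add: l_def)
  also have "bform 1 l = bconst (\<kappa> * t) * bX1 - bconst \<kappa> * bX2"
    unfolding l_def bform_linear by simp
  finally show "(bconst (\<kappa> * t) * bX1 - bconst \<kappa> * bX2) ^ n dvd bform d g" by simp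
qed

lemma dvd_bform_infinite:
  fixes g :: "'a::field_char_0 poly"
  assumes "\<kappa> \<noteq> 0" "g \<noteq> 0" "degree g \<le> d"
  shows "(bconst \<kappa> * bX1) ^ n dvd bform d g \<longleftrightarrow> n \<le> d - degree g"
proof
  assume "(bconst \<kappa> * bX1) ^ n dvd bform d g"
  then obtain H where H: "bform d g = (bconst \<kappa> * bX1) ^ n * H" by (elim dvdE)
  have "rev_poly d g = smult (\<kappa> ^ n) ([:- 0, 1:] ^ n * poly H 1)"
  proof (rule poly_eqI_cofinite[of "{}"])
    fix y
    have "poly (rev_poly d g) y = beval (bform d g) (vector [y, 1])"
      unfolding beval_bform using hform_rev[of d g 1 y] by (simp add: hform_1 degree_rev_poly)
    also have "\<dots> = (\<kappa> * y) ^ n * poly (poly H 1) y"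
      unfolding H by (simp add: beval_def one_pCons mult.commute)
    finally show "poly (rev_poly d g) y = poly (smult (\<kappa> ^ n) ([:- 0, 1:] ^ n * poly H 1)) y"
      by (simp add: power_mult_distrib mult.assoc)
  qed simp
  then have "[:- 0, 1:] ^ n dvd rev_poly d g" using assms(1) by (simp add: dvd_smult)
  moreover have "rev_poly d g \<noteq> 0" using rev_rev_poly[OF assms(3)] assms(2) by (metis rev_poly_0)
  ultimately show "n \<le> d - degree g"
    using order_rev_poly[OF assms(2,3)] by (simp only: order_divides) simp
next
  assume n: "n \<le> d - degree g"
  have "bconst \<kappa> ^ n * bconst ((1 / \<kappa>) ^ n) = (1 :: 'a poly poly)"
    using assms(1) by (induction n) (simp_all add: one_pCons power_divide poly_const_pow field_simps)
  moreover have "bform d g = bX1 ^ n * bform (d - n) g"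
    using bform_X1_power[of g "d - n" n] n assms(3) by simp
  ultimately have "bform d g =
      (bconst \<kappa> ^ n * bconst ((1 / \<kappa>) ^ n)) * (bX1 ^ n * bform (d - n) g)"
    by (simp only: mult_1_left)
  also have "\<dots> = (bconst \<kappa> * bX1) ^ n * (bconst ((1 / \<kappa>) ^ n) * bform (d - n) g)"
    by (simp only: power_mult_distrib mult_ac)
  finally have "bform d g = (bconst \<kappa> * bX1) ^ n * (bconst ((1 / \<kappa>) ^ n) * bform (d - n) g)" .
  then show "(bconst \<kappa> * bX1) ^ n dvd bform d g" by (rule dvdI)
qed

text \<open>The form in \<open>ram_index\<close> is c^4 times the homogenised \<open>fibre\<close>,
  of order m + 1 by \<open>order_fibre\<close>; at infinity the same holds in the flipped
  chart.\<close>

lemma ram_index_bform: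
  fixes F :: "nat \<Rightarrow> nat \<Rightarrow> 'a::{alg_closed_field, field_char_0} poly"
  assumes "smooth_quintic F" "c \<noteq> 0"
  shows "ram_index (bform 4 (F 0 1)) (- bform 4 (F 1 0)) (c *s pt x) = Suc (ram F x)"
proof -
  interpret smooth_quintic F by fact
  define a b where "a = F 1 0" and "b = F 0 1"
  have deg: "degree a \<le> 4" "degree b \<le> 4"
    using degree_F[of 1 0] degree_F[of 0 1] by (simp_all add: a_def b_def)
  define u v where "u = hform 4 a (pt x $ 1) (pt x $ 2)" and "v = hform 4 b (pt x $ 1) (pt x $ 2)"
  define p where "p = c *s pt x"
  define g where "g = smult v a - smult u b"
  have deg_g: "degree g \<le> 4" unfolding g_def
    using deg by (intro degree_diff_le) (auto intro: order_trans[OF degree_smult_le])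
  have beval: "beval (bform 4 b) p = c ^ 4 * v" "beval (- bform 4 a) p = - (c ^ 4 * u)"
    unfolding bform_uminus[symmetric] beval_bform p_def u_def v_def
    by (simp_all add: hform_scale) (simp add: hform_def sum_negf flip: hform_scale)
  have form: "bconst (beval (- bform 4 a) p) * bform 4 b - bconst (beval (bform 4 b) p) * (- bform 4 a) =
      bform 4 (smult (c ^ 4) g)"
  proof -
    have "smult (c ^ 4) g = smult (c ^ 4 * v) a + smult (- (c ^ 4 * u)) b"
      by (simp add: g_def smult_diff_right)
    then show ?thesis unfolding beval by (simp only: bform_add bform_smult) simp
  qed
  have "g \<noteq> 0 \<and> {n. (bconst (p $ 2) * bX1 - bconst (p $ 1) * bX2) ^ n dvd bform 4 (smult (c ^ 4) g)} =
      {..Suc (ram F x)}"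
  proof (cases x)
    case (Some t)
    interpret smooth_at F t by (rule smooth_at)
    have g: "g = fibre"
      using deg by (simp add: g_def fibre_def u_def v_def Some hform_1 a_def b_def)
    have "g \<noteq> 0" using fibre_nonzero g by simp
    moreover have "order t (smult (c ^ 4) g) = Suc (ram F x)"
      using order_fibre assms(2) by (simp add: order_smult g ram_def Some m_def)
    moreover have "p $ 2 = c * t" "p $ 1 = c" by (simp_all add: p_def Some)
    ultimately show ?thesis
      using dvd_bform_finite[of c "smult (c ^ 4) g" 4 t] deg_g assms(2) by (auto simp: atMost_def)
  next
    case None
    interpret flip: smooth_at "flip F" 0 by (rule smooth_at_flip)
    have g: "rev_poly 4 g = flip.fibre"
      by (rule poly_eqI)
        (simp add: g_def flip.fibre_def u_def v_def None hform_0_1 a_def b_def flip_def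
          coeff_rev_poly poly_0_coeff_0)
    then have "g \<noteq> 0" using flip.fibre_nonzero by auto
    moreover have "4 - degree (smult (c ^ 4) g) = Suc (ram F x)"
      using flip.order_fibre assms(2) order_rev_poly[OF \<open>g \<noteq> 0\<close> deg_g]
      by (simp add: g ram_def None flip.m_def)
    moreover have "p $ 2 = c" "p $ 1 = 0" by (simp_all add: p_def None)
    ultimately show ?thesis
      using dvd_bform_infinite[of c "smult (c ^ 4) g" 4] deg_g assms(2) by (auto simp: atMost_def)
  qed
  then have "Max {n. (bconst (p $ 2) * bX1 - bconst (p $ 1) * bX2) ^ n dvd bform 4 (smult (c ^ 4) g)} =
      Suc (ram F x)"
    by (simp add: Max_eq_iff)
  then show ?thesis unfolding ram_index_def a_def[symmetric] b_def[symmetric] p_def[symmetric] form .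
qed

theorem ramification_type_eq:
  fixes f :: "'a::{alg_closed_field, field_char_0} mpoly4"
  assumes hom: "homogeneous 5 f" and "smooth_quintic (fam f)"
  shows "ramification_type f = image_mset (ram (fam f)) (mset_set {x. ram (fam f) x > 0})"
proof -
  define S where "S x = vec.span {pt x}" for x :: "'a option"
  have inj: "inj S" unfolding S_def by (rule inj_span_pt)
  have hom4: "homogeneous 4 (partial i f)" for i
    using hom by (intro homogeneous_partial) (simp add: numeral_eq_Suc)
  have restrict: "restrict_line (partial 4 f) = bform 4 (fam f 0 1)"
    "restrict_line (partial 3 f) = bform 4 (fam f 1 0)"
    by (simp_all only: restrict_line_bform[OF hom4] dehom_first)
  have mult: "line_ram_mult f (S x) = ram (fam f) x" for x
  proof -
    have eq: "S x - {0} = (\<lambda>c. c *s pt x) ` (- {0})"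
      unfolding S_def span_pt using pt_nonzero[of x] by (auto simp: vector_mul_eq_0)
    \<comment> \<open>The index agrees for all representatives of the point, so the image is a
      singleton and \<open>the_elem\<close> picks its value.\<close>
    have "ram_index (bform 4 (fam f 0 1)) (- bform 4 (fam f 1 0)) ` (S x - {0}) =
        (\<lambda>c. Suc (ram (fam f) x)) ` (- {0::'a})"
      unfolding eq image_image by (intro image_cong refl ram_index_bform[OF assms(2)]) simp
    also have "\<dots> = {Suc (ram (fam f) x)}"
      by (rule image_constant[of 1]) simp
    finally show ?thesis
      unfolding line_ram_mult_def ram_mult_def restrict by simp
  qed
  have "{P \<in> P1_points. line_ram_mult f P > 0} = S ` {x. ram (fam f) x > 0}"
    unfolding P1_points_eq S_def[symmetric] using mult by auto
  then have "ramification_type f = image_mset (line_ram_mult f) (mset_set (S ` {x. ram (fam f) x > 0}))"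
    by (simp add: ramification_type_def)
  also have "mset_set (S ` {x. ram (fam f) x > 0}) = image_mset S (mset_set {x. ram (fam f) x > 0})"
    by (rule image_mset_mset_set[symmetric]) (rule inj_on_subset[OF inj subset_UNIV])
  finally show ?thesis by (simp add: image_mset.compositionality o_def mult)
qed

section \<open>The function \<open>\<bb>\<^sub>1\<close>\<close>

lemma rat_on_line_eq:
  fixes f :: "'a::field mpoly4"
  assumes "homogeneous d f"
  shows "rat_on_line f = to_fract bX1 ^ d * at_ratio (dehom d f)"
proof -
  have "degree (dehom d f) \<le> d" by (rule degree_le) (simp add: coeff_dehom)
  then show ?thesis unfolding restrict_line_bform[OF assms] by (rule to_fract_bform)
qed

context
  fixes f :: "'a::{alg_closed_field, field_char_0} mpoly4"
  assumes hom: "homogeneous 5 f" and smooth: "smooth_quintic (fam f)"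
begin

lemma rat_first:
  "rat_on_line (partial 3 f) = to_fract bX1 ^ 4 * at_ratio (fam f 1 0)"
  "rat_on_line (partial 4 f) = to_fract bX1 ^ 4 * at_ratio (fam f 0 1)"
proof -
  have "homogeneous 4 (partial i f)" for i
    using hom by (intro homogeneous_partial) (simp add: numeral_eq_Suc)
  from rat_on_line_eq[OF this]
  show "rat_on_line (partial 3 f) = to_fract bX1 ^ 4 * at_ratio (fam f 1 0)"
    "rat_on_line (partial 4 f) = to_fract bX1 ^ 4 * at_ratio (fam f 0 1)"
    by (simp_all only: dehom_first)
qed

lemma rat_second:
  "rat_on_line (partial i (partial j f)) = to_fract bX1 ^ 3 * at_ratio (dehom 3 (partial i (partial j f)))"
  by (rule rat_on_line_eq)
    (use hom homogeneous_partial[of 4 f j] homogeneous_partial[of 3 "partial j f" i] in simp)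

lemma rat_dd:
  "rat_on_line (dd i f) = to_fract bX1 ^ 7 *
    at_ratio (dehom 3 (partial i (partial 3 f)) * fam f 0 1 - dehom 3 (partial i (partial 4 f)) * fam f 1 0)"
proof -
  have "to_fract (bX1 :: 'a poly poly) ^ 7 = to_fract bX1 ^ 3 * to_fract bX1 ^ 4"
    by (simp only: power_add[symmetric]) simp
  then show ?thesis
    unfolding dd_def restrict_line_hom to_fract_diff to_fract_mult rat_first rat_second
      at_ratio_diff at_ratio_mult
    by (simp only: right_diff_distrib mult_ac)
qed

lemma jac_fam: "jac (fam f) = pderiv (fam f 1 0) * fam f 0 1 - pderiv (fam f 0 1) * fam f 1 0"
  by (simp add: jac_def contact_coeff_def hasse_1)

lemma at_ratio_jac_nonzero: "at_ratio (jac (fam f)) \<noteq> 0"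
  using smooth_quintic.jac_nonzero[OF smooth] at_ratio_eq_0 by blast

lemma at_ratio_b_nonzero: "at_ratio (fam f 0 1) \<noteq> 0"
proof
  assume "at_ratio (fam f 0 1) = 0"
  then have b: "fam f 0 1 = 0" by (rule at_ratio_eq_0)
  have "coeff (fam f 1 0) 4 \<noteq> 0" using smooth_quintic.base_infinite[OF smooth] b by simp
  then have "degree (fam f 1 0) > 0" using le_degree[of "fam f 1 0" 4] by simp
  then obtain t where "poly (fam f 1 0) t = 0" using alg_closed_imp_poly_has_root by blast
  then show False using smooth_quintic.base_finite[OF smooth, of t] b by simp
qed

text \<open>By Euler's relation the terms 4 a b cancel in \<open>dd 1 f\<close>: up to the factor
  x_1^7 it becomes -t J, and \<open>dd 2 f\<close> is J.\<close>

lemma ratA_eq: "ratA f = at_ratio [:0, 1:]"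
proof -
  let ?J = "jac (fam f)"
  have "dehom 3 (partial 1 (partial 3 f)) * fam f 0 1 - dehom 3 (partial 1 (partial 4 f)) * fam f 1 0 =
      - ([:0, 1:] * ?J)"
    unfolding dehom_euler jac_fam by algebra
  then have "rat_on_line (dd 1 f) = - (to_fract bX1 ^ 7 * (at_ratio [:0, 1:] * at_ratio ?J))"
    unfolding rat_dd by (simp only: at_ratio_uminus at_ratio_mult mult_minus_right)
  moreover have "rat_on_line (dd 2 f) = to_fract bX1 ^ 7 * at_ratio ?J"
    unfolding rat_dd dehom_second jac_fam ..
  ultimately show ?thesis
    unfolding ratA_def using at_ratio_jac_nonzero bX1_nonzero by simp
qed

lemma ratC_eq: "ratC f = - (at_ratio (fam f 1 0) / at_ratio (fam f 0 1))"
  unfolding ratC_def rat_first using bX1_nonzero by simp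

text \<open>Together with \<open>ratC_eq\<close> this explains B and C: the tangent direction (0, z,
  w b, -w a) with z = -\<open>contact_coeff (fam f) 2 0\<close> and w = J, scaled to third
  coordinate 1, is (0, B, 1, C).\<close>

lemma ratB_eq:
  "ratB f = - at_ratio (contact_coeff (fam f) 2 0) / (at_ratio (jac (fam f)) * at_ratio (fam f 0 1))"
proof -
  let ?x = "to_fract (bX1 :: 'a poly poly)"
  define a b where "a = fam f 1 0" and "b = fam f 0 1"
  have q: "contact_coeff (fam f) 2 0 = fam f 2 0 * b * b - fam f 1 1 * b * a + fam f 0 2 * a * a"
    by (simp add: contact_coeff_def numeral_eq_Suc a_def b_def)
  have "a * (fam f 1 1 * b - 2 * fam f 0 2 * a) - b * (2 * fam f 2 0 * b - fam f 1 1 * a) =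
      - (2 * contact_coeff (fam f) 2 0)"
    unfolding q by (simp add: algebra_simps)
  then have E: "at_ratio a * at_ratio (fam f 1 1 * b - 2 * fam f 0 2 * a) -
      at_ratio b * at_ratio (2 * fam f 2 0 * b - fam f 1 1 * a) = - (2 * at_ratio (contact_coeff (fam f) 2 0))"
    using at_ratio_of_nat[of 2, where 'a = 'a]
    by (simp only: at_ratio_mult[symmetric] at_ratio_diff[symmetric] at_ratio_uminus)
      (simp add: at_ratio_mult)
  have scale: "c * u - d * v = - (2 * q) \<Longrightarrow>
      (y * c) * (z * u) - (y * d) * (z * v) = - (2 * (y * z * q))" for c d u v q y z :: "'a poly poly fract"
    by algebra
  have num: "rat_on_line (partial 3 f * dd 4 f - partial 4 f * dd 3 f) =
      - (2 * (?x ^ 4 * ?x ^ 7 * at_ratio (contact_coeff (fam f) 2 0)))"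
    unfolding restrict_line_hom to_fract_diff to_fract_mult rat_first rat_dd dehom_second
      a_def[symmetric] b_def[symmetric] by (rule scale[OF E])
  have den: "rat_on_line (dd 2 f) = ?x ^ 7 * at_ratio (jac (fam f))"
    unfolding rat_dd dehom_second jac_fam ..
  have two: "(2 :: 'a poly poly fract) \<noteq> 0"
  proof
    assume "(2 :: 'a poly poly fract) = 0"
    then have "at_ratio (of_nat 2 :: 'a poly) = 0"
      using at_ratio_of_nat[of 2, where 'a = 'a] by simp
    then have "(of_nat 2 :: 'a poly) = 0" by (rule at_ratio_eq_0)
    then show False by simp
  qed
  have cancel: "y \<noteq> 0 \<Longrightarrow> z \<noteq> 0 \<Longrightarrow> (2 :: 'a poly poly fract) \<noteq> 0 \<Longrightarrow> j \<noteq> 0 \<Longrightarrow> k \<noteq> 0 \<Longrightarrow>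
      - (2 * (y * z * q)) / (2 * (z * j) * (y * k)) = - q / (j * k)" for y z j k q :: "'a poly poly fract"
    by (simp add: field_simps)
  show ?thesis
    unfolding ratB_def rat_first num den
    by (rule cancel[OF _ _ two])
      (use at_ratio_jac_nonzero bX1_nonzero at_ratio_b_nonzero in simp_all)
qed

text \<open>\<open>fam f i (n - i)\<close> has degree at most 5 - n, so its Hasse derivative of
  order 4 - n is linear; j = 0 and j = 1 give its two coefficients, evaluated at A =
  x_2/x_1.\<close>

lemma inner_sum:
  assumes "n \<le> 4" "i \<le> n"
  shows "(\<Sum>j\<le>1. of_nat ((5 - (n + j)) choose (4 - n)) *
      to_fract (bconst (alpha f i (n - i) j (5 - (n + j)))) * ratA f ^ (1 - j)) =
    at_ratio (hasse (4 - n) (fam f i (n - i)))"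
proof -
  let ?p = "fam f i (n - i)"
  have idx: "5 - i - (n - i) = 5 - n" "5 - n = Suc (4 - n)" using assms by simp_all
  have c: "coeff ?p (5 - n) = alpha f i (n - i) 0 (5 - n)"
    "coeff ?p (4 - n) = alpha f i (n - i) 1 (4 - n)"
    unfolding coeff_fam idx(1) using assms by simp_all
  have "hasse (4 - n) ?p = smult (of_nat ((5 - n) choose (4 - n)) * coeff ?p (5 - n)) [:0, 1:] +
      [:coeff ?p (4 - n):]"
  proof (rule poly_eqI)
    fix k :: nat
    consider "k = 0" | "k = 1" | "k \<ge> 2" by linarith
    then show "coeff (hasse (4 - n) ?p) k =
        coeff (smult (of_nat ((5 - n) choose (4 - n)) * coeff ?p (5 - n)) [:0, 1:] + [:coeff ?p (4 - n):]) k"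
    proof cases
      case 2
      then show ?thesis by (simp add: coeff_hasse idx)
    next
      case 3
      then have "coeff ?p (k + (4 - n)) = 0" using assms by (simp add: coeff_fam idx)
      then show ?thesis using 3 by (simp add: coeff_hasse coeff_pCons split: nat.splits)
    qed (simp add: coeff_hasse)
  qed
  moreover have "to_fract (bconst (of_nat m * x)) = of_nat m * to_fract (bconst x)" for m and x :: 'a
    by (induction m) (simp_all add: to_fract_bconst algebra_simps del: to_fract_mult)
  ultimately have "at_ratio (hasse (4 - n) ?p) =
      of_nat ((5 - n) choose (4 - n)) * to_fract (bconst (coeff ?p (5 - n))) * ratA f +
      to_fract (bconst (coeff ?p (4 - n)))"
    by (simp only: at_ratio_add at_ratio_smult at_ratio_const ratA_eq)
  then show ?thesis unfolding c by simp
qed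

lemma b1_eq:
  "b1 f = (\<Sum>n\<le>4. \<Sum>i\<le>n.
    ratB f ^ (4 - n) * ratC f ^ (n - i) * at_ratio (hasse (4 - n) (fam f i (n - i))))"
proof -
  define g where "g = (\<lambda>(j1, j2, j3). of_nat ((5 - (j1 + j2 + j3)) choose (4 - (j1 + j2))) *
      to_fract (bconst (alpha f j1 j2 j3 (5 - (j1 + j2 + j3)))) *
      ratA f ^ (1 - j3) * ratB f ^ (4 - (j1 + j2)) * ratC f ^ j2)"
  define S where "S = (SIGMA n:{..4::nat}. SIGMA i:{..n}. {..1::nat})"
  define \<phi> where "\<phi> = (\<lambda>(n :: nat, i :: nat, j :: nat). (i, n - i, j))"
  have inj: "inj_on \<phi> S" by (rule inj_onI) (auto simp: \<phi>_def S_def)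
  have im: "\<phi> ` S = {(j1, j2, j3). j1 + j2 \<le> 4 \<and> j3 \<le> 1}"
  proof (intro equalityI subsetI)
    fix x :: "nat \<times> nat \<times> nat" assume "x \<in> {(j1, j2, j3). j1 + j2 \<le> 4 \<and> j3 \<le> 1}"
    then obtain i j k where x: "x = (i, j, k)" "i + j \<le> 4" "k \<le> 1" by auto
    then have "x = \<phi> (i + j, i, k)" "(i + j, i, k) \<in> S" by (auto simp: \<phi>_def S_def)
    then show "x \<in> \<phi> ` S" by blast
  qed (auto simp: \<phi>_def S_def)
  have "b1 f = sum g (\<phi> ` S)" unfolding b1_def im g_def ..
  also have "\<dots> = sum (g \<circ> \<phi>) S" by (rule sum.reindex[OF inj])
  also have "\<dots> = (\<Sum>n\<le>4. \<Sum>i\<le>n. \<Sum>j\<le>1. g (i, n - i, j))"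
  proof -
    have "(\<Sum>n\<le>4. \<Sum>i\<le>n. \<Sum>j\<le>1. g (i, n - i, j)) =
        (\<Sum>n\<le>4. \<Sum>(i, j)\<in>(SIGMA i:{..n}. {..1}). g (i, n - i, j))"
      by (intro sum.cong refl sum.Sigma) auto
    also have "\<dots> = (\<Sum>(n, x)\<in>S. case x of (i, j) \<Rightarrow> g (i, n - i, j))"
      unfolding S_def by (rule sum.Sigma) auto
    finally show ?thesis by (simp add: \<phi>_def o_def split_def)
  qed
  also have "\<dots> = (\<Sum>n\<le>4. \<Sum>i\<le>n.
    ratB f ^ (4 - n) * ratC f ^ (n - i) * at_ratio (hasse (4 - n) (fam f i (n - i))))"
  proof (intro sum.cong refl)
    fix n i :: nat assume "n \<in> {..4}" "i \<in> {..n}"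
    then show "(\<Sum>j\<le>1. g (i, n - i, j)) =
        ratB f ^ (4 - n) * ratC f ^ (n - i) * at_ratio (hasse (4 - n) (fam f i (n - i)))"
      unfolding g_def prod.case
      by (subst inner_sum[symmetric]) (simp_all add: sum_distrib_left sum_distrib_right mult_ac algebra_simps)
  qed
  finally show ?thesis .
qed

text \<open>The contact of index 4 in the canonical direction, with an additional term n = 0 as in
  \<open>b1\<close>; that term belongs to \<open>G 0 0\<close>, the restriction to the line.\<close>

lemma jac_contact4_poly:
  assumes "G 0 0 = 0"
  shows "(\<Sum>n\<le>4. jac G ^ n * (- contact_coeff G 2 0) ^ (4 - n) * contact_coeff G n (4 - n)) = jac G * contact4_poly G"
proof -
  have "contact_coeff G 0 4 = 0" using assms by (simp add: contact_coeff_def hasse_eq_0)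
  then show ?thesis
    unfolding contact4_poly_def by (simp add: numeral_eq_Suc algebra_simps)
qed

text \<open>\<open>b1 f\<close> is the coefficient of s^4 along the tangent scaled as (0, B, 1, C);
  multiplication by (J b)^4 undoes the scaling and gives J times
  \<open>contact4_poly\<close>.\<close>

theorem b1_eq_0_iff: "b1 f = 0 \<longleftrightarrow> contact4_poly (fam f) = 0"
proof -
  let ?F = "fam f"
  define J a b q where "J = at_ratio (jac ?F)" and "a = at_ratio (?F 1 0)" and "b = at_ratio (?F 0 1)"
    and "q = at_ratio (contact_coeff ?F 2 0)"
  have J: "J \<noteq> 0" and b: "b \<noteq> 0"
    using at_ratio_jac_nonzero at_ratio_b_nonzero by (simp_all add: J_def b_def)
  have F00: "?F 0 0 = 0"
    using smooth by (simp add: smooth_quintic_def quintic_family_def)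
  have "(J * b) ^ 4 * b1 f =
      (\<Sum>n\<le>4. \<Sum>i\<le>n. J ^ n * (- q) ^ (4 - n) * (b ^ i * (- a) ^ (n - i) * at_ratio (hasse (4 - n) (?F i (n - i)))))"
    unfolding b1_eq sum_distrib_left
  proof (intro sum.cong refl)
    fix n i :: nat assume n: "n \<in> {..4}" and i: "i \<in> {..n}"
    have B: "(J * b) ^ (4 - n) * ratB f ^ (4 - n) = (- q) ^ (4 - n)"
      unfolding ratB_eq power_mult_distrib[symmetric] using J b
      by (simp add: J_def b_def q_def)
    have C: "b ^ (n - i) * ratC f ^ (n - i) = (- a) ^ (n - i)"
      unfolding ratC_eq power_mult_distrib[symmetric] using b by (simp add: a_def b_def)
    have 1: "(J * b) ^ 4 = (J * b) ^ (4 - n) * (J * b) ^ n" using n by (simp flip: power_add)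
    have 2: "b ^ n = b ^ i * b ^ (n - i)" using i by (simp flip: power_add)
    have eq: "(J * b) ^ 4 * (ratB f ^ (4 - n) * ratC f ^ (n - i) * h) =
        ((J * b) ^ (4 - n) * ratB f ^ (4 - n)) * J ^ n * b ^ i * (b ^ (n - i) * ratC f ^ (n - i)) * h" for h
      unfolding 1 power_mult_distrib[of J b n] 2 by (simp only: mult_ac)
    show "(J * b) ^ 4 * (ratB f ^ (4 - n) * ratC f ^ (n - i) * at_ratio (hasse (4 - n) (?F i (n - i)))) =
        J ^ n * (- q) ^ (4 - n) * (b ^ i * (- a) ^ (n - i) * at_ratio (hasse (4 - n) (?F i (n - i))))"
      unfolding eq B C by (simp only: mult_ac)
  qed
  also have "\<dots> = at_ratio (\<Sum>n\<le>4. jac ?F ^ n * (- contact_coeff ?F 2 0) ^ (4 - n) * contact_coeff ?F n (4 - n))"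
    unfolding contact_coeff_def[of ?F _ "4 - _"] J_def a_def b_def q_def at_ratio_sum at_ratio_mult at_ratio_power
      at_ratio_uminus sum_distrib_left
    by (simp only: mult_ac)
  also have "\<dots> = J * at_ratio (contact4_poly ?F)"
    unfolding jac_contact4_poly[of ?F, OF F00] at_ratio_mult J_def ..
  finally have "b1 f = 0 \<longleftrightarrow> at_ratio (contact4_poly ?F) = 0" using J b
    by (metis mult_eq_0_iff power_eq_0_iff mult_zero_right)
  then show ?thesis using at_ratio_eq_0[of "contact4_poly ?F"] by auto
qed

end

section \<open>Lines meeting a line on the surface\<close>

definition v4 :: "'a \<Rightarrow> 'a \<Rightarrow> 'a \<Rightarrow> 'a \<Rightarrow> 'a^4" where
  "v4 p q r s = (\<chi> i. if i = 1 then p else if i = 2 then q else if i = 3 then r else s)"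

lemma v4_nth [simp]: "v4 p q r s $ 1 = p" "v4 p q r s $ 2 = q" "v4 p q r s $ 3 = r" "v4 p q r s $ 4 = s"
  by (simp_all add: v4_def)

lemma vec4_eq_iff: "x = y \<longleftrightarrow> x $ 1 = y $ 1 \<and> x $ 2 = y $ 2 \<and> x $ 3 = y $ 3 \<and> x $ 4 = (y $ 4 :: 'a)"
  for x y :: "'a^4"
  by (simp add: vec_eq_iff forall_4)

lemma span_pair: "x \<in> vec.span {p, q} \<longleftrightarrow> (\<exists>\<alpha> \<beta>. x = \<alpha> *s p + \<beta> *s q)"
  for p q :: "'a::field^'n"
proof -
  have "x \<in> vec.span {p, q} \<longleftrightarrow> (\<exists>\<alpha> \<beta>. x - \<alpha> *s p = \<beta> *s q)"
    unfolding vec.span_insert[of p] vec.span_singleton by auto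
  then show ?thesis by (simp add: diff_eq_eq add.commute)
qed

lemma dim_pair:
  fixes p q :: "'a::field^'n"
  assumes "p \<noteq> 0" "\<And>c. q \<noteq> c *s p"
  shows "vec.dim (vec.span {p, q}) = 2"
proof -
  have "q \<notin> vec.span {p}" using assms(2) by (auto simp: vec.span_singleton)
  then have "vec.dim (insert q {p}) = 2"
    using assms(1) by (subst vec.dim_insert) simp
  then show ?thesis by (simp add: insert_commute)
qed

lemma eval4_scale:
  fixes f :: "'a::comm_ring_1 mpoly4"
  assumes "homogeneous d f"
  shows "eval4 f (c *s x) = c ^ d * eval4 f x"
  unfolding insertion_def sum_distrib_left
proof (intro sum.cong refl)
  fix m assume "m \<in> Poly_Mapping.keys f"
  then have "d = (\<Sum>i\<in>UNIV. Poly_Mapping.lookup m i)" using assms by (simp add: homogeneous_def)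
  then show "Poly_Mapping.lookup f m * (\<Prod>i\<in>UNIV. (c *s x) $ i ^ Poly_Mapping.lookup m i) =
      c ^ d * (Poly_Mapping.lookup f m * (\<Prod>i\<in>UNIV. x $ i ^ Poly_Mapping.lookup m i))"
    by (simp add: power_mult_distrib prod.distrib power_sum mult_ac)
qed

lemma sum_triangle_5:
  "(\<Sum>i\<le>5. \<Sum>j\<le>5-i. g i j) = (\<Sum>n\<le>5. \<Sum>i\<le>n. g i (n - i :: nat) :: 'b::comm_monoid_add)"
  by (simp add: numeral_eq_Suc add_ac)

locale quintic_with_line =
  fixes h :: "'a::{alg_closed_field, field_char_0} mpoly4"
  assumes hom: "homogeneous 5 h"
    and on_line: "\<And>y. y $ 3 = 0 \<Longrightarrow> y $ 4 = 0 \<Longrightarrow> eval4 h y = 0"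
    and smooth: "\<And>y. y $ 3 = 0 \<Longrightarrow> y $ 4 = 0 \<Longrightarrow> y \<noteq> 0 \<Longrightarrow>
      eval4 (partial 3 h) y \<noteq> 0 \<or> eval4 (partial 4 h) y \<noteq> 0"
begin

abbreviation F where "F \<equiv> fam h"

definition base :: "'a option \<Rightarrow> 'a^4" where
  "base x = (case x of Some t \<Rightarrow> v4 1 t 0 0 | None \<Rightarrow> v4 0 1 0 0)"

definition aval :: "'a option \<Rightarrow> 'a" where
  "aval x = (case x of Some t \<Rightarrow> poly (F 1 0) t | None \<Rightarrow> coeff (F 1 0) 4)"

definition bval :: "'a option \<Rightarrow> 'a" where
  "bval x = (case x of Some t \<Rightarrow> poly (F 0 1) t | None \<Rightarrow> coeff (F 0 1) 4)"

text \<open>Normalised modulo the base point: the coordinate in which \<open>base x\<close> is 1 is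
  set to 0, and (b, -a) is the tangent plane modulo the line.\<close>

definition direction :: "'a option \<Rightarrow> 'a \<Rightarrow> 'a^4" where
  "direction x z = (case x of Some t \<Rightarrow> v4 0 z (bval x) (- aval x) | None \<Rightarrow> v4 z 0 (bval x) (- aval x))"

lemma base_nth: "base x $ 3 = 0" "base x $ 4 = 0"
  by (simp_all add: base_def split: option.splits)

lemma direction_nth: "direction x z $ 3 = bval x" "direction x z $ 4 = - aval x"
  by (simp_all add: direction_def split: option.splits)

lemma base_nonzero: "base x \<noteq> 0"
  by (auto simp: base_def vec4_eq_iff split: option.splits)

lemma partials_base: "eval4 (partial 3 h) (base x) = aval x" "eval4 (partial 4 h) (base x) = bval x"
  using degree_fam[of h 1 0] degree_fam[of h 0 1]
  by (simp_all add: eval4_partial_line[OF hom] base_nth)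
     (simp_all add: base_def aval_def bval_def hform_1 hform_0_1 split: option.splits)

lemma values_nonzero: "aval x \<noteq> 0 \<or> bval x \<noteq> 0"
  using smooth[of "base x"] base_nth base_nonzero by (simp add: partials_base)

lemma fam_0_0: "F 0 0 = 0"
proof -
  have "poly (F 0 0) t = 0" for t
  proof -
    have "eval4 h (v4 1 t 0 0) = (\<Sum>i\<le>5. \<Sum>j\<le>5-i. 0 ^ i * 0 ^ j * hform (5-i-j) (F i j) 1 t)"
      by (simp add: eval4_fam[OF hom])
    also have "\<dots> = hform 5 (F 0 0) 1 t" by (simp add: numeral_eq_Suc)
    also have "\<dots> = poly (F 0 0) t" using degree_fam[of h 0 0] by (simp add: hform_1)
    finally show ?thesis using on_line[of "v4 1 t 0 0"] by simp
  qed
  then show ?thesis using poly_all_0_iff_0 by auto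
qed

lemma quintic_family: "quintic_family F"
  by unfold_locales (rule degree_fam fam_0_0)+

lemma smooth_quintic: "smooth_quintic F"
proof -
  interpret quintic_family F by (rule quintic_family)
  show ?thesis
  proof
    show "poly (F 0 1) t \<noteq> 0 \<or> poly (F 1 0) t \<noteq> 0" for t
      using values_nonzero[of "Some t"] by (auto simp: aval_def bval_def)
    show "coeff (F 0 1) 4 \<noteq> 0 \<or> coeff (F 1 0) 4 \<noteq> 0"
      using values_nonzero[of None] by (auto simp: aval_def bval_def)
  qed
qed

lemma eval4_direction:
  "eval4 h (base x + s *s direction x z) =
    (case x of Some t \<Rightarrow> line_fun F t z 1 s | None \<Rightarrow> line_fun (flip F) 0 z 1 s)"
proof -
  have split: "(\<Sum>n\<le>5. g n) = g 0 + (\<Sum>n=1..5. g n)" for g :: "nat \<Rightarrow> 'a"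
    by (simp add: numeral_eq_Suc add_ac)
  have gen: "(\<Sum>i\<le>5. \<Sum>j\<le>5-i. (s * B) ^ i * (- (s * A)) ^ j * H i j) =
      (\<Sum>n=1..5. (s * 1) ^ n * (\<Sum>i\<le>n. B ^ i * (- A) ^ (n - i) * H i (n - i)))"
    if "H 0 0 = 0" for A B and H :: "nat \<Rightarrow> nat \<Rightarrow> 'a"
  proof -
    have "(\<Sum>i\<le>5. \<Sum>j\<le>5-i. (s * B) ^ i * (- (s * A)) ^ j * H i j) =
        (\<Sum>n\<le>5. \<Sum>i\<le>n. (s * B) ^ i * (- (s * A)) ^ (n - i) * H i (n - i))"
      by (rule sum_triangle_5)
    also have "\<dots> = (\<Sum>n=1..5. \<Sum>i\<le>n. (s * B) ^ i * (- (s * A)) ^ (n - i) * H i (n - i))"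
      by (subst split) (simp add: that)
    also have "\<dots> = (\<Sum>n=1..5. (s * 1) ^ n * (\<Sum>i\<le>n. B ^ i * (- A) ^ (n - i) * H i (n - i)))"
      unfolding sum_distrib_left
    proof (intro sum.cong refl)
      fix n i :: nat assume "i \<in> {..n}"
      then have "s ^ n = s ^ i * s ^ (n - i)" by (simp flip: power_add)
      moreover have "- (s * A) = s * (- A)" by simp
      ultimately show "(s * B) ^ i * (- (s * A)) ^ (n - i) * H i (n - i) =
          (s * 1) ^ n * (B ^ i * (- A) ^ (n - i) * H i (n - i))"
        by (simp only: power_mult_distrib power_one mult_1_left mult_1_right mult_ac)
    qed
    finally show ?thesis .
  qed
  have deg: "degree (F i j) \<le> 5 - i - j" for i j by (rule degree_fam)
  show ?thesis
  proof (cases x)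
    case (Some t)
    have fl: "hform (5-i-j) (F i j) 1 u = poly (F i j) u" for i j u
      using deg by (rule hform_1)
    show ?thesis
      unfolding eval4_fam[OF hom] Some line_fun_def option.case
      using gen[of "\<lambda>i j. poly (F i j) (t + s * z)" "poly (F 0 1) t" "poly (F 1 0) t"]
      by (simp add: base_def direction_def aval_def bval_def fl[simplified] fam_0_0 del: sum.atMost_Suc sum.cl_ivl_Suc)
  next
    case None
    have fl: "hform (5-i-j) (F i j) (s * z) 1 = poly (flip F i j) (0 + s * z)" for i j
      using hform_rev[of "5-i-j" "F i j" 1 "s * z"] by (simp add: flip_def hform_1 degree_rev_poly)
    have fl0: "poly (flip F 0 1) 0 = coeff (F 0 1) 4" "poly (flip F 1 0) 0 = coeff (F 1 0) 4"
      by (simp_all add: flip_def poly_0_coeff_0 coeff_rev_poly)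
    show ?thesis
      unfolding eval4_fam[OF hom] None line_fun_def option.case fl0
      using gen[of "\<lambda>i j. poly (flip F i j) (0 + s * z)" "coeff (F 0 1) 4" "coeff (F 1 0) 4"]
      by (simp add: base_def direction_def aval_def bval_def fl[simplified] fam_0_0 flip_def[of _ 0 0]
          del: sum.atMost_Suc sum.cl_ivl_Suc)
  qed
qed

lemma lines_through_iff:
  "z \<in> lines_through F x \<longleftrightarrow> (\<forall>s. eval4 h (base x + s *s direction x z) = 0)"
proof -
  interpret quintic_family F by (rule quintic_family)
  interpret flip: quintic_family "flip F" by (rule quintic_family_flip)
  have gen: "z \<in> lines_at G t \<longleftrightarrow> (\<forall>s. line_fun G t z 1 s = 0)"
    if G: "quintic_family G" for G :: "nat \<Rightarrow> nat \<Rightarrow> 'a poly" and t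
  proof -
    define p where "p = [:0, 0, contact G t 2 z 1, contact G t 3 z 1, contact G t 4 z 1, contact G t 5 z 1:]"
    have "line_fun G t z 1 s = poly p s" for s
      by (simp add: quintic_family.line_fun_expand[OF G] p_def numeral_eq_Suc algebra_simps)
    then have "(\<forall>s. line_fun G t z 1 s = 0) \<longleftrightarrow> p = 0" by (simp add: poly_all_0_iff_0)
    then show ?thesis by (simp add: p_def lines_at_iff)
  qed
  show ?thesis unfolding eval4_direction
    using gen[OF quintic_family] gen[OF quintic_family_flip]
    by (cases x) (simp_all add: lines_through_def)
qed

text \<open>The coefficient of s is the gradient paired with w. Its part along the line vanishes
  because the line lies on the surface, which leaves the third and fourth coordinates.\<close>

lemma tangent_direction:
  assumes "\<And>s. eval4 h (base x + s *s w) = 0"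
  shows "aval x * w $ 3 + bval x * w $ 4 = 0"
proof -
  have zero: "(\<Sum>i\<in>UNIV. w $ i * eval4 (partial i h) (base x)) = 0"
    if "\<And>s. eval4 h (base x + s *s w) = 0" for w
  proof -
    have "line_poly h (base x) w = 0"
      using that poly_all_0_iff_0 by (metis poly_line_poly)
    then show ?thesis by (simp flip: coeff_line_poly del: One_nat_def)
  qed
  have "(\<Sum>i\<in>UNIV. v4 (w $ 1) (w $ 2) 0 0 $ i * eval4 (partial i h) (base x)) = 0"
    by (rule zero, rule on_line) (simp_all add: base_nth)
  with zero[OF assms] show ?thesis
    by (simp add: sum_4 partials_base mult.commute)
qed

lemma base_plane_vector:
  assumes "y $ 3 = 0" "y $ 4 = 0" "y \<noteq> 0"
  obtains x c where "c \<noteq> 0" "y = c *s base x"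
proof (cases "y $ 1 = 0")
  case True
  then have "y $ 2 \<noteq> 0" "y = y $ 2 *s base None" using assms by (auto simp: vec4_eq_iff base_def)
  then show ?thesis by (rule that)
next
  case False
  then have "y = y $ 1 *s base (Some (y $ 2 / y $ 1))" using assms by (auto simp: vec4_eq_iff base_def)
  with False show ?thesis by (rule that)
qed

lemma normalise_direction:
  assumes "\<And>s. eval4 h (base x + s *s w) = 0" "w $ 3 \<noteq> 0 \<or> w $ 4 \<noteq> 0"
  obtains z \<kappa> e where "\<kappa> \<noteq> 0" "direction x z = \<kappa> *s w + e *s base x"
proof -
  have tan: "aval x * w $ 3 + bval x * w $ 4 = 0" by (rule tangent_direction[OF assms(1)])
  obtain k where k: "w $ 3 = k * bval x" "w $ 4 = - (k * aval x)"
  proof (cases "bval x = 0")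
    case True
    then have "aval x \<noteq> 0" "w $ 3 = 0" using tan values_nonzero[of x] by auto
    then show ?thesis using True by (intro that[of "- (w $ 4 / aval x)"]) simp_all
  next
    case False
    have "w $ 4 = - (w $ 3 / bval x * aval x)"
      using tan False by (simp add: field_simps eq_neg_iff_add_eq_0)
    then show ?thesis using False by (intro that[of "w $ 3 / bval x"]) simp_all
  qed
  have k0: "k \<noteq> 0" using assms(2) k by auto
  show ?thesis
  proof (cases x)
    case (Some t)
    have "direction x ((w $ 2 - w $ 1 * t) / k) = (1 / k) *s w + (- (w $ 1 / k)) *s base x"
      using k0 k by (simp add: vec4_eq_iff direction_def base_def Some field_simps)
    then show ?thesis by (rule that[rotated]) (use k0 in simp)
  next
    case None
    have "direction x (w $ 1 / k) = (1 / k) *s w + (- (w $ 2 / k)) *s base x"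
      using k0 k by (simp add: vec4_eq_iff direction_def base_def None field_simps)
    then show ?thesis by (rule that[rotated]) (use k0 in simp)
  qed
qed

text \<open>Homogeneity covers the combinations with nonzero coefficient of p; the multiples of w
  follow because a polynomial vanishing off 0 is zero.\<close>

lemma plane_in_cone:
  assumes "\<And>s. eval4 h (p + s *s w) = 0"
  shows "eval4 h (\<alpha> *s p + \<beta> *s w) = 0"
proof -
  have "poly (line_poly h (\<beta> *s w) p) \<gamma> = 0" if "\<gamma> \<notin> {0}" for \<gamma>
  proof -
    have "\<beta> *s w + \<gamma> *s p = \<gamma> *s (p + (\<beta> / \<gamma>) *s w)"
      using that by (simp add: vector_add_ldistrib add.commute)
    then have "eval4 h (\<beta> *s w + \<gamma> *s p) = \<gamma> ^ 5 * eval4 h (p + (\<beta> / \<gamma>) *s w)"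
      by (simp only: eval4_scale[OF hom])
    then show ?thesis by (simp only: poly_line_poly assms mult_zero_right)
  qed
  then have "line_poly h (\<beta> *s w) p = 0"
    by (intro poly_eqI_cofinite[of "{0}"]) simp_all
  then show ?thesis using poly_line_poly[of h "\<beta> *s w" p \<alpha>] by (simp add: add.commute)
qed

lemma same_base:
  assumes "base x = c *s base y"
  shows "x = y"
  using assms by (cases x; cases y) (auto simp: base_def vec4_eq_iff)

lemma same_direction:
  assumes "direction x z = \<alpha> *s base x + \<beta> *s direction x w"
  shows "z = w"
proof -
  have "bval x = \<beta> * bval x" "aval x = \<beta> * aval x"
    using assms by (simp_all add: vec4_eq_iff direction_nth base_nth)
  then have "\<beta> = 1" using values_nonzero[of x] by auto
  then show ?thesis using assms
    by (cases x) (simp_all add: vec4_eq_iff direction_def base_def)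
qed

end

text \<open>A line on the surface that meets L and differs from it has exactly one point x on L, and
  together with that point a unique normalised \<open>direction\<close> spans it.\<close>

theorem card_lines_meeting:
  fixes f :: "'a::{alg_closed_field, field_char_0} mpoly4"
  assumes surface: "smooth_surface_eq 5 f" and L: "proj_line L" "L \<subseteq> cone_of f"
    and T: "adapted_coords T L"
  defines "h \<equiv> in_coords T f"
  shows "homogeneous 5 h" "smooth_quintic (fam h)"
    "\<exists>\<Phi>. bij_betw \<Phi> (Sigma UNIV (lines_through (fam h))) (lines_meeting f L)"
proof -
  have inv: "invertible T" and L_eq: "L = (\<lambda>y. T *v y) ` {y. y $ 3 = 0 \<and> y $ 4 = 0}"
    using T by (simp_all add: adapted_coords_def)
  obtain T' where T': "T ** T' = mat 1" "T' ** T = mat 1" using inv by (auto simp: invertible_def)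
  have TT': "T *v (T' *v x) = x" "T' *v (T *v x) = x" for x
    by (simp_all add: matrix_vector_mul_assoc T')
  have T_inj: "T *v x = T *v y \<longleftrightarrow> x = y" for x y using TT' by metis
  have T_comb: "T *v (\<alpha> *s x + \<beta> *s y) = \<alpha> *s (T *v x) + \<beta> *s (T *v y)" for \<alpha> \<beta> x y
    by (simp add: matrix_vector_right_distrib vector_scalar_commute)
  have T_0: "T *v x = 0 \<longleftrightarrow> x = 0" for x using T_inj[of x 0] by simp
  have in_L: "T *v y \<in> L \<longleftrightarrow> y $ 3 = 0 \<and> y $ 4 = 0" for y
    unfolding L_eq using T_inj by auto
  have h_eval: "eval4 h y = eval4 f (T *v y)" for y unfolding h_def by (rule eval4_in_coords)
  show hom: "homogeneous 5 h"
    using surface unfolding h_def smooth_surface_eq_def by (intro homogeneous_in_coords) simp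
  have on_line: "eval4 h y = 0" if "y $ 3 = 0" "y $ 4 = 0" for y
    using L(2) in_L[of y] that by (auto simp: h_eval cone_of_def)
  have smooth: "eval4 (partial 3 h) y \<noteq> 0 \<or> eval4 (partial 4 h) y \<noteq> 0"
    if y: "y $ 3 = 0" "y $ 4 = 0" "y \<noteq> 0" for y
  proof (rule ccontr)
    assume "\<not> ?thesis"
    then have p34: "eval4 (partial 3 h) y = 0" "eval4 (partial 4 h) y = 0" by simp_all
    \<comment> \<open>Smoothness is transported through lines: all linear coefficients of h at y
      vanish, those along the line because it lies on the surface, so those of f at T y vanish too,
      and with them its gradient.\<close>
    have lp: "line_poly h y w = line_poly f (T *v y) (T *v w)" for w
      by (rule poly_eqI_cofinite[of "{}"]) (simp_all only: poly_line_poly h_eval matrix_vector_line finite.emptyI)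
    have sum_h: "(\<Sum>i\<in>UNIV. w $ i * eval4 (partial i h) y) =
        (\<Sum>i\<in>UNIV. v4 (w $ 1) (w $ 2) 0 0 $ i * eval4 (partial i h) y)" for w
      by (simp add: sum_4 p34)
    have line_0: "line_poly h y (v4 a b 0 0) = 0" for a b
    proof (rule poly_eqI_cofinite[of "{}"])
      fix s
      have "eval4 h (y + s *s v4 a b 0 0) = 0" by (rule on_line) (simp_all add: y)
      then show "poly (line_poly h y (v4 a b 0 0)) s = poly 0 s" by (simp only: poly_line_poly poly_0)
    qed simp
    have "coeff (line_poly h y w) 1 = coeff (line_poly h y (v4 (w $ 1) (w $ 2) 0 0)) 1" for w
      unfolding coeff_line_poly by (rule sum_h)
    then have "coeff (line_poly h y w) 1 = 0" for w by (simp only: line_0 coeff_0)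
    then have "coeff (line_poly f (T *v y) u) 1 = 0" for u
      using lp[of "T' *v u"] TT' by metis
    then have sum_f: "(\<Sum>i\<in>UNIV. u $ i * eval4 (partial i f) (T *v y)) = 0" for u
      by (simp only: coeff_line_poly)
    have "eval4 (partial i f) (T *v y) = 0" for i
    proof -
      have "(\<Sum>j\<in>UNIV. (\<chi> j. if j = i then 1 else 0) $ j * eval4 (partial j f) (T *v y)) =
          (\<Sum>j\<in>UNIV. if j = i then eval4 (partial j f) (T *v y) else 0)"
        by (intro sum.cong) simp_all
      then show ?thesis using sum_f[of "\<chi> j. if j = i then 1 else 0"] by simp
    qed
    moreover have "eval4 f (T *v y) = 0" using on_line[OF y(1,2)] by (simp only: h_eval)
    moreover have "T *v y \<noteq> 0" using y(3) T_0 by simp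
    ultimately show False using surface unfolding smooth_surface_eq_def by blast
  qed
  interpret quintic_with_line h
    using hom on_line smooth by unfold_locales
  let ?F = "fam h"
  show "smooth_quintic ?F" by (rule smooth_quintic)
  define P where "P x = T *v base x" for x :: "'a option"
  define V where "V x z = T *v direction x z" for x z
  define \<Phi> where "\<Phi> = (\<lambda>(x, z). vec.span {P x, V x z})"
  have P_nz: "P x \<noteq> 0" for x unfolding P_def T_0 by (rule base_nonzero)
  have comb: "\<alpha> *s P x + \<beta> *s V x z = T *v (\<alpha> *s base x + \<beta> *s direction x z)" for \<alpha> \<beta> x z
    by (simp add: P_def V_def T_comb)
  have V_notin: "\<beta> = 0" if "\<alpha> *s P x + \<beta> *s V x z \<in> L" for \<alpha> \<beta> x z
  proof -
    have "\<beta> * bval x = 0" "\<beta> * aval x = 0"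
      using that unfolding comb in_L by (simp_all add: base_nth direction_nth)
    then show ?thesis using values_nonzero[of x] by auto
  qed
  have dim: "vec.dim (vec.span {P x, V x z}) = 2" for x z
  proof (rule dim_pair[OF P_nz])
    fix c
    show "V x z \<noteq> c *s P x"
    proof
      assume "V x z = c *s P x"
      then have "0 *s P x + 1 *s V x z = T *v (c *s base x)"
        by (simp add: P_def vector_scalar_commute)
      moreover have "T *v (c *s base x) \<in> L" unfolding in_L by (simp add: base_nth)
      ultimately have "0 *s P x + 1 *s V x z \<in> L" by simp
      from V_notin[OF this] show False by simp
    qed
  qed
  have "inj_on \<Phi> (Sigma UNIV (lines_through ?F))"
  proof (rule inj_onI)
    fix u u' assume eq: "\<Phi> u = \<Phi> u'"
    obtain x z x' z' where u: "u = (x, z)" "u' = (x', z')" by (metis surj_pair)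
    have sub: "P x \<in> vec.span {P x', V x' z'}" "V x z \<in> vec.span {P x', V x' z'}"
      using eq unfolding u \<Phi>_def prod.case by (auto intro: vec.span_base simp flip: eq)
    then obtain \<alpha> \<beta> where 1: "P x = \<alpha> *s P x' + \<beta> *s V x' z'" by (auto simp: span_pair)
    have "P x \<in> L" unfolding P_def in_L by (simp add: base_nth)
    then have "\<beta> = 0" using V_notin 1 by metis
    then have "T *v base x = T *v (\<alpha> *s base x')" using 1 by (simp add: P_def vector_scalar_commute)
    then have x: "x = x'" unfolding T_inj by (rule same_base)
    obtain \<alpha> \<beta> where "V x z = \<alpha> *s P x' + \<beta> *s V x' z'" using sub(2) by (auto simp: span_pair)
    then have "T *v direction x z = T *v (\<alpha> *s base x + \<beta> *s direction x z')"
      unfolding comb x by (simp only: V_def)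
    then have "direction x z = \<alpha> *s base x + \<beta> *s direction x z'"
      unfolding T_inj .
    then show "u = u'" using same_direction x u by blast
  qed
  moreover have "\<Phi> ` Sigma UNIV (lines_through ?F) = lines_meeting f L"
  proof (intro equalityI subsetI)
    fix M assume "M \<in> \<Phi> ` Sigma UNIV (lines_through ?F)"
    then obtain x z where M: "M = vec.span {P x, V x z}" and z: "z \<in> lines_through ?F x"
      by (auto simp: \<Phi>_def)
    have "proj_line M" unfolding M proj_line_def using dim by simp
    moreover have "M \<subseteq> cone_of f"
    proof
      fix y assume "y \<in> M"
      then obtain \<alpha> \<beta> where "y = \<alpha> *s P x + \<beta> *s V x z" unfolding M by (auto simp: span_pair)
      moreover have "eval4 h (\<alpha> *s base x + \<beta> *s direction x z) = 0"
        using z unfolding lines_through_iff by (intro plane_in_cone) blast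
      ultimately show "y \<in> cone_of f" by (simp only: cone_of_def mem_Collect_eq comb h_eval)
    qed
    moreover have "V x z \<in> M" "P x \<in> M" unfolding M by (auto intro: vec.span_base)
    moreover have "V x z \<notin> L" using V_notin[of 0 x 1 z] by auto
    moreover have "P x \<in> L" unfolding P_def in_L by (simp add: base_nth)
    ultimately show "M \<in> lines_meeting f L"
      using P_nz[of x] unfolding lines_meeting_def by blast
  next
    fix M assume "M \<in> lines_meeting f L"
    then have M: "vec.subspace M" "vec.dim M = 2" "M \<subseteq> cone_of f" "M \<noteq> L" "M \<inter> L \<noteq> {0}"
      by (simp_all add: lines_meeting_def proj_line_def)
    have sL: "vec.subspace L" "vec.dim L = 2" using L(1) by (simp_all add: proj_line_def)
    have "0 \<in> M \<inter> L" using M(1) sL(1) vec.subspace_0 by blast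
    then obtain q where q: "q \<in> M" "q \<in> L" "q \<noteq> 0" using M(5) by blast
    obtain y where y: "q = T *v y" "y $ 3 = 0" "y $ 4 = 0" using q(2) unfolding L_eq by auto
    then have "y \<noteq> 0" using q(3) T_0 by metis
    then obtain x c where c: "c \<noteq> 0" "y = c *s base x"
      using base_plane_vector[OF y(2,3)] by metis
    have "\<not> M \<subseteq> L" using vec.subspace_dim_equal[OF M(1) sL(1)] M(2,4) sL(2) by auto
    then obtain v where v: "v \<in> M" "v \<notin> L" by auto
    define w where "w = T' *v v"
    have vw: "v = T *v w" by (simp add: w_def TT')
    have w: "w $ 3 \<noteq> 0 \<or> w $ 4 \<noteq> 0" using v(2) unfolding vw in_L by auto
    have "P x = (1 / c) *s q" using c y(1) by (simp add: P_def vector_scalar_commute)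
    then have Px: "P x \<in> M" using M(1) q(1) vec.subspace_scale by metis
    have in_M: "T *v (\<alpha> *s base x + \<beta> *s w) \<in> M" for \<alpha> \<beta>
      unfolding T_comb using M(1) Px v(1) unfolding P_def vw
      by (intro vec.subspace_add vec.subspace_scale)
    then have zero: "eval4 h (\<alpha> *s base x + \<beta> *s w) = 0" for \<alpha> \<beta>
      using M(3) unfolding h_eval cone_of_def by blast
    have "eval4 h (base x + s *s w) = 0" for s
      using zero[of 1 s] by (simp only: vector_smult_lid)
    then obtain z k e where z: "k \<noteq> 0" "direction x z = k *s w + e *s base x"
      using normalise_direction[OF _ w] by metis
    have "eval4 h (base x + s *s direction x z) = 0" for s
    proof -
      have "base x + s *s direction x z = (1 + s * e) *s base x + (s * k) *s w"
        unfolding z(2) by (simp add: vec4_eq_iff algebra_simps)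
      then show ?thesis by (simp only: zero)
    qed
    then have zl: "z \<in> lines_through ?F x" unfolding lines_through_iff by blast
    have "V x z \<in> M" unfolding V_def z(2) using in_M[of e k] by (simp only: add.commute)
    then have "vec.span {P x, V x z} \<subseteq> M" using M(1) Px by (intro vec.span_minimal) auto
    then have "vec.span {P x, V x z} = M"
      using M(1,2) dim by (intro vec.subspace_dim_equal) simp_all
    then show "M \<in> \<Phi> ` Sigma UNIV (lines_through ?F)"
      using zl by (intro image_eqI[of _ _ "(x, z)"]) (simp_all add: \<Phi>_def)
  qed
  ultimately show "\<exists>\<Phi>. bij_betw \<Phi> (Sigma UNIV (lines_through ?F)) (lines_meeting f L)"
    unfolding bij_betw_def by blast
qed

theorem corollary6p2:
  fixes f :: "'a::{alg_closed_field, field_char_0} mpoly4"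
    and L :: "('a^4) set"
    and T :: "'a^4^4"
  assumes "smooth_surface_eq 5 f"
    and "proj_line L"
    and "L \<subseteq> cone_of f"
    and "adapted_coords T L"
    and "card (lines_meeting f L) = 28"
  shows "(ramification_type (in_coords T f) = {#3, 3#} \<and> b1 (in_coords T f) = 0) \<or>
         (ramification_type (in_coords T f) = {#2, 2, 2#} \<and> b1 (in_coords T f) \<noteq> 0) \<or>
         ramification_type (in_coords T f) = {#2, 1, 1, 1, 1#}"
proof -
  define h where "h = in_coords T f"
  note h = card_lines_meeting[OF assms(1-4), folded h_def]
  obtain \<Phi> where \<Phi>: "bij_betw \<Phi> (Sigma UNIV (lines_through (fam h))) (lines_meeting f L)"
    using h(3) by blast
  \<comment> \<open>An infinite set has \<open>card\<close> equal to 0, so the value 28 entails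
    finiteness.\<close>
  have "finite (lines_meeting f L)" using assms(5) by (intro card_ge_0_finite) simp
  then have "finite (Sigma UNIV (lines_through (fam h)))"
    using bij_betw_finite[OF \<Phi>] by simp
  moreover have "card (Sigma UNIV (lines_through (fam h))) = 28"
    using bij_betw_same_card[OF \<Phi>] assms(5) by simp
  ultimately show ?thesis
    using smooth_quintic.ramification_of_28_lines[OF h(2)]
    unfolding h_def[symmetric] ramification_type_eq[OF h(1,2)] b1_eq_0_iff[OF h(1,2)] by blast
qed

end
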